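(* Let $F\subset\mathrm{Sym}^2(\mathbb{R}^n)$ be a cone subequation, $\Omega\subset\mathbb{R}^n$ a bounded domain, $x_1,\dots,x_k\in\Omega$ distinct, and for each $j$ let $h_j$ be a downward-pointing singular $F$-harmonic of polar type at $x_j$. Let $v,w\in\mathrm{USC}(\overline\Omega\setminus\{x_1,\dots,x_k\})$ with $v$ $F$-subharmonic and $w$ $\tilde F$-subharmonic on $\Omega\setminus\{x_1,\dots,x_k\}$, and suppose that for each $j$ there are constants $c_j,k_j$ with $v\le h_j+c_j$ and $w\le -h_j+k_j$ near $x_j$. If $v+w\le0$ on $\partial\Omega$, then $v+w\le0$ on $\Omega\setminus\{x_1,\dots,x_k\}$.
   Context: A cone subequation is a closed $F\subset\mathrm{Sym}^2(\mathbb{R}^n)$ with $A\in F,P\ge0\Rightarrow A+P\in F$ and $tF=F$ for $t>0$; its dual is $\tilde F=\{A:-A\notin\mathrm{Int}F\}$. For a set $G$ (here $F$ or $\tilde F$), an upper semicontinuous $u:X\to[-\infty,\infty)$ is $G$-subharmonic if for every $x_0\in X$ and every $C^2$ function $\phi$ with $u\le\phi$ near $x_0$ and $u(x_0)=\phi(x_0)$, $D^2\phi(x_0)\in G$. $u$ is $F$-harmonic if finite, continuous, $F$-subharmonic and $-u$ is $\tilde F$-subharmonic. A downward-pointing singular $F$-harmonic of polar type at $x_0$ is a continuous $[-\infty,\infty)$-valued $F$-subharmonic function $h$ on a neighborhood $U$ of $x_0$, $F$-harmonic on $U\setminus\{x_0\}$, with $h(x_0)=-\infty$ and $h>-\infty$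 on $U\setminus\{x_0\}$. *)

theory Defs
  imports "HOL-Analysis.Analysis"
begin

definition Sym2 :: "(real^'n^'n) set" where
  "Sym2 = {A. transpose A = A}"

definition psd :: "real^'n^'n \<Rightarrow> bool" where
  "psd P \<longleftrightarrow> transpose P = P \<and> (\<forall>\<xi>. 0 \<le> \<xi> \<bullet> (P *v \<xi>))"

definition cone_subequation :: "(real^'n^'n) set \<Rightarrow> bool" where
  "cone_subequation F \<longleftrightarrow> F \<subseteq> Sym2 \<and> closed F
     \<and> (\<forall>A\<in>F. \<forall>P. psd P \<longrightarrow> A + P \<in> F)
     \<and> (\<forall>t>0. (\<lambda>A. t *\<^sub>R A) ` F = F)"

definition sym_interior :: "(real^'n^'n) set \<Rightarrow> (real^'n^'n) set" where
  "sym_interior F = {A\<in>F. \<exists>e>0. \<forall>B\<in>Sym2. dist B A < e \<longrightarrow> B \<in> F}"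

definition dual_subeq :: "(real^'n^'n) set \<Rightarrow> (real^'n^'n) set" where
  "dual_subeq F = {A\<in>Sym2. - A \<notin> sym_interior F}"

definition C2_on_with :: "(real^'n \<Rightarrow> real) \<Rightarrow> (real^'n) set \<Rightarrow> (real^'n \<Rightarrow> real^'n)
   \<Rightarrow> (real^'n \<Rightarrow> real^'n^'n) \<Rightarrow> bool" where
  "C2_on_with \<phi> U g H \<longleftrightarrow> open U \<and>
     (\<forall>x\<in>U. (\<phi> has_derivative (\<lambda>h. g x \<bullet> h)) (at x)) \<and>
     (\<forall>x\<in>U. (g has_derivative (\<lambda>h. H x *v h)) (at x)) \<and>
     continuous_on U H"

definition usc_on :: "(real^'n) set \<Rightarrow> (real^'n \<Rightarrow> ereal) \<Rightarrow> bool" where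
  "usc_on X u \<longleftrightarrow> (\<forall>x\<in>X. u x \<noteq> \<infinity>) \<and>
     (\<forall>x\<in>X. \<forall>c. u x < c \<longrightarrow> (\<forall>\<^sub>F y in at x within X. u y < c))"

definition subharmonic_on :: "(real^'n^'n) set \<Rightarrow> (real^'n) set \<Rightarrow> (real^'n \<Rightarrow> ereal) \<Rightarrow> bool" where
  "subharmonic_on G X u \<longleftrightarrow> usc_on X u \<and>
     (\<forall>x0\<in>X. \<forall>\<phi> U g H. x0 \<in> U \<and> C2_on_with \<phi> U g H \<and>
        (\<forall>y\<in>U \<inter> X. u y \<le> ereal (\<phi> y)) \<and> u x0 = ereal (\<phi> x0) \<longrightarrow> H x0 \<in> G)"

definition harmonic_on :: "(real^'n^'n) set \<Rightarrow> (real^'n) set \<Rightarrow> (real^'n \<Rightarrow> ereal) \<Rightarrow> bool" where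
  "harmonic_on F X u \<longleftrightarrow> (\<forall>x\<in>X. u x \<noteq> \<infinity> \<and> u x \<noteq> -\<infinity>) \<and> continuous_on X u \<and>
     subharmonic_on F X u \<and> subharmonic_on (dual_subeq F) X (\<lambda>x. - u x)"

definition polar_singular_harmonic :: "(real^'n^'n) set \<Rightarrow> real^'n \<Rightarrow> (real^'n \<Rightarrow> ereal) \<Rightarrow> bool" where
  "polar_singular_harmonic F x0 h \<longleftrightarrow> (\<exists>U. open U \<and> x0 \<in> U \<and>
     continuous_on U h \<and> subharmonic_on F U h \<and> harmonic_on F (U - {x0}) h \<and>
     h x0 = -\<infinity> \<and> (\<forall>x\<in>U - {x0}. h x \<noteq> -\<infinity>))"

end

theory Submission
  imports Defs
begin

text \<open>
  If \<open>F\<close> is a cone then \<open>(1 + \<epsilon>) v\<close> is again \<open>F\<close>-subharmonic, and near a pole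
  \<open>(1 + \<epsilon>) v + w \<le> \<epsilon> h + const\<close> tends to \<open>-\<infinity>\<close>. So the poles can be cut out, the comparison
  principle gives \<open>(1 + \<epsilon>) v + w \<le> \<epsilon> sup v\<close>, and \<open>\<epsilon> \<rightarrow> 0\<close>.

  The comparison principle is proved without Alexandrov's theorem. A counterexample yields
  semiconvex sup-convolutions \<open>u\<close>, \<open>z\<close> such that \<open>u + z + \<delta> |x|\<^sup>2\<close> has an interior maximum.
  By Jensen's lemma the points where a small affine tilt of this sum is maximal form a set of
  positive measure, which therefore is not porous. Blowing up at such points and suitable scales
  produces an entire pair \<open>(u, z)\<close> with the same subharmonicity for which every point is a contact
  point, so that \<open>u\<close> and \<open>z\<close> are of class \<open>C\<^sup>1\<^sup>,\<^sup>1\<close>. The set of all such normalised pairs is compact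
  and invariant under scaling and recentring. A pair maximising \<open>z(e)\<close> is, after another blow-up,
  exactly quadratic along all lines of direction \<open>e\<close>; treating the coordinate directions in turn makes
  \<open>z\<close> a quadratic form with matrix \<open>A\<close> in the dual of \<open>F\<close>, while \<open>u \<le> - z - \<delta> |x|\<^sup>2\<close> forces
  \<open>- A - 2 \<delta> I\<close> into \<open>F\<close> and hence \<open>- A\<close> into the interior of \<open>F\<close>.
\<close>


subsection \<open>Porous sets, cluster points and semicontinuity\<close>

text \<open>The obstacle is that contact alone bounds \<open>u\<close> and \<open>z\<close> between
  paraboloids and gives no second-order expansion, so there are no Hessians to compare. The missing
  expansion is obtained from extremality: a function whose value at \<open>e\<close> is largest in a
  class stable under rescaling and recentring has no freedom left along \<open>e\<close>.
  Non-porosity is all that is asked of the contact set, since one sequence of centres and scales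
  along which the contact points become dense is enough. Limits are pointwise and taken along
  filters. Semiconvex functions with a common quadratic bound are uniformly Lipschitz on balls, so
  such limits still allow evaluation at moving points. The constant \<delta> survives every blow-up
  because rescaling divides by the square of the scale; it is the margin that finally contradicts
  the duality. At the poles the factor \<open>1 + \<epsilon>\<close> has to multiply
  \<open>v\<close>: near a pole \<open>w\<close> is bounded only by \<open>- h\<close>, which tends
  to plus infinity, so scaling \<open>w\<close> would leave \<open>- \<epsilon> h\<close>.\<close>

lemma porous_imp_negligible:
  fixes S :: "'a::euclidean_space set"
  assumes "compact S" and e: "0 < e" "e \<le> 1" and "0 < R"
    and pore: "\<And>x r. \<lbrakk>x \<in> S; 0 < r; r < R\<rbrakk> \<Longrightarrow> \<exists>y. dist x y < r \<and> ball y (e * r) \<inter> S = {}"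
  shows "negligible S"
  unfolding negligible_outer_le
proof (intro allI impI)
  fix \<eta> :: real assume "\<eta> > 0"
  \<comment> \<open>The ratio of the volumes of balls of radius \<open>10 * r\<close> and
    \<open>e * r\<close>; the 10 is the factor 5 of Vitali's lemma applied to doubled radii.\<close>
  define c where "c = (10 / e) ^ DIM('a)"
  have "c > 0" using e by (simp add: c_def)
  have "S \<in> sets lebesgue" using \<open>compact S\<close> by (simp add: borel_compact)
  then obtain U where U: "open U" "S \<subseteq> U" "U - S \<in> lmeasurable" 
    and mU: "emeasure lebesgue (U - S) < ennreal (\<eta> / c)"
    by (rule sets_lebesgue_outer_open[of S "\<eta> / c"]) (use \<open>\<eta> > 0\<close> \<open>c > 0\<close> in auto)
  have mU': "measure lebesgue (U - S) < \<eta> / c"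
    using mU U(3) \<open>\<eta> > 0\<close> \<open>c > 0\<close> by (simp add: emeasure_eq_measure2 ennreal_less_iff)
  have "\<exists>r y. 0 < r \<and> r < R \<and> ball x (2 * r) \<subseteq> U \<and> dist x y < r \<and> ball y (e * r) \<inter> S = {}" 
    if xS: "x \<in> S" for x
  proof -
    obtain d where d: "d > 0" "ball x d \<subseteq> U"
      using xS U(1,2) by (meson open_contains_ball subsetD)
    let ?r = "min (d/2) (R/2)"
    have "0 < ?r" "?r < R" "ball x (2 * ?r) \<subseteq> U"
      using d \<open>0 < R\<close> by (auto simp: subset_iff)
    then show ?thesis using pore[OF xS, of ?r] by blast
  qed
  then obtain \<rho> y where \<rho>: "\<forall>x\<in>S. 0 < \<rho> x \<and> \<rho> x < R \<and> ball x (2 * \<rho> x) \<subseteq> U 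
      \<and> dist x (y x) < \<rho> x \<and> ball (y x) (e * \<rho> x) \<inter> S = {}"
    by (metis (no_types))
  have cov: "S \<subseteq> (\<Union>x\<in>S. ball x (2 * \<rho> x))"
  proof
    fix x assume "x \<in> S"
    with \<rho> have "x \<in> ball x (2 * \<rho> x)" by simp
    then show "x \<in> (\<Union>x\<in>S. ball x (2 * \<rho> x))" using \<open>x \<in> S\<close> by blast
  qed
  obtain X where X: "X \<subseteq> S" "finite X" "S \<subseteq> (\<Union>x\<in>X. ball x (2 * \<rho> x))"
    using compactE_image[OF \<open>compact S\<close> _ cov] by blast
  have rad: "\<And>x. x \<in> X \<Longrightarrow> 0 < 2 * \<rho> x \<and> 2 * \<rho> x \<le> 2 * R"
    using \<rho> X(1) by fastforce
  obtain C where C: "C \<subseteq> X" "pairwise (\<lambda>i j. disjnt (ball i (2 * \<rho> i)) (ball j (2 * \<rho> j))) C"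
     "S \<subseteq> (\<Union>i\<in>C. ball i (5 * (2 * \<rho> i)))"
    by (rule Vitali_covering_lemma_balls[OF X(3) rad])
  have "finite C" "C \<subseteq> S" using C X finite_subset by blast+
  \<comment> \<open>As \<open>e \<le> 1\<close>, a pore fits into the doubled ball. The pores thus
    inherit disjointness from the Vitali family and lie in \<open>U - S\<close>, while occupying a
    fixed fraction of the balls that cover \<open>S\<close>.\<close>
  have pin: "ball (y x) (e * \<rho> x) \<subseteq> ball x (2 * \<rho> x)" if "x \<in> C" for x
  proof
    fix t assume "t \<in> ball (y x) (e * \<rho> x)"
    moreover have "e * \<rho> x \<le> \<rho> x" using e \<rho> that \<open>C \<subseteq> S\<close> by (simp add: subset_iff)
    ultimately show "t \<in> ball x (2 * \<rho> x)"
      using \<rho> that \<open>C \<subseteq> S\<close> dist_triangle[of x t "y x"] by (fastforce simp: subset_iff)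
  qed
  have disj: "pairwise (\<lambda>i j. disjnt (ball (y i) (e * \<rho> i)) (ball (y j) (e * \<rho> j))) C"
    using C(2) pin unfolding pairwise_def disjnt_def by blast
  let ?T = "\<Union>i\<in>C. ball i (5 * (2 * \<rho> i))"
  have "measure lebesgue ?T \<le> (\<Sum>i\<in>C. measure lebesgue (ball i (5 * (2 * \<rho> i))))"
    using \<open>finite C\<close> by (intro measure_UNION_le) auto
  also have "\<dots> = (\<Sum>i\<in>C. c * measure lebesgue (ball (y i) (e * \<rho> i)))"
  proof (rule sum.cong)
    fix i assume "i \<in> C"
    then have "\<rho> i > 0" using \<rho> \<open>C \<subseteq> S\<close> by blast
    then show "measure lebesgue (ball i (5 * (2 * \<rho> i))) = c * measure lebesgue (ball (y i) (e * \<rho> i))"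
      using e by (simp add: content_ball c_def power_divide power_mult_distrib)
  qed simp
  also have "\<dots> = c * measure lebesgue (\<Union>i\<in>C. ball (y i) (e * \<rho> i))"
    by (subst measure_UNION') (use \<open>finite C\<close> disj in \<open>auto simp: sum_distrib_left\<close>)
  also have "\<dots> \<le> c * measure lebesgue (U - S)"
  proof (intro mult_left_mono measure_mono_fmeasurable)
    show "(\<Union>i\<in>C. ball (y i) (e * \<rho> i)) \<subseteq> U - S"
      using pin \<rho> \<open>C \<subseteq> S\<close> by blast
  qed (use U \<open>c > 0\<close> \<open>finite C\<close> in \<open>auto intro!: sets.finite_UN\<close>)
  also have "\<dots> \<le> \<eta>" using mU' \<open>c > 0\<close> by (simp add: field_simps)
  finally have "measure lebesgue ?T \<le> \<eta>" .
  moreover have "?T \<in> lmeasurable" using \<open>finite C\<close> by (intro fmeasurable.finite_UN) auto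
  ultimately show "\<exists>T. S \<subseteq> T \<and> T \<in> lmeasurable \<and> measure lebesgue T \<le> \<eta>"
    using C(3) by blast
qed

text \<open>A cluster point of the image filter is a limit along a finer filter, namely the meet of
  \<open>F\<close> with the preimages of the neighbourhoods of \<open>l\<close>. Filters stand in
  for subsequences because a product of uncountably many intervals is compact but not sequentially
  compact.\<close>

lemma compact_cluster_filter:
  assumes "compact K" "F \<noteq> bot" and K: "eventually (\<lambda>i. s i \<in> K) F"
  obtains H l where "H \<le> F" "H \<noteq> bot" "l \<in> K" "(s \<longlongrightarrow> l) H"
proof -
  have "filtermap s F \<noteq> bot" using \<open>F \<noteq> bot\<close> by (simp add: filtermap_bot_iff)
  moreover have "eventually (\<lambda>f. f \<in> K) (filtermap s F)"
    using K by (simp add: eventually_filtermap)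
  ultimately obtain l where l: "l \<in> K" "inf (nhds l) (filtermap s F) \<noteq> bot"
    using \<open>compact K\<close> unfolding compact_filter by blast
  let ?H = "inf F (filtercomap s (nhds l))"
  have nb: "?H \<noteq> bot"
  proof
    assume "?H = bot"
    then have "eventually (\<lambda>_. False) ?H" by simp
    then obtain P Q where P: "eventually P F" and Q: "eventually Q (filtercomap s (nhds l))"
      and PQ: "\<And>i. P i \<and> Q i \<Longrightarrow> False"
      unfolding eventually_inf by blast
    obtain T where T: "eventually T (nhds l)" "\<And>i. T (s i) \<Longrightarrow> Q i"
      using Q unfolding eventually_filtercomap by blast
    have "eventually (\<lambda>f. \<not> T f) (filtermap s F)"
      unfolding eventually_filtermap using P by eventually_elim (use PQ T in blast)
    then have "eventually (\<lambda>_. False) (inf (nhds l) (filtermap s F))"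
      unfolding eventually_inf using T(1) by blast
    with l show False by (simp add: eventually_False)
  qed
  have "filterlim s (nhds l) ?H"
    unfolding filterlim_def by (metis filtermap_filtercomap filtermap_mono inf.cobounded2 order_trans)
  then show ?thesis using that[of ?H l] nb l(1) by auto
qed

text \<open>Tychonoff's theorem for the box of all functions bounded by \<open>B\<close>.\<close>

lemma pointwise_bounded_cluster:
  fixes s :: "'i \<Rightarrow> 'a \<Rightarrow> real"
  assumes "F \<noteq> bot" and B: "\<And>i y. \<bar>s i y\<bar> \<le> B y"
  obtains H l where "H \<le> F" "H \<noteq> bot" "\<And>y. ((\<lambda>i. s i y) \<longlongrightarrow> l y) H"
proof -
  let ?K = "PiE UNIV (\<lambda>y. {- B y..B y})"
  have "compactin (product_topology (\<lambda>_. euclidean) UNIV) ?K"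
    by (simp add: compactin_PiE)
  then have "compact ?K" by (simp add: euclidean_product_topology)
  moreover have "eventually (\<lambda>i. s i \<in> ?K) F"
    using B by (intro always_eventually) (auto simp: abs_le_iff minus_le_iff)
  ultimately obtain H l where H: "H \<le> F" "H \<noteq> bot" and sl: "(s \<longlongrightarrow> l) H"
    using compact_cluster_filter[OF _ \<open>F \<noteq> bot\<close>] by blast
  have ev: "((\<lambda>f. f y) \<longlongrightarrow> l y) (nhds l)" for y
    using continuous_on_product_coordinates[of y]
    by (intro tendsto_at_iff_tendsto_nhds[THEN iffD1]) (auto simp: continuous_on_def)
  show ?thesis using that[OF H filterlim_compose[OF ev sl]] .
qed

section \<open>Upper semicontinuous functions on compact sets\<close>

lemma usc_on_openin:
  assumes "usc_on X u"
  shows "openin (top_of_set X) {x\<in>X. u x < c}"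
  unfolding openin_subopen[of _ "{x\<in>X. u x < c}"]
proof
  fix x assume "x \<in> {x\<in>X. u x < c}"
  then have x: "x \<in> X" "u x < c" by auto
  then have "\<forall>\<^sub>F y in at x within X. u y < c" using assms by (auto simp: usc_on_def)
  then obtain S where "open S" "x \<in> S" "\<forall>y\<in>S. y \<noteq> x \<longrightarrow> y \<in> X \<longrightarrow> u y < c"
    unfolding eventually_at_topological by blast
  then show "\<exists>T. openin (top_of_set X) T \<and> x \<in> T \<and> T \<subseteq> {x \<in> X. u x < c}"
    using x by (intro exI[of _ "X \<inter> S"]) (auto simp: openin_open)
qed

text \<open>If no point were maximal, the relatively open sets where \<open>u\<close> lies below a
  value \<open>u y\<close> would cover \<open>K\<close>; the largest of the finitely many values of
  a subcover would then lie below another of them.\<close>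

lemma usc_on_attains_max:
  assumes "compact K" "K \<noteq> {}" and u: "usc_on K u"
  obtains x where "x \<in> K" "\<And>y. y \<in> K \<Longrightarrow> u y \<le> u x"
proof (rule ccontr)
  assume "\<not> thesis"
  with that have no: "\<forall>x\<in>K. \<exists>y\<in>K. u x < u y" by (meson not_le)
  have "\<forall>y. \<exists>T. open T \<and> {x\<in>K. u x < u y} = K \<inter> T"
    using usc_on_openin[OF u] by (auto simp: openin_open)
  then obtain T where T: "\<And>y. open (T y)" "\<And>y. {x\<in>K. u x < u y} = K \<inter> T y"
    by metis
  have "K \<subseteq> (\<Union>y\<in>K. T y)" using no T(2) by blast
  then obtain D where D: "D \<subseteq> K" "finite D" "K \<subseteq> (\<Union>y\<in>D. T y)"
    using compactE_image[OF \<open>compact K\<close>, of K T] T(1) by blast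
  then have "D \<noteq> {}" using \<open>K \<noteq> {}\<close> by blast
  then have "Max (u ` D) \<in> u ` D" using D(2) by (intro Max_in) auto
  then obtain y where y: "y \<in> D" "u y = Max (u ` D)" by auto
  then have ymax: "\<forall>z\<in>D. u z \<le> u y" using D(2) by simp
  obtain z where "z \<in> D" "y \<in> T z" using D y by blast
  then have "u y < u z" using T(2)[of z] y(1) D by blast
  with ymax \<open>z \<in> D\<close> show False by (simp add: leD)
qed

subsection \<open>Functions invariant under blow-up\<close>

text \<open>This identifies slopes: two paraboloids that touch a function at one point from opposite
  sides have the same gradient there.\<close>

lemma inner_le_quadratic_imp_zero:
  fixes p :: "'a::real_inner"
  assumes "\<And>y. p \<bullet> y \<le> C * (norm y)\<^sup>2"
  shows "p = 0"
proof (rule ccontr)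
  assume "p \<noteq> 0"
  define s where "s = 1 / (\<bar>C\<bar> + 1)"
  have "s > 0" by (simp add: s_def)
  have "s * (norm p)\<^sup>2 \<le> C * (s\<^sup>2 * (norm p)\<^sup>2)"
    using assms[of "s *\<^sub>R p"] by (simp add: power_mult_distrib dot_square_norm)
  then have "s * (norm p)\<^sup>2 * 1 \<le> s * (norm p)\<^sup>2 * (C * s)"
    by (simp add: power2_eq_square algebra_simps)
  then have "1 \<le> C * s" using \<open>s > 0\<close> \<open>p \<noteq> 0\<close> by (simp add: mult_le_cancel_left_pos del: mult_1_right)
  moreover have "C * s < 1" by (auto simp: s_def field_simps abs_if)
  ultimately show False by simp
qed

text \<open>By concavity a drop over one step, of either sign, recurs at least as large over every
  following step, which contradicts the bound.\<close>

lemma midpoint_concave_bounded_const: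
  fixes m :: "real \<Rightarrow> real"
  assumes mid: "\<And>t \<tau>. m (t + \<tau>) + m (t - \<tau>) \<le> 2 * m t" and bd: "\<And>t. \<bar>m t\<bar> \<le> C"
  shows "m t = m s"
proof -
  have step: "m (a + \<tau>) \<ge> m a" for a \<tau>
  proof (rule ccontr)
    assume "\<not> m (a + \<tau>) \<ge> m a"
    define e where "e = m a - m (a + \<tau>)"
    have "e > 0" using \<open>\<not> m (a + \<tau>) \<ge> m a\<close> by (simp add: e_def)
    have dec: "m (a + real (Suc n) * \<tau>) \<le> m (a + real n * \<tau>) - e" for n
    proof (induction n)
      case 0 then show ?case by (simp add: e_def)
    next
      case (Suc n)
      have eq: "a + real (Suc n) * \<tau> + \<tau> = a + real (Suc (Suc n)) * \<tau>"
        "a + real (Suc n) * \<tau> - \<tau> = a + real n * \<tau>"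
        by (simp_all add: algebra_simps)
      show ?case using mid[of "a + real (Suc n) * \<tau>" \<tau>] Suc unfolding eq by linarith
    qed
    have lin: "m (a + real n * \<tau>) \<le> m a - real n * e" for n
    proof (induction n)
      case (Suc n)
      then show ?case using dec[of n] by (simp add: algebra_simps)
    qed simp
    obtain n where "real n * e > 2 * C"
      using \<open>e > 0\<close> reals_Archimedean3 by blast
    with lin[of n] bd[of a] bd[of "a + real n * \<tau>"] show False by (simp add: abs_le_iff)
  qed
  show ?thesis using step[of t "s - t"] step[of s "t - s"] by simp
qed

text \<open>Subtracting the linear function with the same value at 1 leaves an additive function
  that vanishes at the integers, hence is periodic and globally bounded. A bounded additive function
  is zero, as its multiples stay bounded.\<close>

lemma additive_locally_bounded_imp_scaleR:
  fixes b :: "real \<Rightarrow> 'a::real_normed_vector"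
  assumes add: "\<And>s t. b (s + t) = b s + b t" and bd: "\<And>t. \<lbrakk>0 \<le> t; t \<le> 1\<rbrakk> \<Longrightarrow> norm (b t) \<le> C"
  shows "b t = t *\<^sub>R b 1"
proof -
  define c where "c t = b t - t *\<^sub>R b 1" for t
  have cadd: "c (s + t) = c s + c t" for s t
    by (simp add: c_def add algebra_simps)
  have c0: "c 0 = 0" using cadd[of 0 0] by simp
  have c1: "c 1 = 0" by (simp add: c_def)
  have cn: "c (real n * t) = real n *\<^sub>R c t" for n t
  proof (induction n)
    case 0 then show ?case by (simp add: c0)
  next
    case (Suc n) 
    have "c (real (Suc n) * t) = c (real n * t + t)" by (simp add: algebra_simps)
    then show ?case using Suc by (simp add: cadd algebra_simps)
  qed
  have cm: "c (- t) = - c t" for t using cadd[of t "- t"] c0 by (simp add: add_eq_0_iff)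
  have ci: "c (real_of_int i) = 0" for i
  proof (cases "i \<ge> 0")
    case True then show ?thesis using cn[of "nat i" 1] c1 by simp
  next
    case False then show ?thesis using cn[of "nat (- i)" 1] c1 cm[of "real_of_int i"] by simp
  qed
  have cbd: "norm (c t) \<le> 2 * C" for t
  proof -
    have fr: "0 \<le> frac t" "frac t \<le> 1" by (simp_all add: frac_lt_1 less_imp_le)
    have "t = frac t + real_of_int \<lfloor>t\<rfloor>" by (simp add: frac_def)
    then have "c t = c (frac t)" using cadd[of "frac t" "real_of_int \<lfloor>t\<rfloor>"] ci by simp
    also have "norm \<dots> \<le> norm (b (frac t)) + \<bar>frac t\<bar> * norm (b 1)"
      unfolding c_def by (metis norm_scaleR norm_triangle_ineq4)
    also have "\<dots> \<le> C + 1 * C"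
      using bd[OF fr] bd[of 1] fr by (intro add_mono mult_mono) auto
    finally show ?thesis by simp
  qed
  have "norm (c t) = 0"
  proof (rule ccontr)
    assume "norm (c t) \<noteq> 0"
    then have "norm (c t) > 0" by simp
    then obtain n where "real n * norm (c t) > 2 * C"
      using reals_Archimedean3 by blast
    with cbd[of "real n * t"] cn[of n t] show False by simp
  qed
  then show ?thesis by (simp add: c_def)
qed

text \<open>Compactness is stated with a filter below \<open>sequentially\<close>, since pointwise
  cluster points need not be limits of subsequences. In the recentring clause \<open>p\<close> can
  only be the gradient of \<open>z\<close> at \<xi>, by the quadratic bound for the recentred
  function.\<close>

definition blowup_closed :: "real \<Rightarrow> ('a::euclidean_space \<Rightarrow> real) set \<Rightarrow> bool" where
  "blowup_closed \<kappa> Z \<longleftrightarrow>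
     (\<forall>z\<in>Z. \<forall>y. \<bar>z y\<bar> \<le> \<kappa> * (norm y)\<^sup>2) \<and>
     (\<forall>z\<in>Z. \<forall>r>0. (\<lambda>y. z (r *\<^sub>R y) / r\<^sup>2) \<in> Z) \<and>
     (\<forall>z\<in>Z. \<forall>\<xi>. \<exists>p. (\<lambda>y. z (\<xi> + y) - z \<xi> - p \<bullet> y) \<in> Z) \<and>
     (\<forall>s. (\<forall>n::nat. s n \<in> Z) \<longrightarrow> (\<exists>H l. H \<le> sequentially \<and> H \<noteq> bot \<and> l \<in> Z \<and>
        (\<forall>y. ((\<lambda>n. s n y) \<longlongrightarrow> l y) H)))"

text \<open>The leading coefficient is the same on all parallel lines, and the slope depends
  linearly on the base point; this is the form that persists under recentring.\<close>

definition quad_along :: "('a::euclidean_space \<Rightarrow> real) \<Rightarrow> 'a \<Rightarrow> 'a \<Rightarrow> real \<Rightarrow> bool" where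
  "quad_along z e b M \<longleftrightarrow> (\<forall>t y. z (t *\<^sub>R e + y) = z y + t * (b \<bullet> y) + M * t\<^sup>2)"

lemma blowup_closedD:
  assumes "blowup_closed \<kappa> Z"
  shows "z \<in> Z \<Longrightarrow> \<bar>z y\<bar> \<le> \<kappa> * (norm y)\<^sup>2"
    and "z \<in> Z \<Longrightarrow> r > 0 \<Longrightarrow> (\<lambda>y. z (r *\<^sub>R y) / r\<^sup>2) \<in> Z"
    and "z \<in> Z \<Longrightarrow> \<exists>p. (\<lambda>y. z (\<xi> + y) - z \<xi> - p \<bullet> y) \<in> Z"
    and "(\<And>n::nat. s n \<in> Z) \<Longrightarrow> (\<exists>H l. H \<le> sequentially \<and> H \<noteq> bot \<and> l \<in> Z \<and>
        (\<forall>y. ((\<lambda>n. s n y) \<longlongrightarrow> l y) H))"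
  using assms unfolding blowup_closed_def by blast+

lemma blowup_closed_attains_max:
  assumes Z: "blowup_closed \<kappa> Z" "Z \<noteq> {}"
  obtains z0 where "z0 \<in> Z" "\<And>z. z \<in> Z \<Longrightarrow> z d \<le> z0 d"
proof -
  let ?V = "(\<lambda>z. z d) ` Z"
  have "bdd_above ?V"
    using blowup_closedD(1)[OF Z(1), of _ d] by (intro bdd_aboveI[of _ "\<kappa> * (norm d)\<^sup>2"]) (force simp: abs_le_iff)
  then have ub: "z d \<le> Sup ?V" if "z \<in> Z" for z
    using that by (intro cSup_upper) auto
  have "\<exists>z\<in>Z. Sup ?V - inverse (real (Suc n)) < z d" for n
    using less_cSupD[of ?V "Sup ?V - inverse (real (Suc n))"] Z(2) by auto
  then obtain s where s: "\<And>n. s n \<in> Z" "\<And>n. Sup ?V - inverse (real (Suc n)) < s n d"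
    by metis
  obtain H l where H: "H \<le> sequentially" "H \<noteq> bot" "l \<in> Z" "\<And>y. ((\<lambda>n. s n y) \<longlongrightarrow> l y) H"
    using blowup_closedD(4)[OF Z(1), of s] s(1) by blast
  have "((\<lambda>n. Sup ?V - inverse (real (Suc n))) \<longlongrightarrow> Sup ?V - 0) sequentially"
    by (intro tendsto_intros LIMSEQ_inverse_real_of_nat)
  then have "((\<lambda>n. Sup ?V - inverse (real (Suc n))) \<longlongrightarrow> Sup ?V) H"
    using tendsto_mono[OF H(1)] by simp
  then have "Sup ?V \<le> l d"
    using H(2) H(4)[of d] s(2) by (intro tendsto_le[of H]) (auto intro!: always_eventually less_imp_le)
  with ub H(3) that show ?thesis by (meson order_trans)
qed

text \<open>Rescaling and recentring turn the maximal value \<open>M\<close> into an upper bound for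
  the opening of every member of \<open>Z\<close> along \<open>d\<close>. Attaining it at
  \<open>d\<close> propagates to a segment, after a blow-up to a line, and from there to all
  parallel lines. The bound at \<open>- d\<close> is assumed separately because only positive scales
  are available.\<close>

lemma ex_quad_along_aux:
  assumes Z: "blowup_closed \<kappa> Z" and z0: "z0 \<in> Z"
    and max: "\<And>z. z \<in> Z \<Longrightarrow> z d \<le> z0 d" "\<And>z. z \<in> Z \<Longrightarrow> z (- d) \<le> z0 d"
  shows "\<exists>z\<in>Z. \<exists>b M. quad_along z d b M"
proof -
  define M where "M = z0 d"
  note grow = blowup_closedD(1)[OF Z]
  have zero: "z 0 = 0" if "z \<in> Z" for z using grow[OF that, of 0] by simp
  have le: "z (t *\<^sub>R d) \<le> M * t\<^sup>2" if z: "z \<in> Z" for z t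
  proof -
    consider "t = 0" | "t > 0" | "t < 0" by linarith
    then show ?thesis
    proof cases
      case 1 then show ?thesis using zero[OF z] by simp
    next
      case 2
      then show ?thesis
        using max(1)[OF blowup_closedD(2)[OF Z z, of t]] by (simp add: M_def field_simps)
    next
      case 3
      then show ?thesis
        using max(2)[OF blowup_closedD(2)[OF Z z, of "- t"]] by (simp add: M_def field_simps)
    qed
  qed
  have supp: "\<exists>p. \<forall>t. z (\<xi> + t *\<^sub>R d) \<le> z \<xi> + t * p + M * t\<^sup>2" if z: "z \<in> Z" for z \<xi>
  proof -
    obtain p where "(\<lambda>y. z (\<xi> + y) - z \<xi> - p \<bullet> y) \<in> Z"
      using blowup_closedD(3)[OF Z z] by blast
    from le[OF this] have "\<forall>t. z (\<xi> + t *\<^sub>R d) \<le> z \<xi> + t * (p \<bullet> d) + M * t\<^sup>2"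
      by (simp add: algebra_simps)
    then show ?thesis by blast
  qed
  have seg: "z0 (t *\<^sub>R d) = M * t\<^sup>2" if t: "0 \<le> t" "t \<le> 1" for t
  proof (rule antisym)
    \<comment> \<open>The parabola of opening \<open>M\<close> touching from above at
      \<open>t *\<^sub>R d\<close> must pass above the value 0 at the origin and \<open>M\<close> at
      \<open>d\<close>. Weighting the two inequalities with \<open>1 - t\<close> and
      \<open>t\<close> cancels its slope.\<close>
    obtain p where p: "\<And>s. z0 (t *\<^sub>R d + s *\<^sub>R d) \<le> z0 (t *\<^sub>R d) + s * p + M * s\<^sup>2"
      using supp[OF z0] by blast
    have "0 \<le> z0 (t *\<^sub>R d) - t * p + M * t\<^sup>2"
      using p[of "- t"] zero[OF z0] by simp
    then have 1: "0 \<le> (1 - t) * (z0 (t *\<^sub>R d) - t * p + M * t\<^sup>2)"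
      using t by simp
    have "t *\<^sub>R d + (1 - t) *\<^sub>R d = d" by (simp add: algebra_simps)
    then have "0 \<le> z0 (t *\<^sub>R d) + (1 - t) * p + M * (1 - t)\<^sup>2 - M"
      using p[of "1 - t"] by (simp add: M_def)
    then have 2: "0 \<le> t * (z0 (t *\<^sub>R d) + (1 - t) * p + M * (1 - t)\<^sup>2 - M)"
      using t by simp
    have "z0 (t *\<^sub>R d) - M * t\<^sup>2 = (1 - t) * (z0 (t *\<^sub>R d) - t * p + M * t\<^sup>2)
         + t * (z0 (t *\<^sub>R d) + (1 - t) * p + M * (1 - t)\<^sup>2 - M)"
      by (simp add: power2_eq_square algebra_simps)
    with 1 2 show "M * t\<^sup>2 \<le> z0 (t *\<^sub>R d)" by linarith
  qed (rule le[OF z0])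
  \<comment> \<open>The origin is an endpoint of the segment. Recentring at the midpoint makes it
    interior, so that a blow-up there reaches the whole line.\<close>
  obtain p where "(\<lambda>y. z0 ((1/2) *\<^sub>R d + y) - z0 ((1/2) *\<^sub>R d) - p \<bullet> y) \<in> Z"
    using blowup_closedD(3)[OF Z z0] by blast
  then obtain z1 where z1: "z1 \<in> Z" and z1_eq: "\<And>y. z1 y = z0 ((1/2) *\<^sub>R d + y) - z0 ((1/2) *\<^sub>R d) - p \<bullet> y"
    by blast
  have z1_seg': "z1 (t *\<^sub>R d) = M * t\<^sup>2 + t * (M - p \<bullet> d)" if t: "\<bar>t\<bar> \<le> 1/2" for t
  proof -
    have "z0 ((1/2) *\<^sub>R d + t *\<^sub>R d) = M * (1/2 + t)\<^sup>2"
      using seg[of "1/2 + t"] t by (simp add: scaleR_left_distrib abs_le_iff)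
    moreover have "z0 ((1/2) *\<^sub>R d) = M * (1/2)\<^sup>2" using seg[of "1/2"] by simp
    ultimately show ?thesis by (simp add: z1_eq power2_eq_square algebra_simps)
  qed
  \<comment> \<open>The bound \<open>le\<close> at both ends of the centred segment leaves no room
    for a linear term.\<close>
  have "M - p \<bullet> d = 0"
    using le[OF z1, of "1/2"] le[OF z1, of "- (1/2)"] z1_seg'[of "1/2"] z1_seg'[of "- (1/2)"] by simp
  then have z1_seg: "z1 (t *\<^sub>R d) = M * t\<^sup>2" if "\<bar>t\<bar> \<le> 1/2" for t
    using z1_seg'[OF that] by simp
  define s where "s n = (\<lambda>y. z1 (inverse (real (Suc n)) *\<^sub>R y) / (inverse (real (Suc n)))\<^sup>2)" for n
  have "s n \<in> Z" for n unfolding s_def by (rule blowup_closedD(2)[OF Z z1]) simp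
  then obtain H l where H: "H \<le> sequentially" "H \<noteq> bot" and l: "l \<in> Z" 
     and lim: "\<And>y. ((\<lambda>n. s n y) \<longlongrightarrow> l y) H"
    using blowup_closedD(4)[OF Z, of s] by blast
  have l_line: "l (t *\<^sub>R d) = M * t\<^sup>2" for t
  proof -
    have "((\<lambda>n. inverse (real (Suc n)) * \<bar>t\<bar>) \<longlongrightarrow> 0 * \<bar>t\<bar>) sequentially"
      by (intro tendsto_intros LIMSEQ_inverse_real_of_nat)
    then have "\<forall>\<^sub>F n in sequentially. inverse (real (Suc n)) * \<bar>t\<bar> < 1/2"
      by (intro order_tendstoD) auto
    then have "\<forall>\<^sub>F n in H. inverse (real (Suc n)) * \<bar>t\<bar> < 1/2"
      by (rule filter_leD[OF H(1)])
    then have "\<forall>\<^sub>F n in H. s n (t *\<^sub>R d) = M * t\<^sup>2"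
    proof eventually_elim
      case (elim n)
      let ?r = "inverse (real (Suc n))"
      have "\<bar>?r * t\<bar> \<le> 1/2" using elim by (simp add: abs_mult)
      from z1_seg[OF this] show ?case by (simp add: s_def power_mult_distrib field_simps)
    qed
    then have "((\<lambda>n. s n (t *\<^sub>R d)) \<longlongrightarrow> M * t\<^sup>2) H" by (rule tendsto_eventually)
    then show ?thesis using lim H(2) tendsto_unique by blast
  qed
  have "\<forall>t. \<exists>p. (\<lambda>y. l (t *\<^sub>R d + y) - l (t *\<^sub>R d) - p \<bullet> y) \<in> Z"
    using blowup_closedD(3)[OF Z l] by blast
  then obtain b where "\<And>t. (\<lambda>y. l (t *\<^sub>R d + y) - l (t *\<^sub>R d) - b t \<bullet> y) \<in> Z" by metis
  from grow[OF this] have b: "\<bar>l (t *\<^sub>R d + y) - M * t\<^sup>2 - b t \<bullet> y\<bar> \<le> \<kappa> * (norm y)\<^sup>2" for t y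
    by (simp add: l_line)
  \<comment> \<open>What remains of \<open>l\<close> beside the line once its value and gradient at
    \<open>t *\<^sub>R d\<close> are removed. For fixed \<open>y\<close> it is bounded in
    \<open>t\<close>, and midpoint concave by \<open>mid\<close> and \<open>bmid\<close>, hence
    constant in \<open>t\<close>.\<close>
  define m where "m t y = l (t *\<^sub>R d + y) - M * t\<^sup>2 - b t \<bullet> y" for t y
  have mbd: "\<bar>m t y\<bar> \<le> \<kappa> * (norm y)\<^sup>2" for t y using b by (simp add: m_def)
  have mid: "l ((t + \<tau>) *\<^sub>R d + y) - M * (t + \<tau>)\<^sup>2 + (l ((t - \<tau>) *\<^sub>R d + y) - M * (t - \<tau>)\<^sup>2)
       \<le> 2 * (l (t *\<^sub>R d + y) - M * t\<^sup>2)" for t \<tau> y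
  proof -
    obtain p where p: "\<And>s. l (t *\<^sub>R d + y + s *\<^sub>R d) \<le> l (t *\<^sub>R d + y) + s * p + M * s\<^sup>2"
      using supp[OF l] by blast
    have eq: "t *\<^sub>R d + y + \<tau> *\<^sub>R d = (t + \<tau>) *\<^sub>R d + y" "t *\<^sub>R d + y + (- \<tau>) *\<^sub>R d = (t - \<tau>) *\<^sub>R d + y"
      by (simp_all add: algebra_simps)
    have "M * (t + \<tau>)\<^sup>2 + M * (t - \<tau>)\<^sup>2 = 2 * (M * t\<^sup>2) + 2 * (M * \<tau>\<^sup>2)"
      by (simp add: power2_eq_square algebra_simps)
    with p[of \<tau>] p[of "- \<tau>"] show ?thesis unfolding eq by simp
  qed
  \<comment> \<open>In \<open>mid\<close> linear forms in \<open>y\<close> are compared up to errors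
    quadratic in \<open>y\<close>, which forces equality of the linear forms.\<close>
  have bmid: "b (t + \<tau>) + b (t - \<tau>) = 2 *\<^sub>R b t" for t \<tau>
  proof -
    have "(b (t + \<tau>) + b (t - \<tau>) - 2 *\<^sub>R b t) \<bullet> y \<le> (4 * \<kappa>) * (norm y)\<^sup>2" for y
      using mid[of t \<tau> y] mbd[of "t + \<tau>" y] mbd[of "t - \<tau>" y] mbd[of t y]
      by (simp add: m_def inner_add_left inner_diff_left abs_le_iff)
    from inner_le_quadratic_imp_zero[OF this] show ?thesis by simp
  qed
  have mconst: "m t y = m 0 y" for t y
  proof (rule midpoint_concave_bounded_const[where m = "\<lambda>t. m t y" and C = "\<kappa> * (norm y)\<^sup>2"])
    fix t \<tau>
    have "b (t + \<tau>) \<bullet> y + b (t - \<tau>) \<bullet> y = 2 * (b t \<bullet> y)"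
      by (metis bmid inner_add_left inner_scaleR_left)
    with mid[of t \<tau> y] show "m (t + \<tau>) y + m (t - \<tau>) y \<le> 2 * m t y"
      by (simp add: m_def)
  qed (rule mbd)
  have b0: "b 0 = 0"
  proof (rule inner_le_quadratic_imp_zero)
    show "b 0 \<bullet> y \<le> (2 * \<kappa>) * (norm y)\<^sup>2" for y
      using b[of 0 y] grow[OF l, of y] by (simp add: abs_le_iff)
  qed
  have badd: "b (s + t) = b s + b t" for s t
  proof -
    have eq: "(s + t) / 2 + (s - t) / 2 = s" "(s + t) / 2 - (s - t) / 2 = t"
      "(s + t) / 2 + (s + t) / 2 = s + t" "(s + t) / 2 - (s + t) / 2 = 0" by (simp_all add: field_simps)
    have "b s + b t = 2 *\<^sub>R b ((s + t) / 2)" "b (s + t) + b 0 = 2 *\<^sub>R b ((s + t) / 2)"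
      using bmid[of "(s + t) / 2" "(s - t) / 2"] bmid[of "(s + t) / 2" "(s + t) / 2"] unfolding eq .
    then show ?thesis using b0 by (metis add.right_neutral)
  qed
  have l_eq: "l (t *\<^sub>R d + y) = l y + b t \<bullet> y + M * t\<^sup>2" for t y
    using mconst[of t y] b0 by (simp add: m_def)
  \<comment> \<open>Obtained by testing \<open>l_eq\<close> with the unit vector in the direction of
    \<open>b t\<close>; the three summands bound the two values of \<open>l\<close> and the term
    \<open>M * t\<^sup>2\<close>.\<close>
  define C where "C = \<bar>\<kappa>\<bar> * (norm d + 1)\<^sup>2 + \<bar>\<kappa>\<bar> + \<bar>M\<bar>"
  have bbd: "norm (b t) \<le> C" if t: "0 \<le> t" "t \<le> 1" for t
  proof -
    define y where "y = sgn (b t)"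
    have ny: "norm y \<le> 1" by (simp add: y_def norm_sgn)
    have "norm (b t) = b t \<bullet> y" 
      by (simp add: y_def sgn_div_norm dot_square_norm power2_eq_square divide_simps)
    also have "\<dots> \<le> \<bar>l (t *\<^sub>R d + y)\<bar> + \<bar>l y\<bar> + \<bar>M\<bar> * t\<^sup>2"
    proof -
      have "(- M) * t\<^sup>2 \<le> \<bar>M\<bar> * t\<^sup>2" by (intro mult_right_mono) auto
      then show ?thesis using l_eq[of t y] by linarith
    qed
    also have "\<dots> \<le> \<bar>\<kappa>\<bar> * (norm d + 1)\<^sup>2 + \<bar>\<kappa>\<bar> + \<bar>M\<bar>"
    proof (intro add_mono)
      have "norm (t *\<^sub>R d + y) \<le> norm d + 1"
        using norm_triangle_ineq[of "t *\<^sub>R d" y] ny t mult_right_mono[of t 1 "norm d"] by simp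
      then have "(norm (t *\<^sub>R d + y))\<^sup>2 \<le> (norm d + 1)\<^sup>2" by (intro power_mono) auto
      then have "\<kappa> * (norm (t *\<^sub>R d + y))\<^sup>2 \<le> \<bar>\<kappa>\<bar> * (norm d + 1)\<^sup>2"
        by (intro mult_mono) auto
      with grow[OF l, of "t *\<^sub>R d + y"] show "\<bar>l (t *\<^sub>R d + y)\<bar> \<le> \<bar>\<kappa>\<bar> * (norm d + 1)\<^sup>2" by linarith
      have "(norm y)\<^sup>2 \<le> 1" using ny by (simp add: power_le_one)
      then have "\<kappa> * (norm y)\<^sup>2 \<le> \<bar>\<kappa>\<bar> * 1" by (intro mult_mono) auto
      with grow[OF l, of y] show "\<bar>l y\<bar> \<le> \<bar>\<kappa>\<bar>" by linarith
      have "t\<^sup>2 \<le> 1" using t by (simp add: power_le_one)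
      then show "\<bar>M\<bar> * t\<^sup>2 \<le> \<bar>M\<bar>" using mult_left_mono[of "t\<^sup>2" 1 "\<bar>M\<bar>"] by simp
    qed
    finally show ?thesis by (simp add: C_def)
  qed
  have "b t = t *\<^sub>R b 1" for t
    by (rule additive_locally_bounded_imp_scaleR[of b C]) (use badd bbd in auto)
  then have bt: "b t \<bullet> y = t * (b 1 \<bullet> y)" for t y by (metis inner_scaleR_left)
  have "l (t *\<^sub>R d + y) = l y + t * (b 1 \<bullet> y) + M * t\<^sup>2" for t y
    using l_eq[of t y] bt[of t y] by linarith
  then have "quad_along l d (b 1) M" by (simp add: quad_along_def)
  with l show ?thesis by blast
qed

lemma quad_along_uminus: "quad_along z (- e) b M \<Longrightarrow> quad_along z e (- b) M"
  unfolding quad_along_def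
proof (intro allI)
  fix t y
  assume "\<forall>t y. z (t *\<^sub>R - e + y) = z y + t * (b \<bullet> y) + M * t\<^sup>2"
  from this[rule_format, of "- t" y] show "z (t *\<^sub>R e + y) = z y + t * (- b \<bullet> y) + M * t\<^sup>2" by simp
qed

text \<open>The largest values at \<open>e\<close> and at \<open>- e\<close> may differ; the
  direction with the larger one satisfies both maximality hypotheses.\<close>

lemma ex_quad_along:
  assumes Z: "blowup_closed \<kappa> Z" "Z \<noteq> {}"
  shows "\<exists>z\<in>Z. \<exists>b M. quad_along z e b M"
proof -
  obtain z1 where z1: "z1 \<in> Z" "\<And>z. z \<in> Z \<Longrightarrow> z e \<le> z1 e"
    using blowup_closed_attains_max[OF Z] by blast
  obtain z2 where z2: "z2 \<in> Z" "\<And>z. z \<in> Z \<Longrightarrow> z (- e) \<le> z2 (- e)"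
    using blowup_closed_attains_max[OF Z] by blast
  show ?thesis
  proof (cases "z2 (- e) \<le> z1 e")
    case True
    show ?thesis
    proof (rule ex_quad_along_aux[OF Z(1) z1(1)])
      show "z e \<le> z1 e" if "z \<in> Z" for z using z1(2)[OF that] .
      show "z (- e) \<le> z1 e" if "z \<in> Z" for z using z2(2)[OF that] True by linarith
    qed
  next
    case False
    have "\<exists>z\<in>Z. \<exists>b M. quad_along z (- e) b M"
    proof (rule ex_quad_along_aux[OF Z(1) z2(1)])
      show "z (- e) \<le> z2 (- e)" if "z \<in> Z" for z using z2(2)[OF that] .
      show "z (- (- e)) \<le> z2 (- e)" if "z \<in> Z" for z using z1(2)[OF that] False by simp
    qed
    then show ?thesis using quad_along_uminus by blast
  qed
qed

text \<open>This permits a repetition of the extremal argument for another direction inside the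
  subclass, without losing what was gained for \<open>e\<close>.\<close>

lemma blowup_closed_quad_along:
  assumes Z: "blowup_closed \<kappa> Z"
  shows "blowup_closed \<kappa> {z\<in>Z. quad_along z e b M}"
proof -
  have "(\<lambda>y. z (r *\<^sub>R y) / r\<^sup>2) \<in> {z\<in>Z. quad_along z e b M}"
    if z: "z \<in> Z" "quad_along z e b M" and "r > 0" for z r
  proof -
    have "z (r *\<^sub>R (t *\<^sub>R e + y)) / r\<^sup>2 = z (r *\<^sub>R y) / r\<^sup>2 + t * (b \<bullet> y) + M * t\<^sup>2" for t y
      using z(2)[unfolded quad_along_def, rule_format, of "r * t" "r *\<^sub>R y"] \<open>r > 0\<close>
      by (simp add: scaleR_right_distrib field_simps power2_eq_square)
    then show ?thesis using blowup_closedD(2)[OF Z z(1) \<open>r > 0\<close>] by (simp add: quad_along_def)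
  qed
  moreover have "\<exists>p. (\<lambda>y. z (\<xi> + y) - z \<xi> - p \<bullet> y) \<in> {z\<in>Z. quad_along z e b M}"
    if z: "z \<in> Z" "quad_along z e b M" for z \<xi>
  proof -
    obtain p where p: "(\<lambda>y. z (\<xi> + y) - z \<xi> - p \<bullet> y) \<in> Z" using blowup_closedD(3)[OF Z z(1)] by blast
    have q: "z (\<xi> + (t *\<^sub>R e + y)) = z (\<xi> + y) + t * (b \<bullet> (\<xi> + y)) + M * t\<^sup>2" for t y
      using z(2)[unfolded quad_along_def, rule_format, of t "\<xi> + y"] by (simp add: algebra_simps)
    \<comment> \<open>The quadratic bound for the recentred function fixes the slope along
      \<open>e\<close>, so that the same \<open>b\<close> and \<open>M\<close> serve after
      recentring.\<close>
    have "b \<bullet> \<xi> - p \<bullet> e = 0"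
    proof (rule inner_le_quadratic_imp_zero)
      fix t :: real
      have "\<bar>z (\<xi> + t *\<^sub>R e) - z \<xi> - p \<bullet> (t *\<^sub>R e)\<bar> \<le> \<kappa> * (norm (t *\<^sub>R e))\<^sup>2"
        using blowup_closedD(1)[OF Z p, of "t *\<^sub>R e"] by simp
      then have "\<bar>t * (b \<bullet> \<xi>) + M * t\<^sup>2 - t * (p \<bullet> e)\<bar> \<le> \<kappa> * (t\<^sup>2 * (norm e)\<^sup>2)"
        using q[of t 0] by (simp add: power_mult_distrib)
      then show "(b \<bullet> \<xi> - p \<bullet> e) \<bullet> t \<le> (\<kappa> * (norm e)\<^sup>2 - M) * (norm t)\<^sup>2"
        by (simp add: abs_le_iff algebra_simps)
    qed
    then have "p \<bullet> e = b \<bullet> \<xi>" by simp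
    then have "quad_along (\<lambda>y. z (\<xi> + y) - z \<xi> - p \<bullet> y) e b M"
      unfolding quad_along_def q by (simp add: algebra_simps)
    with p show ?thesis by blast
  qed
  moreover have "\<exists>H l. H \<le> sequentially \<and> H \<noteq> bot \<and> l \<in> {z\<in>Z. quad_along z e b M} \<and>
        (\<forall>y. ((\<lambda>n. s n y) \<longlongrightarrow> l y) H)" if s: "\<And>n::nat. s n \<in> {z\<in>Z. quad_along z e b M}" for s
  proof -
    obtain H l where H: "H \<le> sequentially" "H \<noteq> bot" "l \<in> Z" "\<And>y. ((\<lambda>n. s n y) \<longlongrightarrow> l y) H"
      using blowup_closedD(4)[OF Z, of s] s by blast
    have "l (t *\<^sub>R e + y) = l y + t * (b \<bullet> y) + M * t\<^sup>2" for t y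
    proof -
      have "(\<lambda>n. s n (t *\<^sub>R e + y)) = (\<lambda>n. s n y + t * (b \<bullet> y) + M * t\<^sup>2)"
        using s by (auto simp: quad_along_def)
      moreover have "((\<lambda>n. s n y + t * (b \<bullet> y) + M * t\<^sup>2) \<longlongrightarrow> l y + t * (b \<bullet> y) + M * t\<^sup>2) H"
        by (intro tendsto_intros H)
      ultimately have "((\<lambda>n. s n (t *\<^sub>R e + y)) \<longlongrightarrow> l y + t * (b \<bullet> y) + M * t\<^sup>2) H" by (simp only:)
      then show ?thesis by (rule tendsto_unique[OF H(2) H(4)])
    qed
    then have "quad_along l e b M" by (simp add: quad_along_def)
    then show ?thesis by (intro exI[of _ H] exI[of _ l] conjI CollectI allI H)
  qed
  ultimately show ?thesis
    unfolding blowup_closed_def using blowup_closedD(1)[OF Z] by (intro conjI allI impI ballI) blast+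
qed

text \<open>The directions along which a fixed function is quadratic form a subspace, so a basis
  suffices. Then \<open>M d\<close> is \<open>z d\<close> and \<open>b\<close> is the polarisation
  of \<open>z\<close>, which is symmetric and therefore linear.\<close>

lemma blowup_closed_contains_quadratic:
  fixes Z :: "('a::euclidean_space \<Rightarrow> real) set"
  assumes "blowup_closed \<kappa> Z" "Z \<noteq> {}"
  obtains z b where "z \<in> Z" "linear b" "\<And>x y. b x \<bullet> y = x \<bullet> b y" "\<And>x. z x = (x \<bullet> b x) / 2"
proof -
  \<comment> \<open>The induction carries a nonempty subclass and not a function, because each new
    direction replaces the function by another one.\<close>
  have "finite D \<Longrightarrow> \<exists>Z'. Z' \<subseteq> Z \<and> blowup_closed \<kappa> Z' \<and> Z' \<noteq> {} \<and> (\<forall>e\<in>D. \<exists>b M. \<forall>z\<in>Z'. quad_along z e b M)"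
    for D :: "'a set"
  proof (induction D rule: finite_induct)
    case empty
    then show ?case using assms by blast
  next
    case (insert e D)
    then obtain Z' where Z': "Z' \<subseteq> Z" "blowup_closed \<kappa> Z'" "Z' \<noteq> {}" "\<forall>e\<in>D. \<exists>b M. \<forall>z\<in>Z'. quad_along z e b M"
      by blast
    obtain z b M where "z \<in> Z'" "quad_along z e b M" using ex_quad_along[OF Z'(2,3)] by blast
    then show ?case
      using Z' blowup_closed_quad_along[OF Z'(2), of e b M]
      by (intro exI[of _ "{z\<in>Z'. quad_along z e b M}"]) blast
  qed
  from this[OF finite_Basis] obtain z where z: "z \<in> Z" and basis: "\<forall>e\<in>Basis. \<exists>b M. quad_along z e b M"
    by blast
  have z0: "z 0 = 0" using blowup_closedD(1)[OF assms(1) z, of 0] by simp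
  have "subspace {d. \<exists>b M. quad_along z d b M}"
  proof (rule subspaceI; clarsimp)
    show "\<exists>b M. quad_along z 0 b M" by (intro exI[of _ 0]) (simp add: quad_along_def)
  next
    fix d d' b b' M M' assume q: "quad_along z d b M" "quad_along z d' b' M'"
    have "z (t *\<^sub>R (d + d') + y) = z y + t * ((b + b') \<bullet> y) + (M + M' + b \<bullet> d') * t\<^sup>2" for t y
    proof -
      have "z (t *\<^sub>R (d + d') + y) = z (t *\<^sub>R d + (t *\<^sub>R d' + y))" by (simp add: algebra_simps)
      also have "\<dots> = z y + t * (b' \<bullet> y) + M' * t\<^sup>2 + t * (b \<bullet> (t *\<^sub>R d' + y)) + M * t\<^sup>2"
        using q by (simp add: quad_along_def)
      finally show ?thesis by (simp add: algebra_simps power2_eq_square)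
    qed
    then show "\<exists>b M. quad_along z (d + d') b M" unfolding quad_along_def by blast
  next
    fix c d b M assume q: "quad_along z d b M"
    have "z (t *\<^sub>R (c *\<^sub>R d) + y) = z y + t * ((c *\<^sub>R b) \<bullet> y) + (M * c\<^sup>2) * t\<^sup>2" for t y
      using q[unfolded quad_along_def, rule_format, of "t * c" y] by (simp add: algebra_simps power_mult_distrib)
    then show "\<exists>b M. quad_along z (c *\<^sub>R d) b M" unfolding quad_along_def by blast
  qed
  then have "span Basis \<subseteq> {d. \<exists>b M. quad_along z d b M}" using basis by (intro span_minimal) auto
  then have "\<forall>d. \<exists>b M. quad_along z d b M" by auto
  then obtain b M where q: "\<And>d t y. z (t *\<^sub>R d + y) = z y + t * (b d \<bullet> y) + M d * t\<^sup>2"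
    unfolding quad_along_def by metis
  have M: "M d = z d" for d using q[of 1 d 0] z0 by simp
  have pol: "b x \<bullet> y = z (x + y) - z x - z y" for x y using q[of 1 x y] M by simp
  have sym: "b x \<bullet> y = b y \<bullet> x" for x y by (simp add: pol add.commute)
  have "linear b"
  proof (rule linearI)
    show "b (x + y) = b x + b y" for x y
      by (rule vector_eq_rdot[THEN iffD1]) (simp add: sym[of "x + y"] sym[of x] sym[of y] inner_add_left inner_add_right)
    show "b (c *\<^sub>R x) = c *\<^sub>R b x" for c x
      by (rule vector_eq_rdot[THEN iffD1]) (simp add: sym[of "c *\<^sub>R x"] sym[of x])
  qed
  moreover have "z x = (x \<bullet> b x) / 2" for x
    using q[of 2 x 0] pol[of x x] M[of x] z0 by (simp add: scaleR_2 inner_commute)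
  ultimately show ?thesis using that[of z b] z sym by (metis inner_commute)
qed

subsection \<open>Second-order superjets and pointwise limits\<close>

text \<open>The majorant is an exact quadratic on a ball, without an error term, so it is itself a
  test function of class \<open>C^2\<close>. Only the matrix is recorded, as the constraint sets see
  nothing else.\<close>

definition sjet :: "(real^'n \<Rightarrow> real) \<Rightarrow> real^'n \<Rightarrow> (real^'n^'n) set" where
  "sjet u x = {A. transpose A = A \<and>
     (\<exists>p. \<exists>\<epsilon>>0. \<forall>h. norm h < \<epsilon> \<longrightarrow> u (x + h) \<le> u x + p \<bullet> h + (h \<bullet> (A *v h)) / 2)}"

text \<open>In finite dimension this is convexity of \<open>u + \<kappa> |.|^2\<close>, expressed by
  its supporting hyperplanes.\<close>

definition semiconvex :: "real \<Rightarrow> ('a::real_inner \<Rightarrow> real) \<Rightarrow> bool" where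
  "semiconvex \<kappa> u \<longleftrightarrow> (\<forall>\<xi>. \<exists>p. \<forall>h. u \<xi> + p \<bullet> h - \<kappa> * (norm h)\<^sup>2 \<le> u (\<xi> + h))"

text \<open>Both functions are supported from below and their sum is touched from above by a concave
  paraboloid; each is thereby pinched, with gradients \<open>p\<close> and \<open>q\<close>.\<close>

definition contact :: "real \<Rightarrow> real \<Rightarrow> ('a::real_inner \<Rightarrow> real) \<Rightarrow> ('a \<Rightarrow> real) \<Rightarrow> 'a \<Rightarrow> 'a \<Rightarrow> 'a \<Rightarrow> bool" where
  "contact \<kappa> \<delta> u z \<xi> p q \<longleftrightarrow>
     (\<forall>h. u \<xi> + p \<bullet> h - \<kappa> * (norm h)\<^sup>2 \<le> u (\<xi> + h)) \<and>
     (\<forall>h. z \<xi> + q \<bullet> h - \<kappa> * (norm h)\<^sup>2 \<le> z (\<xi> + h)) \<and>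
     (\<forall>h. u (\<xi> + h) + z (\<xi> + h) \<le> u \<xi> + z \<xi> + (p + q) \<bullet> h - \<delta> * (norm h)\<^sup>2)"

text \<open>A second-order blow-up: the affine part at \<xi> is removed, and division by
  \<open>r\<^sup>2\<close> preserves matrices of superjets as well as the constants \<kappa> and
  \<delta>.\<close>

definition rescale :: "('a::real_inner \<Rightarrow> real) \<Rightarrow> 'a \<Rightarrow> 'a \<Rightarrow> real \<Rightarrow> 'a \<Rightarrow> real" where
  "rescale u \<xi> p r y = (u (\<xi> + r *\<^sub>R y) - u \<xi> - p \<bullet> (r *\<^sub>R y)) / r\<^sup>2"

lemma sjet_rescale:
  assumes "r > 0"
  shows "sjet (rescale u \<xi> p r) y \<subseteq> sjet u (\<xi> + r *\<^sub>R y)"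
proof
  fix A assume "A \<in> sjet (rescale u \<xi> p r) y"
  then obtain p' \<epsilon> where A: "transpose A = A" "\<epsilon> > 0"
    and le: "\<And>h. norm h < \<epsilon> \<Longrightarrow> rescale u \<xi> p r (y + h) \<le> rescale u \<xi> p r y + p' \<bullet> h + (h \<bullet> (A *v h)) / 2"
    unfolding sjet_def by blast
  have "u (\<xi> + r *\<^sub>R y + h) \<le> u (\<xi> + r *\<^sub>R y) + (p + r *\<^sub>R p') \<bullet> h + (h \<bullet> (A *v h)) / 2"
    if h: "norm h < r * \<epsilon>" for h
  proof -
    define k where "k = h /\<^sub>R r"
    have hk: "h = r *\<^sub>R k" using \<open>r > 0\<close> by (simp add: k_def)
    have "norm k < \<epsilon>" using h \<open>r > 0\<close> by (simp add: hk)
    from le[OF this] have "r\<^sup>2 * rescale u \<xi> p r (y + k) \<le> r\<^sup>2 * (rescale u \<xi> p r y + p' \<bullet> k + (k \<bullet> (A *v k)) / 2)"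
      by (intro mult_left_mono) auto
    moreover have "r\<^sup>2 * rescale u \<xi> p r w = u (\<xi> + r *\<^sub>R w) - u \<xi> - p \<bullet> (r *\<^sub>R w)" for w
      using \<open>r > 0\<close> by (simp add: rescale_def)
    ultimately have "u (\<xi> + r *\<^sub>R (y + k)) - u \<xi> - p \<bullet> (r *\<^sub>R (y + k)) \<le> 
       u (\<xi> + r *\<^sub>R y) - u \<xi> - p \<bullet> (r *\<^sub>R y) + r\<^sup>2 * (p' \<bullet> k) + r\<^sup>2 * ((k \<bullet> (A *v k)) / 2)"
      by (simp only: distrib_left)
    moreover have "h \<bullet> (A *v h) = r\<^sup>2 * (k \<bullet> (A *v k))"
      by (simp add: hk linear_cmul[OF matrix_vector_mul_linear] power2_eq_square)
    moreover have "p \<bullet> (r *\<^sub>R (y + k)) = p \<bullet> (r *\<^sub>R y) + p \<bullet> h"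
      "u (\<xi> + r *\<^sub>R (y + k)) = u (\<xi> + r *\<^sub>R y + h)" "(r *\<^sub>R p') \<bullet> h = r\<^sup>2 * (p' \<bullet> k)"
      by (simp_all add: hk inner_add_right scaleR_right_distrib power2_eq_square add.assoc)
    ultimately show ?thesis unfolding inner_add_left by linarith
  qed
  moreover have "r * \<epsilon> > 0" using A \<open>r > 0\<close> by simp
  ultimately show "A \<in> sjet u (\<xi> + r *\<^sub>R y)" unfolding sjet_def using A by blast
qed

lemma rescale_increment:
  assumes "r > 0"
  shows "rescale u \<xi> p r (y + h) - rescale u \<xi> p r y - ((p' - p) /\<^sub>R r) \<bullet> h 
    = (u (\<xi> + r *\<^sub>R y + r *\<^sub>R h) - u (\<xi> + r *\<^sub>R y) - p' \<bullet> (r *\<^sub>R h)) / r\<^sup>2"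
  using assms by (simp add: rescale_def field_simps inner_diff_left inner_add_right scaleR_right_distrib power2_eq_square add.assoc)

lemma semiconvex_rescale:
  assumes "r > 0" "semiconvex \<kappa> u"
  shows "semiconvex \<kappa> (rescale u \<xi> p r)"
  unfolding semiconvex_def
proof
  fix y
  obtain p' where p': "\<And>h. u (\<xi> + r *\<^sub>R y) + p' \<bullet> h - \<kappa> * (norm h)\<^sup>2 \<le> u (\<xi> + r *\<^sub>R y + h)"
    using assms(2) unfolding semiconvex_def by blast
  have "rescale u \<xi> p r y + ((p' - p) /\<^sub>R r) \<bullet> h - \<kappa> * (norm h)\<^sup>2 \<le> rescale u \<xi> p r (y + h)" for h
  proof -
    have "- \<kappa> * (norm h)\<^sup>2 = (- \<kappa> * (norm (r *\<^sub>R h))\<^sup>2) / r\<^sup>2"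
      using \<open>r > 0\<close> by (simp add: power_mult_distrib)
    also have "\<dots> \<le> (u (\<xi> + r *\<^sub>R y + r *\<^sub>R h) - u (\<xi> + r *\<^sub>R y) - p' \<bullet> (r *\<^sub>R h)) / r\<^sup>2"
      using p'[of "r *\<^sub>R h"] by (intro divide_right_mono) auto
    finally show ?thesis using rescale_increment[OF \<open>r > 0\<close>, of u \<xi> p y h p'] by linarith
  qed
  then show "\<exists>p'. \<forall>h. rescale u \<xi> p r y + p' \<bullet> h - \<kappa> * (norm h)\<^sup>2 \<le> rescale u \<xi> p r (y + h)" by blast
qed

lemma contact_rescale:
  assumes "r > 0" "contact \<kappa> \<delta> u z (\<xi> + r *\<^sub>R y) p' q'"
  shows "contact \<kappa> \<delta> (rescale u \<xi> p r) (rescale z \<xi> q r) y ((p' - p) /\<^sub>R r) ((q' - q) /\<^sub>R r)"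
proof -
  have n: "c * (norm h)\<^sup>2 = (c * (norm (r *\<^sub>R h))\<^sup>2) / r\<^sup>2" for c and h :: 'a
    using \<open>r > 0\<close> by (simp add: power_mult_distrib)
  note c = assms(2)[unfolded contact_def]
  note inc = rescale_increment[OF \<open>r > 0\<close>]
  have "- \<kappa> * (norm h)\<^sup>2 \<le> rescale u \<xi> p r (y + h) - rescale u \<xi> p r y - ((p' - p) /\<^sub>R r) \<bullet> h" for h
    unfolding inc by (subst n, rule divide_right_mono) (use c[THEN conjunct1, rule_format, of "r *\<^sub>R h"] in auto)
  moreover have "- \<kappa> * (norm h)\<^sup>2 \<le> rescale z \<xi> q r (y + h) - rescale z \<xi> q r y - ((q' - q) /\<^sub>R r) \<bullet> h" for h
    unfolding inc by (subst n, rule divide_right_mono)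
      (use c[THEN conjunct2, THEN conjunct1, rule_format, of "r *\<^sub>R h"] in auto)
  moreover have "rescale u \<xi> p r (y + h) - rescale u \<xi> p r y - ((p' - p) /\<^sub>R r) \<bullet> h + 
      (rescale z \<xi> q r (y + h) - rescale z \<xi> q r y - ((q' - q) /\<^sub>R r) \<bullet> h) \<le> - \<delta> * (norm h)\<^sup>2" for h
    unfolding inc add_divide_distrib[symmetric] by (subst n, rule divide_right_mono)
      (use c[THEN conjunct2, THEN conjunct2, rule_format, of "r *\<^sub>R h"] in \<open>auto simp: inner_add_left algebra_simps\<close>)
  ultimately have I: "- \<kappa> * (norm h)\<^sup>2 \<le> rescale u \<xi> p r (y + h) - rescale u \<xi> p r y - ((p' - p) /\<^sub>R r) \<bullet> h"
    "- \<kappa> * (norm h)\<^sup>2 \<le> rescale z \<xi> q r (y + h) - rescale z \<xi> q r y - ((q' - q) /\<^sub>R r) \<bullet> h"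
    "rescale u \<xi> p r (y + h) - rescale u \<xi> p r y - ((p' - p) /\<^sub>R r) \<bullet> h + 
      (rescale z \<xi> q r (y + h) - rescale z \<xi> q r y - ((q' - q) /\<^sub>R r) \<bullet> h) \<le> - \<delta> * (norm h)\<^sup>2" for h
    by blast+
  show ?thesis
    unfolding contact_def inner_add_left
  proof (intro conjI allI)
    fix h
    show "rescale u \<xi> p r y + ((p' - p) /\<^sub>R r) \<bullet> h - \<kappa> * (norm h)\<^sup>2 \<le> rescale u \<xi> p r (y + h)"
      using I(1)[of h] by linarith
    show "rescale z \<xi> q r y + ((q' - q) /\<^sub>R r) \<bullet> h - \<kappa> * (norm h)\<^sup>2 \<le> rescale z \<xi> q r (y + h)"
      using I(2)[of h] by linarith
    show "rescale u \<xi> p r (y + h) + rescale z \<xi> q r (y + h) \<le> rescale u \<xi> p r y + rescale z \<xi> q r y +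
        (((p' - p) /\<^sub>R r) \<bullet> h + ((q' - q) /\<^sub>R r) \<bullet> h) - \<delta> * (norm h)\<^sup>2"
      using I(3)[of h] by linarith
  qed
qed

text \<open>The upper bound for one function is the bound for the sum minus the lower bound for the
  other.\<close>

lemma contact_bounds:
  assumes "contact \<kappa> \<delta> u z \<xi> p q" "\<delta> \<ge> 0"
  shows "\<bar>u (\<xi> + h) - u \<xi> - p \<bullet> h\<bar> \<le> \<kappa> * (norm h)\<^sup>2" "\<bar>z (\<xi> + h) - z \<xi> - q \<bullet> h\<bar> \<le> \<kappa> * (norm h)\<^sup>2"
proof -
  have "0 \<le> \<delta> * (norm h)\<^sup>2" using assms by simp
  moreover have "u \<xi> + p \<bullet> h - \<kappa> * (norm h)\<^sup>2 \<le> u (\<xi> + h)" "z \<xi> + q \<bullet> h - \<kappa> * (norm h)\<^sup>2 \<le> z (\<xi> + h)"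
    "u (\<xi> + h) + z (\<xi> + h) \<le> u \<xi> + z \<xi> + p \<bullet> h + q \<bullet> h - \<delta> * (norm h)\<^sup>2"
    using assms(1) by (auto simp: contact_def inner_add_left add.assoc)
  ultimately show "\<bar>u (\<xi> + h) - u \<xi> - p \<bullet> h\<bar> \<le> \<kappa> * (norm h)\<^sup>2" "\<bar>z (\<xi> + h) - z \<xi> - q \<bullet> h\<bar> \<le> \<kappa> * (norm h)\<^sup>2"
    by linarith+
qed

lemma subgradient_bound:
  fixes p :: "'a::real_inner"
  assumes p: "\<And>h. u \<xi> + p \<bullet> h - \<kappa> * (norm h)\<^sup>2 \<le> u (\<xi> + h)" and u: "\<And>y. \<bar>u y\<bar> \<le> \<kappa> * (norm y)\<^sup>2"
    and "0 \<le> \<kappa>" "norm \<xi> \<le> R"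
  shows "norm p \<le> \<kappa> * (R + 1)\<^sup>2 + \<kappa> * R\<^sup>2 + \<kappa>"
proof -
  define h where "h = sgn p"
  have nh: "norm h \<le> 1" by (simp add: h_def norm_sgn)
  have "norm p = p \<bullet> h" 
    by (simp add: h_def sgn_div_norm dot_square_norm power2_eq_square divide_simps)
  also have "\<dots> \<le> \<bar>u (\<xi> + h)\<bar> + \<bar>u \<xi>\<bar> + \<kappa> * (norm h)\<^sup>2" using p[of h] by linarith
  also have "\<dots> \<le> \<kappa> * (R + 1)\<^sup>2 + \<kappa> * R\<^sup>2 + \<kappa>"
  proof (intro add_mono)
    have "norm (\<xi> + h) \<le> R + 1" using norm_triangle_ineq[of \<xi> h] nh \<open>norm \<xi> \<le> R\<close> by linarith
    then have "\<kappa> * (norm (\<xi> + h))\<^sup>2 \<le> \<kappa> * (R + 1)\<^sup>2" using \<open>0 \<le> \<kappa>\<close> by (intro mult_left_mono power_mono) auto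
    with u[of "\<xi> + h"] show "\<bar>u (\<xi> + h)\<bar> \<le> \<kappa> * (R + 1)\<^sup>2" by linarith
    have "\<kappa> * (norm \<xi>)\<^sup>2 \<le> \<kappa> * R\<^sup>2" using assms by (intro mult_left_mono power_mono) auto
    with u[of \<xi>] show "\<bar>u \<xi>\<bar> \<le> \<kappa> * R\<^sup>2" by linarith
    show "\<kappa> * (norm h)\<^sup>2 \<le> \<kappa>" using nh \<open>0 \<le> \<kappa>\<close> by (simp add: mult_left_le power_le_one)
  qed
  finally show ?thesis .
qed

lemma semiconvex_lipschitz_on_ball:
  fixes u :: "'a::real_inner \<Rightarrow> real"
  assumes sc: "semiconvex \<kappa> u" and u: "\<And>y. \<bar>u y\<bar> \<le> \<kappa> * (norm y)\<^sup>2" and "0 \<le> \<kappa>"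
    and x: "norm x \<le> R" and y: "norm y \<le> R"
  shows "\<bar>u y - u x\<bar> \<le> (\<kappa> * (R + 1)\<^sup>2 + \<kappa> * R\<^sup>2 + \<kappa> + 2 * \<kappa> * R) * norm (y - x)"
proof -
  let ?C = "\<kappa> * (R + 1)\<^sup>2 + \<kappa> * R\<^sup>2 + \<kappa>"
  have one: "u x - u y \<le> (?C + 2 * \<kappa> * R) * norm (y - x)" if x: "norm x \<le> R" and y: "norm y \<le> R" for x y
  proof -
    obtain p where p: "\<And>h. u x + p \<bullet> h - \<kappa> * (norm h)\<^sup>2 \<le> u (x + h)"
      using sc unfolding semiconvex_def by blast
    have "norm (y - x) \<le> 2 * R" using norm_triangle_ineq4[of y x] x y by linarith
    then have "\<kappa> * (norm (y - x) * norm (y - x)) \<le> \<kappa> * (2 * R * norm (y - x))"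
      using \<open>0 \<le> \<kappa>\<close> by (intro mult_left_mono mult_right_mono) auto
    moreover have "- (p \<bullet> (y - x)) \<le> norm p * norm (y - x)" using Cauchy_Schwarz_ineq2[of p "y - x"] by linarith
    moreover have "norm p * norm (y - x) \<le> ?C * norm (y - x)"
      by (intro mult_right_mono subgradient_bound[OF p u \<open>0 \<le> \<kappa>\<close> x]) auto
    moreover have "u x + p \<bullet> (y - x) - \<kappa> * (norm (y - x))\<^sup>2 \<le> u y" using p[of "y - x"] by simp
    moreover have "(?C + 2 * \<kappa> * R) * norm (y - x) = ?C * norm (y - x) + \<kappa> * (2 * R * norm (y - x))"
      by (simp add: algebra_simps)
    ultimately show ?thesis by (simp add: power2_eq_square)
  qed
  show ?thesis using one[OF x y] one[OF y x] by (simp add: abs_le_iff norm_minus_commute)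
qed

text \<open>A common Lipschitz constant on a ball around the limit point compares
  \<open>u n (x n)\<close> with \<open>u n a\<close>. This is what makes pointwise convergence
  strong enough for all later limits.\<close>

lemma moving_point_limit:
  fixes u :: "'i \<Rightarrow> 'a::real_inner \<Rightarrow> real"
  assumes "0 \<le> \<kappa>" and sc: "\<And>n. semiconvex \<kappa> (u n)" and bd: "\<And>n y. \<bar>u n y\<bar> \<le> \<kappa> * (norm y)\<^sup>2"
    and lim: "\<And>y. ((\<lambda>n. u n y) \<longlongrightarrow> l y) H" and x: "(x \<longlongrightarrow> a) H"
  shows "((\<lambda>n. u n (x n)) \<longlongrightarrow> l a) H"
proof -
  define R where "R = norm a + 1"
  let ?L = "\<kappa> * (R + 1)\<^sup>2 + \<kappa> * R\<^sup>2 + \<kappa> + 2 * \<kappa> * R"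
  have "((\<lambda>n. norm (x n)) \<longlongrightarrow> norm a) H" by (intro tendsto_intros x)
  then have "\<forall>\<^sub>F n in H. norm (x n) < R" by (rule order_tendstoD) (simp add: R_def)
  then have "\<forall>\<^sub>F n in H. norm (u n (x n) - u n a) \<le> ?L * norm (x n - a)"
  proof eventually_elim
    case (elim n)
    then show ?case
      using semiconvex_lipschitz_on_ball[OF sc bd \<open>0 \<le> \<kappa>\<close>, of a R "x n"] by (simp add: R_def)
  qed
  moreover have "((\<lambda>n. ?L * norm (x n - a)) \<longlongrightarrow> ?L * norm (a - a)) H" by (intro tendsto_intros x)
  ultimately have "((\<lambda>n. u n (x n) - u n a) \<longlongrightarrow> 0) H"
    using Lim_null_comparison[of "\<lambda>n. u n (x n) - u n a" "\<lambda>n. ?L * norm (x n - a)" H] by (simp only: diff_self norm_zero mult_zero_right)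
  from tendsto_add[OF this lim[of a]] show ?thesis by simp
qed

text \<open>A constant family indexed by the approaching point itself turns the statement about
  moving points into continuity.\<close>

lemma semiconvex_continuous:
  fixes u :: "'a::real_inner \<Rightarrow> real"
  assumes "0 \<le> \<kappa>" and sc: "semiconvex \<kappa> u" and bd: "\<And>y. \<bar>u y\<bar> \<le> \<kappa> * (norm y)\<^sup>2"
  shows "continuous_on S u"
  unfolding continuous_on_def
proof
  fix a
  show "(u \<longlongrightarrow> u a) (at a within S)"
    by (rule moving_point_limit[where u = "\<lambda>_. u" and x = "\<lambda>x. x", OF assms(1)]) (use sc bd in auto)
qed

section \<open>Stability of superjets and of contact under pointwise limits\<close>

lemma symmetric_inner_matrix:
  fixes A :: "real^'n^'n"
  assumes "transpose A = A"
  shows "x \<bullet> (A *v y) = y \<bullet> (A *v x)"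
  by (metis assms dot_lmul_matrix inner_commute transpose_matrix_vector)

lemma add_mat_vector_mult:
  fixes A :: "real^'n^'n"
  shows "(A + c *\<^sub>R mat 1) *v x = A *v x + c *\<^sub>R x"
  by (simp add: matrix_vector_mult_add_rdistrib scaleR_matrix_vector_assoc[symmetric])

lemma transpose_add_mat:
  fixes A :: "real^'n^'n"
  shows "transpose (A + c *\<^sub>R mat 1) = transpose A + c *\<^sub>R mat 1"
  by (simp add: transpose_def mat_def vec_eq_iff)

text \<open>The viscosity argument: adding \<open>\<eta> * (norm h)\<^sup>2\<close> makes the
  touching strict, so maximisers for the approximants over a small ball cluster at its centre. There
  \<open>A\<close> plus \<open>2 * \<eta>\<close> times the identity is a superjet of an
  approximant; then \<eta> tends to 0 and \<open>F\<close> is closed.\<close>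

lemma sjet_limit:
  fixes u :: "'i \<Rightarrow> real^'n \<Rightarrow> real"
  assumes "H \<noteq> bot" "closed F" "0 \<le> \<kappa>" and sc: "\<And>n. semiconvex \<kappa> (u n)" and bd: "\<And>n y. \<bar>u n y\<bar> \<le> \<kappa> * (norm y)\<^sup>2"
    and lim: "\<And>y. ((\<lambda>n. u n y) \<longlongrightarrow> l y) H"
    and jets: "\<And>R. \<forall>\<^sub>F n in H. \<forall>x. norm x < R \<longrightarrow> sjet (u n) x \<subseteq> F"
  shows "sjet l x \<subseteq> F"
proof
  fix A assume "A \<in> sjet l x"
  then obtain p \<epsilon> where A: "transpose A = A" "\<epsilon> > 0"
    and le: "\<And>h. norm h < \<epsilon> \<Longrightarrow> l (x + h) \<le> l x + p \<bullet> h + (h \<bullet> (A *v h)) / 2"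
    unfolding sjet_def by blast
  have AF: "A + (2 * \<eta>) *\<^sub>R mat 1 \<in> F" if "\<eta> > 0" for \<eta>
  proof -
    define \<rho> where "\<rho> = \<epsilon> / 2"
    have \<rho>: "0 < \<rho>" "\<rho> < \<epsilon>" using A by (auto simp: \<rho>_def)
    define Q where "Q h = p \<bullet> h + (h \<bullet> (A *v h)) / 2 + \<eta> * (norm h)\<^sup>2" for h
    have Qc: "continuous_on S Q" for S
      unfolding Q_def by (intro continuous_intros linear_continuous_on_compose[OF continuous_on_id] matrix_vector_mul_linear) auto
    have "\<exists>h\<in>cball 0 \<rho>. \<forall>k\<in>cball 0 \<rho>. u n (x + k) - Q k \<le> u n (x + h) - Q h" for n
    proof (rule continuous_attains_sup)
      show "continuous_on (cball 0 \<rho>) (\<lambda>h. u n (x + h) - Q h)"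
        by (intro continuous_on_diff Qc continuous_on_compose2[OF semiconvex_continuous[OF \<open>0 \<le> \<kappa>\<close> sc bd, of UNIV]] continuous_intros) auto
    qed (use \<rho> in auto)
    then obtain hn where hn: "\<And>n. hn n \<in> cball 0 \<rho>" "\<And>n k. k \<in> cball 0 \<rho> \<Longrightarrow> u n (x + k) - Q k \<le> u n (x + hn n) - Q (hn n)"
      by metis
    obtain H' h where H': "H' \<le> H" "H' \<noteq> bot" and h: "h \<in> cball 0 \<rho>" "(hn \<longlongrightarrow> h) H'"
      using compact_cluster_filter[OF compact_cball \<open>H \<noteq> bot\<close>, of hn 0 \<rho>] hn(1) by (metis always_eventually)
    have lim': "((\<lambda>n. u n y) \<longlongrightarrow> l y) H'" for y using tendsto_mono[OF H'(1) lim] .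
    have "((\<lambda>n. u n (x + hn n) - Q (hn n)) \<longlongrightarrow> l (x + h) - Q h) H'"
      by (intro tendsto_diff moving_point_limit[OF \<open>0 \<le> \<kappa>\<close> sc bd lim'] tendsto_add tendsto_const h 
          continuous_on_tendsto_compose[OF Qc[of UNIV] h(2)]) auto
    moreover have "((\<lambda>n. u n (x + 0) - Q 0) \<longlongrightarrow> l (x + 0) - Q 0) H'" by (intro tendsto_diff lim' tendsto_const)
    ultimately have "l (x + 0) - Q 0 \<le> l (x + h) - Q h"
      using hn(2)[of 0] \<rho> by (intro tendsto_le[OF H'(2)]) auto
    moreover have "l (x + h) \<le> l x + p \<bullet> h + (h \<bullet> (A *v h)) / 2" using le h(1) \<rho> by simp
    ultimately have "\<eta> * (norm h)\<^sup>2 \<le> 0" by (simp add: Q_def)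
    then have "h = 0" using \<open>\<eta> > 0\<close> by (simp add: mult_le_0_iff)
    then have "\<forall>\<^sub>F n in H'. norm (hn n) < \<rho>"
      using h(2) \<rho> by (intro order_tendstoD[OF tendsto_norm]) auto
    moreover have "\<forall>\<^sub>F n in H'. \<forall>y. norm y < norm x + \<rho> \<longrightarrow> sjet (u n) y \<subseteq> F"
      using filter_leD[OF H'(1) jets] .
    ultimately have "\<forall>\<^sub>F n in H'. A + (2 * \<eta>) *\<^sub>R mat 1 \<in> F"
    proof eventually_elim
      case (elim n)
      have "u n (x + hn n + k) \<le> u n (x + hn n) + (p + A *v hn n + (2 * \<eta>) *\<^sub>R hn n) \<bullet> k + (k \<bullet> ((A + (2 * \<eta>) *\<^sub>R mat 1) *v k)) / 2"
        if "norm k < \<rho> - norm (hn n)" for k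
      proof -
        have "hn n + k \<in> cball 0 \<rho>" using that norm_triangle_ineq[of "hn n" k] by simp
        from hn(2)[OF this, of n] have "u n (x + hn n + k) \<le> u n (x + hn n) + (Q (hn n + k) - Q (hn n))"
          by (simp add: add.assoc)
        also have "Q (hn n + k) - Q (hn n) = (p + A *v hn n + (2 * \<eta>) *\<^sub>R hn n) \<bullet> k + (k \<bullet> ((A + (2 * \<eta>) *\<^sub>R mat 1) *v k)) / 2"
          unfolding add_mat_vector_mult using symmetric_inner_matrix[OF A(1), of "hn n" k]
          by (simp add: Q_def power2_norm_eq_inner matrix_vector_right_distrib inner_add_left inner_add_right
             inner_commute[of "A *v hn n"] inner_commute[of k "hn n"] algebra_simps add_divide_distrib)
        finally show ?thesis by simp
      qed
      moreover have "\<rho> - norm (hn n) > 0" using elim by simp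
      moreover have "transpose (A + (2 * \<eta>) *\<^sub>R mat 1) = A + (2 * \<eta>) *\<^sub>R mat 1" by (simp add: transpose_add_mat A)
      ultimately have "A + (2 * \<eta>) *\<^sub>R mat 1 \<in> sjet (u n) (x + hn n)" unfolding sjet_def by blast
      moreover have "norm (x + hn n) < norm x + \<rho>" using elim norm_triangle_ineq[of x "hn n"] by linarith
      ultimately show ?case using elim by blast
    qed
    then show ?thesis using H'(2) eventually_happens' by blast
  qed
  show "A \<in> F"
  proof (rule closed_approachable[OF \<open>closed F\<close>, THEN iffD1], intro allI impI)
    fix e :: real assume "e > 0"
    define N where "N = norm (mat 1 :: real^'n^'n)"
    define \<eta> where "\<eta> = e / (4 * (N + 1))"
    have "N \<ge> 0" by (simp add: N_def)
    have "\<eta> > 0" using \<open>e > 0\<close> \<open>N \<ge> 0\<close> by (simp add: \<eta>_def)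
    have "dist (A + (2 * \<eta>) *\<^sub>R mat 1) A = 2 * \<eta> * N" using \<open>\<eta> > 0\<close> by (simp add: dist_norm N_def)
    also have "\<dots> < e" using \<open>e > 0\<close> \<open>N \<ge> 0\<close> by (simp add: \<eta>_def field_simps) (auto intro!: add_pos_nonneg)
    finally show "\<exists>B\<in>F. dist B A < e" using AF[OF \<open>\<eta> > 0\<close>] by blast
  qed
qed

text \<open>Slopes at contact points are bounded, hence cluster along a finer filter. The contact
  points move with \<open>n\<close> because a blow-up provides them only near \<xi>, not at
  \<xi>.\<close>

lemma contact_limit:
  fixes u z :: "'i \<Rightarrow> 'a::euclidean_space \<Rightarrow> real" and x ps qs :: "'i \<Rightarrow> 'a"
  assumes "H \<noteq> bot" "0 \<le> \<kappa>" and scu: "\<And>n. semiconvex \<kappa> (u n)" and scz: "\<And>n. semiconvex \<kappa> (z n)"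
    and bdu: "\<And>n y. \<bar>u n y\<bar> \<le> \<kappa> * (norm y)\<^sup>2" and bdz: "\<And>n y. \<bar>z n y\<bar> \<le> \<kappa> * (norm y)\<^sup>2"
    and limu: "\<And>y. ((\<lambda>n. u n y) \<longlongrightarrow> lu y) H" and limz: "\<And>y. ((\<lambda>n. z n y) \<longlongrightarrow> lz y) H"
    and x: "(x \<longlongrightarrow> \<xi>) H" and c: "\<forall>\<^sub>F n in H. contact \<kappa> \<delta> (u n) (z n) (x n) (ps n) (qs n)"
  shows "\<exists>p q. contact \<kappa> \<delta> lu lz \<xi> p q"
proof -
  define R where "R = norm \<xi> + 1"
  let ?C = "\<kappa> * (R + 1)\<^sup>2 + \<kappa> * R\<^sup>2 + \<kappa>"
  have "\<forall>\<^sub>F n in H. norm (x n) < R"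
    using x by (intro order_tendstoD[OF tendsto_norm]) (auto simp: R_def)
  with c have "\<forall>\<^sub>F n in H. (ps n, qs n) \<in> cball 0 ?C \<times> cball 0 ?C"
  proof eventually_elim
    case (elim n)
    have "norm (ps n) \<le> ?C"
      by (rule subgradient_bound[where u = "u n" and \<xi> = "x n"]) (use elim bdu \<open>0 \<le> \<kappa>\<close> in \<open>auto simp: contact_def\<close>)
    moreover have "norm (qs n) \<le> ?C"
      by (rule subgradient_bound[where u = "z n" and \<xi> = "x n"]) (use elim bdz \<open>0 \<le> \<kappa>\<close> in \<open>auto simp: contact_def\<close>)
    ultimately show ?case by simp
  qed
  then obtain H' l where H': "H' \<le> H" "H' \<noteq> bot" and l: "((\<lambda>n. (ps n, qs n)) \<longlongrightarrow> l) H'"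
    by (rule compact_cluster_filter[OF compact_Times[OF compact_cball compact_cball] \<open>H \<noteq> bot\<close>])
  have p: "(ps \<longlongrightarrow> fst l) H'" and q: "(qs \<longlongrightarrow> snd l) H'"
    using tendsto_fst[OF l] tendsto_snd[OF l] by simp_all
  note x' = tendsto_mono[OF H'(1) x] and limu' = tendsto_mono[OF H'(1) limu] and limz' = tendsto_mono[OF H'(1) limz]
  note c' = filter_leD[OF H'(1) c]
  note mu = moving_point_limit[OF \<open>0 \<le> \<kappa>\<close> scu bdu limu'] and mz = moving_point_limit[OF \<open>0 \<le> \<kappa>\<close> scz bdz limz']
  have "contact \<kappa> \<delta> lu lz \<xi> (fst l) (snd l)"
    unfolding contact_def
  proof (intro conjI allI)
    fix h
    have xh: "((\<lambda>n. x n + h) \<longlongrightarrow> \<xi> + h) H'" by (intro tendsto_intros x')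
    note u1 = mu[OF x'] and u2 = mu[OF xh] and z1 = mz[OF x'] and z2 = mz[OF xh]
    have "((\<lambda>n. u n (x n) + ps n \<bullet> h - \<kappa> * (norm h)\<^sup>2) \<longlongrightarrow> lu \<xi> + fst l \<bullet> h - \<kappa> * (norm h)\<^sup>2) H'"
      by (intro tendsto_diff tendsto_add u1 tendsto_inner p tendsto_const)
    then show "lu \<xi> + fst l \<bullet> h - \<kappa> * (norm h)\<^sup>2 \<le> lu (\<xi> + h)"
      by (rule tendsto_le[OF H'(2) u2]) (rule eventually_mono[OF c'], simp add: contact_def)
    have "((\<lambda>n. z n (x n) + qs n \<bullet> h - \<kappa> * (norm h)\<^sup>2) \<longlongrightarrow> lz \<xi> + snd l \<bullet> h - \<kappa> * (norm h)\<^sup>2) H'"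
      by (intro tendsto_diff tendsto_add z1 tendsto_inner q tendsto_const)
    then show "lz \<xi> + snd l \<bullet> h - \<kappa> * (norm h)\<^sup>2 \<le> lz (\<xi> + h)"
      by (rule tendsto_le[OF H'(2) z2]) (rule eventually_mono[OF c'], simp add: contact_def)
    have "((\<lambda>n. u n (x n) + z n (x n) + (ps n + qs n) \<bullet> h - \<delta> * (norm h)\<^sup>2)
       \<longlongrightarrow> lu \<xi> + lz \<xi> + (fst l + snd l) \<bullet> h - \<delta> * (norm h)\<^sup>2) H'"
      by (intro tendsto_diff tendsto_add u1 z1 tendsto_inner p q tendsto_const)
    then show "lu (\<xi> + h) + lz (\<xi> + h) \<le> lu \<xi> + lz \<xi> + (fst l + snd l) \<bullet> h - \<delta> * (norm h)\<^sup>2"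
      by (rule tendsto_le[OF H'(2) _ tendsto_add[OF u2 z2]]) (rule eventually_mono[OF c'], simp add: contact_def)
  qed
  then show ?thesis by blast
qed

subsection \<open>Pairs in contact everywhere\<close>

text \<open>The growth bounds make value and gradient of both functions vanish at the origin.
  Semiconvexity is contained in contact at every point.\<close>

definition sub_pair :: "real \<Rightarrow> real \<Rightarrow> (real^'n^'n) set \<Rightarrow> (real^'n^'n) set \<Rightarrow> 
    (real^'n \<Rightarrow> real) \<Rightarrow> (real^'n \<Rightarrow> real) \<Rightarrow> bool" where
  "sub_pair \<kappa> \<delta> F G u z \<longleftrightarrow> (\<forall>y. \<bar>u y\<bar> \<le> \<kappa> * (norm y)\<^sup>2) \<and> (\<forall>y. \<bar>z y\<bar> \<le> \<kappa> * (norm y)\<^sup>2) \<and>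
     (\<forall>\<xi>. \<exists>p q. contact \<kappa> \<delta> u z \<xi> p q) \<and> (\<forall>x. sjet u x \<subseteq> F) \<and> (\<forall>x. sjet z x \<subseteq> G)"

lemma contact_everywhere_imp_semiconvex:
  assumes "\<forall>\<xi>. \<exists>p q. contact \<kappa> \<delta> u z \<xi> p q"
  shows "semiconvex \<kappa> u" "semiconvex \<kappa> z"
  using assms unfolding contact_def semiconvex_def by blast+

text \<open>The superjet conditions are asked only eventually on each ball, since the rescaled
  domains exhaust the space without being equal to it.\<close>

lemma sub_pair_limit:
  fixes u z :: "nat \<Rightarrow> real^'n \<Rightarrow> real"
  assumes H: "H \<noteq> bot" and "0 \<le> \<kappa>" "closed F" "closed G"
    and scu: "\<And>n. semiconvex \<kappa> (u n)" and scz: "\<And>n. semiconvex \<kappa> (z n)"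
    and bdu: "\<And>n y. \<bar>u n y\<bar> \<le> \<kappa> * (norm y)\<^sup>2" and bdz: "\<And>n y. \<bar>z n y\<bar> \<le> \<kappa> * (norm y)\<^sup>2"
    and limu: "\<And>y. ((\<lambda>n. u n y) \<longlongrightarrow> lu y) H" and limz: "\<And>y. ((\<lambda>n. z n y) \<longlongrightarrow> lz y) H"
    and c: "\<And>\<xi>. \<exists>x p q. (x \<longlongrightarrow> \<xi>) H \<and> (\<forall>\<^sub>F n in H. contact \<kappa> \<delta> (u n) (z n) (x n) (p n) (q n))"
    and ju: "\<And>R. \<forall>\<^sub>F n in H. \<forall>x. norm x < R \<longrightarrow> sjet (u n) x \<subseteq> F"
    and jz: "\<And>R. \<forall>\<^sub>F n in H. \<forall>x. norm x < R \<longrightarrow> sjet (z n) x \<subseteq> G"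
  shows "sub_pair \<kappa> \<delta> F G lu lz"
  unfolding sub_pair_def
proof (intro conjI allI)
  fix y
  show "\<bar>lu y\<bar> \<le> \<kappa> * (norm y)\<^sup>2"
    by (rule tendsto_upperbound[OF tendsto_rabs[OF limu] _ H]) (simp add: bdu)
  show "\<bar>lz y\<bar> \<le> \<kappa> * (norm y)\<^sup>2"
    by (rule tendsto_upperbound[OF tendsto_rabs[OF limz] _ H]) (simp add: bdz)
next
  fix \<xi>
  obtain x p q where "(x \<longlongrightarrow> \<xi>) H" "\<forall>\<^sub>F n in H. contact \<kappa> \<delta> (u n) (z n) (x n) (p n) (q n)"
    using c[of \<xi>] by (elim exE conjE)
  then show "\<exists>p q. contact \<kappa> \<delta> lu lz \<xi> p q"
    by (rule contact_limit[OF H \<open>0 \<le> \<kappa>\<close> scu scz bdu bdz limu limz])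
next
  fix x
  show "sjet lu x \<subseteq> F" by (rule sjet_limit[OF H \<open>closed F\<close> \<open>0 \<le> \<kappa>\<close> scu bdu limu ju])
  show "sjet lz x \<subseteq> G" by (rule sjet_limit[OF H \<open>closed G\<close> \<open>0 \<le> \<kappa>\<close> scz bdz limz jz])
qed

lemma abs_rescale_le:
  assumes "r > 0" and "\<And>h. \<bar>u (\<xi> + h) - u \<xi> - p \<bullet> h\<bar> \<le> \<kappa> * (norm h)\<^sup>2"
  shows "\<bar>rescale u \<xi> p r y\<bar> \<le> \<kappa> * (norm y)\<^sup>2"
proof -
  have "\<bar>rescale u \<xi> p r y\<bar> = \<bar>u (\<xi> + r *\<^sub>R y) - u \<xi> - p \<bullet> (r *\<^sub>R y)\<bar> / r\<^sup>2"
    by (simp add: rescale_def)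
  also have "\<dots> \<le> (\<kappa> * (norm (r *\<^sub>R y))\<^sup>2) / r\<^sup>2"
    by (intro divide_right_mono assms) auto
  also have "\<dots> = \<kappa> * (norm y)\<^sup>2" using \<open>r > 0\<close> by (simp add: power_mult_distrib)
  finally show ?thesis .
qed

lemma sub_pair_rescale:
  assumes "sub_pair \<kappa> \<delta> F G u z" "contact \<kappa> \<delta> u z \<xi> p q" "0 \<le> \<delta>" "r > 0"
  shows "sub_pair \<kappa> \<delta> F G (rescale u \<xi> p r) (rescale z \<xi> q r)"
  unfolding sub_pair_def
proof (intro conjI allI)
  note P = assms(1)[unfolded sub_pair_def]
  fix y
  show "\<bar>rescale u \<xi> p r y\<bar> \<le> \<kappa> * (norm y)\<^sup>2" "\<bar>rescale z \<xi> q r y\<bar> \<le> \<kappa> * (norm y)\<^sup>2"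
    by (intro abs_rescale_le[OF \<open>r > 0\<close>] contact_bounds[OF assms(2,3)])+
  obtain p' q' where "contact \<kappa> \<delta> u z (\<xi> + r *\<^sub>R y) p' q'" using P by blast
  from contact_rescale[OF \<open>r > 0\<close> this]
  show "\<exists>p' q'. contact \<kappa> \<delta> (rescale u \<xi> p r) (rescale z \<xi> q r) y p' q'" by blast
  show "sjet (rescale u \<xi> p r) y \<subseteq> F" "sjet (rescale z \<xi> q r) y \<subseteq> G"
    using sjet_rescale[OF \<open>r > 0\<close>] P by blast+
qed

lemma sub_pair_contact_0:
  assumes "sub_pair \<kappa> \<delta> F G u z" 
  shows "contact \<kappa> \<delta> u z 0 0 0" "u 0 = 0" "z 0 = 0"
proof -
  note P = assms[unfolded sub_pair_def]
  have u: "\<bar>u y\<bar> \<le> \<kappa> * (norm y)\<^sup>2" and z: "\<bar>z y\<bar> \<le> \<kappa> * (norm y)\<^sup>2" for y using P by blast+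
  show u0: "u 0 = 0" and z0: "z 0 = 0" using u[of 0] z[of 0] by simp_all
  obtain p q where c: "contact \<kappa> \<delta> u z 0 p q" using P by blast
  have "p \<bullet> h \<le> (2 * \<kappa>) * (norm h)\<^sup>2" "q \<bullet> h \<le> (2 * \<kappa>) * (norm h)\<^sup>2" for h
  proof -
    have "u 0 + p \<bullet> h - \<kappa> * (norm h)\<^sup>2 \<le> u (0 + h)" "z 0 + q \<bullet> h - \<kappa> * (norm h)\<^sup>2 \<le> z (0 + h)"
      using c unfolding contact_def by blast+
    then show "p \<bullet> h \<le> (2 * \<kappa>) * (norm h)\<^sup>2" "q \<bullet> h \<le> (2 * \<kappa>) * (norm h)\<^sup>2"
      using u[of h] z[of h] u0 z0 by simp_all
  qed
  then have "p = 0" "q = 0" using inner_le_quadratic_imp_zero by blast+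
  then show "contact \<kappa> \<delta> u z 0 0 0" using c by simp
qed

text \<open>Only \<open>z\<close> is extremised, while some partner \<open>u\<close> is carried
  along. Both are rescaled and recentred with the slopes of one common contact, and a cluster filter
  for the partners is refined to one for the functions themselves.\<close>

lemma blowup_closed_sub_pair:
  fixes F G :: "(real^'n^'n) set"
  assumes "0 \<le> \<kappa>" "0 \<le> \<delta>" "closed F" "closed G"
  shows "blowup_closed \<kappa> {z. \<exists>u. sub_pair \<kappa> \<delta> F G u z}"
  unfolding blowup_closed_def
proof (intro conjI ballI allI impI)
  fix z y assume "z \<in> {z. \<exists>u. sub_pair \<kappa> \<delta> F G u z}"
  then show "\<bar>z y\<bar> \<le> \<kappa> * (norm y)\<^sup>2" unfolding sub_pair_def by blast
next
  fix z and r :: real assume z: "z \<in> {z. \<exists>u. sub_pair \<kappa> \<delta> F G u z}" and "r > 0"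
  then obtain u where uz: "sub_pair \<kappa> \<delta> F G u z" by blast
  have "(\<lambda>y. z (r *\<^sub>R y) / r\<^sup>2) = rescale z 0 0 r"
    by (simp add: rescale_def[abs_def] sub_pair_contact_0[OF uz])
  then show "(\<lambda>y. z (r *\<^sub>R y) / r\<^sup>2) \<in> {z. \<exists>u. sub_pair \<kappa> \<delta> F G u z}"
    using sub_pair_rescale[OF uz sub_pair_contact_0(1)[OF uz] \<open>0 \<le> \<delta>\<close> \<open>r > 0\<close>] by auto
next
  fix z \<xi> assume z: "z \<in> {z. \<exists>u. sub_pair \<kappa> \<delta> F G u z}"
  then obtain u where uz: "sub_pair \<kappa> \<delta> F G u z" by blast
  then obtain p q where "contact \<kappa> \<delta> u z \<xi> p q" unfolding sub_pair_def by blast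
  from sub_pair_rescale[OF uz this \<open>0 \<le> \<delta>\<close> zero_less_one]
  have "rescale z \<xi> q 1 \<in> {z. \<exists>u. sub_pair \<kappa> \<delta> F G u z}" by blast
  moreover have "rescale z \<xi> q 1 = (\<lambda>y. z (\<xi> + y) - z \<xi> - q \<bullet> y)"
    by (simp add: rescale_def[abs_def])
  ultimately show "\<exists>p. (\<lambda>y. z (\<xi> + y) - z \<xi> - p \<bullet> y) \<in> {z. \<exists>u. sub_pair \<kappa> \<delta> F G u z}" by auto
next
  fix s :: "nat \<Rightarrow> real^'n \<Rightarrow> real" assume "\<forall>n. s n \<in> {z. \<exists>u. sub_pair \<kappa> \<delta> F G u z}"
  then obtain u where uz: "\<And>n. sub_pair \<kappa> \<delta> F G (u n) (s n)" by simp metis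
  note P = uz[unfolded sub_pair_def]
  have bdu: "\<bar>u n y\<bar> \<le> \<kappa> * (norm y)\<^sup>2" and bdz: "\<bar>s n y\<bar> \<le> \<kappa> * (norm y)\<^sup>2" for n y using P by blast+
  obtain H1 lu where H1: "H1 \<le> sequentially" "H1 \<noteq> bot" "\<And>y. ((\<lambda>n. u n y) \<longlongrightarrow> lu y) H1"
    by (rule pointwise_bounded_cluster[where s = u and B = "\<lambda>y. \<kappa> * (norm y)\<^sup>2", OF sequentially_bot bdu], rule that)
  obtain H lz where H: "H \<le> H1" "H \<noteq> bot" "\<And>y. ((\<lambda>n. s n y) \<longlongrightarrow> lz y) H"
    by (rule pointwise_bounded_cluster[where s = s and B = "\<lambda>y. \<kappa> * (norm y)\<^sup>2", OF H1(2) bdz], rule that)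
  have ce: "\<forall>\<xi>. \<exists>p q. contact \<kappa> \<delta> (u n) (s n) \<xi> p q" for n using P by blast
  have "sub_pair \<kappa> \<delta> F G lu lz"
  proof (rule sub_pair_limit[OF H(2) assms(1,3,4) contact_everywhere_imp_semiconvex(1)[OF ce] 
        contact_everywhere_imp_semiconvex(2)[OF ce] bdu bdz tendsto_mono[OF H(1) H1(3)] H(3)])
    fix \<xi>
    have "\<forall>n. \<exists>p q. contact \<kappa> \<delta> (u n) (s n) \<xi> p q" using ce by blast
    then obtain p q where "\<forall>n. contact \<kappa> \<delta> (u n) (s n) \<xi> (p n) (q n)" by metis
    then show "\<exists>x p q. (x \<longlongrightarrow> \<xi>) H \<and> (\<forall>\<^sub>F n in H. contact \<kappa> \<delta> (u n) (s n) (x n) (p n) (q n))"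
      by (intro exI[of _ "\<lambda>_. \<xi>"] exI[of _ p] exI[of _ q]) simp
  qed (use P in auto)
  then show "\<exists>H l. H \<le> sequentially \<and> H \<noteq> bot \<and> l \<in> {z. \<exists>u. sub_pair \<kappa> \<delta> F G u z} \<and> (\<forall>y. ((\<lambda>n. s n y) \<longlongrightarrow> l y) H)"
    using H H1(1) by (intro exI[of _ H] exI[of _ lz]) auto
qed

section \<open>Closedness of the dual and exclusion of pairs in contact everywhere\<close>

lemma norm_matrix_vector_mult_le:
  fixes A :: "real^'n^'m"
  shows "norm (A *v x) \<le> norm A * norm x"
proof -
  have "norm (A *v x) = L2_set (\<lambda>i. norm ((A *v x) $ i)) UNIV" by (simp add: norm_vec_def)
  also have "\<dots> \<le> L2_set (\<lambda>i. norm (A $ i) * norm x) UNIV"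
    by (rule L2_set_mono) (simp_all add: matrix_vector_mul_component Cauchy_Schwarz_ineq2)
  also have "\<dots> = norm A * norm x"
    by (simp add: norm_vec_def[of A] L2_set_left_distrib)
  finally show ?thesis .
qed

lemma closed_Sym2: "closed (Sym2 :: (real^'n^'n) set)"
proof -
  have "Sym2 = {A :: real^'n^'n. \<forall>i j. A $ i $ j = A $ j $ i}"
    by (auto simp: Sym2_def transpose_def vec_eq_iff)
  also have "closed \<dots>" 
    by (intro closed_Collect_all closed_Collect_eq continuous_intros)
  finally show ?thesis .
qed

lemma closed_dual_subeq: "closed (dual_subeq F)"
  unfolding closed_sequential_limits
proof (intro allI impI, elim conjE)
  fix A l assume A: "\<forall>n. A n \<in> dual_subeq F" and lim: "A \<longlonglongrightarrow> l"
  have sym: "A n \<in> Sym2" "- A n \<notin> sym_interior F" for n using A by (auto simp: dual_subeq_def)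
  have l: "l \<in> Sym2" using closed_Sym2 sym(1) lim closed_sequentially by blast
  have "- l \<notin> sym_interior F"
  proof
    assume "- l \<in> sym_interior F"
    then obtain e where e: "e > 0" "\<And>B. B \<in> Sym2 \<Longrightarrow> dist B (- l) < e \<Longrightarrow> B \<in> F"
      unfolding sym_interior_def by blast
    obtain n where n: "dist (A n) l < e / 2"
      using lim[THEN metric_LIMSEQ_D, of "e / 2"] e(1) by auto
    have d: "dist (- A n) (- l) < e / 2" using n by (simp add: dist_norm norm_minus_commute)
    have mS: "- A n \<in> Sym2" using sym(1)[of n] by (simp add: Sym2_def transpose_def vec_eq_iff)
    have "B \<in> F" if "B \<in> Sym2" "dist B (- A n) < e / 2" for B
      using e(2)[OF that(1)] dist_triangle[of B "- l" "- A n"] that(2) d by linarith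
    moreover have "- A n \<in> F" using e(2)[OF mS] d e(1) by simp
    ultimately have "- A n \<in> sym_interior F" using e(1) half_gt_zero unfolding sym_interior_def by blast
    with sym(2) show False by blast
  qed
  with l show "l \<in> dual_subeq F" by (simp add: dual_subeq_def)
qed

lemma no_sub_pair:
  fixes F :: "(real^'n^'n) set"
  assumes F: "cone_subequation F" and "0 \<le> \<kappa>" "0 < \<delta>"
  shows "\<not> sub_pair \<kappa> \<delta> F (dual_subeq F) u z"
proof
  assume "sub_pair \<kappa> \<delta> F (dual_subeq F) u z"
  then have ne: "{z. \<exists>u. sub_pair \<kappa> \<delta> F (dual_subeq F) u z} \<noteq> {}" by blast
  have "closed F" using F by (simp add: cone_subequation_def)
  have "blowup_closed \<kappa> {z. \<exists>u. sub_pair \<kappa> \<delta> F (dual_subeq F) u z}"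
    using assms \<open>closed F\<close> by (intro blowup_closed_sub_pair closed_dual_subeq) auto
  from blowup_closed_contains_quadratic[OF this ne] obtain z b 
    where "z \<in> {z. \<exists>u. sub_pair \<kappa> \<delta> F (dual_subeq F) u z}" and b: "linear b" "\<And>x y. b x \<bullet> y = x \<bullet> b y"
     and z: "\<And>x. z x = (x \<bullet> b x) / 2" by blast
  then obtain u where uz: "sub_pair \<kappa> \<delta> F (dual_subeq F) u z" by blast
  define A where "A = matrix b"
  have Ab: "A *v x = b x" for x using matrix_vector_mul(2)[OF b(1)] by (simp add: A_def fun_eq_iff)
  have A_sym: "transpose A = A"
  proof -
    have "b (axis j 1) $ i = b (axis i 1) $ j" for i j
      using b(2)[of "axis j 1" "axis i 1"] by (simp add: inner_axis inner_axis')
    then show ?thesis by (simp add: A_def matrix_def transpose_def vec_eq_iff)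
  qed
  have "\<forall>h. norm h < 1 \<longrightarrow> z (0 + h) \<le> z 0 + 0 \<bullet> h + (h \<bullet> (A *v h)) / 2"
    by (simp add: z Ab)
  then have "A \<in> sjet z 0"
    unfolding sjet_def using A_sym zero_less_one by blast
  then have "A \<in> dual_subeq F" using uz unfolding sub_pair_def by blast
  then have nint: "- A \<notin> sym_interior F" by (simp add: dual_subeq_def)
  \<comment> \<open>The Hessian of the quadratic form \<open>- z - \<delta> |h|^2\<close>, which
    lies above \<open>u\<close> and touches it at the origin.\<close>
  define C where "C = - A + (- (2 * \<delta>)) *\<^sub>R mat 1"
  have Cv: "C *v x = - b x - (2 * \<delta>) *\<^sub>R x" for x
    unfolding C_def add_mat_vector_mult using scaleR_matrix_vector_assoc[of "- 1" A x] by (simp add: Ab)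
  have tmA: "transpose (- A) = - A" using A_sym by (simp add: transpose_def vec_eq_iff)
  have C_sym: "transpose C = C" unfolding C_def transpose_add_mat tmA ..
  have "u h \<le> (h \<bullet> (C *v h)) / 2" for h
  proof -
    have "u (0 + h) + z (0 + h) \<le> u 0 + z 0 + (0 + 0) \<bullet> h - \<delta> * (norm h)\<^sup>2"
      using sub_pair_contact_0(1)[OF uz] unfolding contact_def by blast
    then show ?thesis
      using sub_pair_contact_0(2,3)[OF uz] z[of h] by (simp add: Cv inner_diff_right dot_square_norm diff_divide_distrib)
  qed
  then have "\<forall>h. norm h < 1 \<longrightarrow> u (0 + h) \<le> u 0 + 0 \<bullet> h + (h \<bullet> (C *v h)) / 2"
    by (simp add: sub_pair_contact_0(2)[OF uz])
  then have "C \<in> sjet u 0"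
    unfolding sjet_def using C_sym zero_less_one by blast
  then have CF: "C \<in> F" using uz unfolding sub_pair_def by blast
  \<comment> \<open>The norm on matrices is the Frobenius norm, which dominates the operator norm;
    so a symmetric \<open>B\<close> closer to \<open>- A\<close> than \<open>2 * \<delta>\<close>
    exceeds \<open>C\<close> by a positive semidefinite matrix.\<close>
  have near: "B \<in> F" if B: "B \<in> Sym2" "dist B (- A) < 2 * \<delta>" for B
  proof -
    have "psd (B - C)"
      unfolding psd_def
    proof (intro conjI allI)
      show "transpose (B - C) = B - C"
        using B(1) C_sym by (simp add: Sym2_def transpose_def vec_eq_iff)
      fix \<xi>
      have "(B - C) *v \<xi> = (B + A) *v \<xi> + (2 * \<delta>) *\<^sub>R \<xi>"
        by (simp add: matrix_vector_mult_diff_rdistrib matrix_vector_mult_add_rdistrib Cv Ab)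
      then have "\<xi> \<bullet> ((B - C) *v \<xi>) = \<xi> \<bullet> ((B + A) *v \<xi>) + 2 * \<delta> * (norm \<xi>)\<^sup>2"
        by (simp add: inner_add_right dot_square_norm)
      moreover have "\<bar>\<xi> \<bullet> ((B + A) *v \<xi>)\<bar> \<le> norm \<xi> * (norm (B + A) * norm \<xi>)"
        by (rule order_trans[OF Cauchy_Schwarz_ineq2 mult_left_mono[OF norm_matrix_vector_mult_le]]) simp
      moreover have "norm \<xi> * (norm (B + A) * norm \<xi>) \<le> norm \<xi> * (2 * \<delta> * norm \<xi>)"
        using B(2) by (intro mult_left_mono mult_right_mono) (auto simp: dist_norm)
      ultimately show "0 \<le> \<xi> \<bullet> ((B - C) *v \<xi>)" by (simp add: power2_eq_square algebra_simps abs_le_iff)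
    qed
    with CF have "C + (B - C) \<in> F" using F unfolding cone_subequation_def by blast
    then show ?thesis by simp
  qed
  moreover have "- A \<in> F" using near[of "- A"] tmA \<open>0 < \<delta>\<close> by (simp add: Sym2_def)
  moreover have "2 * \<delta> > 0" using \<open>0 < \<delta>\<close> by simp
  ultimately have "- A \<in> sym_interior F" unfolding sym_interior_def by blast
  with nint show False by blast
qed

subsection \<open>Jensen's lemma and blow-up\<close>

text \<open>The subgradients of \<open>u\<close> and \<open>z\<close> add up to a slope from below
  and the tilt gives one from above; touching from both sides makes them equal, which fixes
  \<open>p + q\<close>.\<close>

lemma contact_of_tilt:
  fixes u z :: "'a::real_inner \<Rightarrow> real"
  assumes "semiconvex \<kappa> u" "semiconvex \<kappa> z"
    and tilt: "\<And>h. u (\<xi> + h) + z (\<xi> + h) + \<delta> * (norm (\<xi> + h - a))\<^sup>2 \<le> u \<xi> + z \<xi> + \<delta> * (norm (\<xi> - a))\<^sup>2 + s \<bullet> h"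
  obtains p q where "contact \<kappa> \<delta> u z \<xi> p q" "p + q = s - (2 * \<delta>) *\<^sub>R (\<xi> - a)"
proof -
  obtain p where p: "\<And>h. u \<xi> + p \<bullet> h - \<kappa> * (norm h)\<^sup>2 \<le> u (\<xi> + h)" using assms(1) unfolding semiconvex_def by blast
  obtain q where q: "\<And>h. z \<xi> + q \<bullet> h - \<kappa> * (norm h)\<^sup>2 \<le> z (\<xi> + h)" using assms(2) unfolding semiconvex_def by blast
  have up: "u (\<xi> + h) + z (\<xi> + h) \<le> u \<xi> + z \<xi> + (s - (2 * \<delta>) *\<^sub>R (\<xi> - a)) \<bullet> h - \<delta> * (norm h)\<^sup>2" for h
  proof -
    have "\<delta> * (norm (\<xi> + h - a))\<^sup>2 = \<delta> * (norm (\<xi> - a))\<^sup>2 + ((2 * \<delta>) *\<^sub>R (\<xi> - a)) \<bullet> h + \<delta> * (norm h)\<^sup>2"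
      by (simp add: power2_norm_eq_inner inner_add_left inner_add_right inner_diff_left inner_diff_right inner_commute algebra_simps)
    with tilt[of h] show ?thesis by (simp add: inner_diff_left)
  qed
  have "p + q - (s - (2 * \<delta>) *\<^sub>R (\<xi> - a)) = 0"
  proof (rule inner_le_quadratic_imp_zero)
    fix h
    have "(p + q - (s - (2 * \<delta>) *\<^sub>R (\<xi> - a))) \<bullet> h = p \<bullet> h + q \<bullet> h - (s - (2 * \<delta>) *\<^sub>R (\<xi> - a)) \<bullet> h"
      by (simp only: inner_add_left inner_diff_left)
    then show "(p + q - (s - (2 * \<delta>) *\<^sub>R (\<xi> - a))) \<bullet> h \<le> (2 * \<kappa> - \<delta>) * (norm h)\<^sup>2"
      using p[of h] q[of h] up[of h] unfolding left_diff_distrib by linarith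
  qed
  then have pq: "p + q = s - (2 * \<delta>) *\<^sub>R (\<xi> - a)" by simp
  have "contact \<kappa> \<delta> u z \<xi> p q" unfolding contact_def pq using p q up by blast
  with pq show ?thesis by (rule that[rotated])
qed

text \<open>The three inequalities combine to a bound of
  \<open>(s - t) \<bullet> (y - \<eta>)\<close> by \<open>L * (norm (y - \<xi>))\<^sup>2\<close>.
  Leaving \<eta> in the direction of \<open>s - t\<close> by the distance between \<eta> and \<xi>
  keeps \<open>y\<close> within twice that distance of \<xi>, whence the 4.\<close>

lemma tilt_lipschitz:
  fixes f :: "'a::real_inner \<Rightarrow> real"
  assumes lo: "\<And>h. f \<xi> + s \<bullet> h - L * (norm h)\<^sup>2 \<le> f (\<xi> + h)"
    and s: "\<And>h. f (\<xi> + h) \<le> f \<xi> + s \<bullet> h" and t: "\<And>h. f (\<eta> + h) \<le> f \<eta> + t \<bullet> h"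
  shows "norm (s - t) \<le> 4 * L * norm (\<eta> - \<xi>)"
proof -
  have ineq: "(s - t) \<bullet> (y - \<eta>) \<le> L * (norm (y - \<xi>))\<^sup>2" for y
    using lo[of "y - \<xi>"] s[of "\<eta> - \<xi>"] t[of "y - \<eta>"] by (simp add: inner_diff_left inner_diff_right)
  show ?thesis
  proof (cases "\<eta> = \<xi>")
    case True
    then have "(s - t) \<bullet> h \<le> L * (norm h)\<^sup>2" for h using ineq[of "\<eta> + h"] by simp
    then have "s - t = 0" by (rule inner_le_quadratic_imp_zero)
    with True show ?thesis by simp
  next
    case False
    define d where "d = norm (\<eta> - \<xi>)"
    have "d > 0" using False by (simp add: d_def)
    have "L \<ge> 0"
    proof -
      have "0 \<le> L * d\<^sup>2" using lo[of "\<eta> - \<xi>"] s[of "\<eta> - \<xi>"] by (simp add: d_def)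
      then show ?thesis using \<open>d > 0\<close> by (simp add: zero_le_mult_iff)
    qed
    define w where "w = sgn (s - t)"
    have "norm w \<le> 1" by (simp add: w_def norm_sgn)
    have "(s - t) \<bullet> w = norm (s - t)"
      by (simp add: w_def sgn_div_norm dot_square_norm power2_eq_square divide_simps)
    then have "d * norm (s - t) = (s - t) \<bullet> (\<eta> + d *\<^sub>R w - \<eta>)" by simp
    also have "\<dots> \<le> L * (norm (\<eta> + d *\<^sub>R w - \<xi>))\<^sup>2" by (rule ineq)
    also have "\<dots> \<le> L * (2 * d)\<^sup>2"
    proof (intro mult_left_mono power_mono)
      have "norm (\<eta> + d *\<^sub>R w - \<xi>) = norm ((\<eta> - \<xi>) + d *\<^sub>R w)" by (simp add: algebra_simps)
      also have "\<dots> \<le> d + d * norm w" using norm_triangle_ineq[of "\<eta> - \<xi>" "d *\<^sub>R w"] \<open>d > 0\<close> by (simp add: d_def)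
      also have "\<dots> \<le> 2 * d" using \<open>norm w \<le> 1\<close> \<open>d > 0\<close> by (simp add: mult_left_le)
      finally show "norm (\<eta> + d *\<^sub>R w - \<xi>) \<le> 2 * d" .
    qed (use \<open>L \<ge> 0\<close> in auto)
    also have "\<dots> = d * (4 * L * d)" by (simp add: power2_eq_square)
    finally show ?thesis using \<open>d > 0\<close> by (simp add: d_def)
  qed
qed

text \<open>The upper contact set: points with a global supporting hyperplane from above whose slope
  has length at most \<open>r\<close>.\<close>

definition tilt_set :: "('a::real_inner \<Rightarrow> real) \<Rightarrow> real \<Rightarrow> 'a set" where
  "tilt_set f r = {\<xi>. \<exists>s. norm s \<le> r \<and> (\<forall>h. f (\<xi> + h) \<le> f \<xi> + s \<bullet> h)}"

lemma closed_tilt_set: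
  fixes f :: "'a::euclidean_space \<Rightarrow> real"
  assumes f: "continuous_on UNIV f"
  shows "closed (tilt_set f r)"
  unfolding closed_sequential_limits
proof (intro allI impI, elim conjE)
  fix x l assume x: "\<forall>n. x n \<in> tilt_set f r" and lim: "x \<longlonglongrightarrow> l"
  obtain s where s: "\<And>n. norm (s n) \<le> r" "\<And>n h. f (x n + h) \<le> f (x n) + s n \<bullet> h"
    using x unfolding tilt_set_def by simp metis
  have "\<forall>\<^sub>F n in sequentially. s n \<in> cball 0 r" using s(1) by simp
  then obtain H t where H: "H \<le> sequentially" "H \<noteq> bot" "t \<in> cball 0 r" "(s \<longlongrightarrow> t) H"
    by (rule compact_cluster_filter[OF compact_cball sequentially_bot])
  note xl = tendsto_mono[OF H(1) lim]
  have fl: "((\<lambda>n. f (y n)) \<longlongrightarrow> f l') H" if "(y \<longlongrightarrow> l') H" for y l'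
    by (rule continuous_on_tendsto_compose[OF f that]) auto
  have "f (l + h) \<le> f l + t \<bullet> h" for h
  proof (rule tendsto_le[OF H(2)])
    show "((\<lambda>n. f (x n) + s n \<bullet> h) \<longlongrightarrow> f l + t \<bullet> h) H" 
      by (intro tendsto_add fl xl tendsto_inner H tendsto_const)
    show "((\<lambda>n. f (x n + h)) \<longlongrightarrow> f (l + h)) H"
      by (intro fl tendsto_add xl tendsto_const)
  qed (use s in simp)
  then show "l \<in> tilt_set f r" unfolding tilt_set_def using H(3) by auto
qed

text \<open>Jensen's lemma: the map sending a contact point to its slope is Lipschitz and covers a ball.\<close>

lemma tilt_set_not_negligible:
  fixes f :: "'a::euclidean_space \<Rightarrow> real"
  assumes f: "continuous_on UNIV f" and "r > 0"
    and lo: "\<And>\<xi> s h. \<lbrakk>norm s \<le> r; \<And>h. f (\<xi> + h) \<le> f \<xi> + s \<bullet> h\<rbrakk> \<Longrightarrow> f \<xi> + s \<bullet> h - L * (norm h)\<^sup>2 \<le> f (\<xi> + h)"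
    and far: "\<And>y. R < norm (y - a) \<Longrightarrow> f y + r * norm (y - a) < f a" and "R \<ge> 0"
  shows "\<not> negligible (tilt_set f r)"
proof
  let ?A = "tilt_set f r"
  assume neg: "negligible ?A"
  have "\<forall>\<xi>\<in>?A. \<exists>s. norm s \<le> r \<and> (\<forall>h. f (\<xi> + h) \<le> f \<xi> + s \<bullet> h)" by (simp add: tilt_set_def)
  then obtain g where g: "\<And>\<xi>. \<xi> \<in> ?A \<Longrightarrow> norm (g \<xi>) \<le> r" "\<And>\<xi> h. \<xi> \<in> ?A \<Longrightarrow> f (\<xi> + h) \<le> f \<xi> + g \<xi> \<bullet> h"
    by metis
  have lip: "norm (g \<xi> - t) \<le> 4 * L * norm (\<eta> - \<xi>)" 
    if "\<xi> \<in> ?A" "\<And>h. f (\<eta> + h) \<le> f \<eta> + t \<bullet> h" for \<xi> \<eta> t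
    by (rule tilt_lipschitz[OF lo[OF g(1)[OF that(1)] g(2)[OF that(1)]] g(2)[OF that(1)] that(2)])
  have "negligible (g ` ?A)"
  proof (rule negligible_locally_Lipschitz_image[OF order_refl neg])
    fix x assume x: "x \<in> ?A"
    show "\<exists>T B. open T \<and> x \<in> T \<and> (\<forall>y\<in>?A \<inter> T. norm (g y - g x) \<le> B * norm (y - x))"
    proof (intro exI conjI ballI)
      fix y assume "y \<in> ?A \<inter> UNIV"
      then show "norm (g y - g x) \<le> (4 * L) * norm (y - x)"
        using lip[OF x g(2), of y] by (simp add: norm_minus_commute)
    qed auto
  qed
  \<comment> \<open>By \<open>far\<close> a maximum of the tilted function over
    \<open>cball a R\<close> is a global one. The slope at a contact point is unique, by the
    Lipschitz estimate for two equal points, so it coincides with the chosen one.\<close>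
  moreover have "ball 0 r \<subseteq> g ` ?A"
  proof
    fix s :: 'a assume "s \<in> ball 0 r"
    then have s: "norm s \<le> r" by simp
    have "\<exists>\<xi>\<in>cball a R. \<forall>y\<in>cball a R. f y - s \<bullet> y \<le> f \<xi> - s \<bullet> \<xi>"
      using \<open>R \<ge> 0\<close> by (intro continuous_attains_sup continuous_intros continuous_on_subset[OF f]) auto
    then obtain \<xi> where \<xi>: "\<And>y. y \<in> cball a R \<Longrightarrow> f y - s \<bullet> y \<le> f \<xi> - s \<bullet> \<xi>" by blast
    have all: "f y - s \<bullet> y \<le> f \<xi> - s \<bullet> \<xi>" for y
    proof (cases "y \<in> cball a R")
      case False
      then have "f y + r * norm (y - a) < f a" by (intro far) (simp add: dist_norm norm_minus_commute)
      moreover have "- (s \<bullet> (y - a)) \<le> norm s * norm (y - a)" using Cauchy_Schwarz_ineq2[of s "y - a"] by linarith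
      moreover have "norm s * norm (y - a) \<le> r * norm (y - a)" using s by (intro mult_right_mono) auto
      moreover have "f a - s \<bullet> a \<le> f \<xi> - s \<bullet> \<xi>" using \<xi>[of a] \<open>R \<ge> 0\<close> by simp
      ultimately show ?thesis by (simp add: inner_diff_right)
    qed (rule \<xi>)
    have tl: "f (\<xi> + h) \<le> f \<xi> + s \<bullet> h" for h using all[of "\<xi> + h"] by (simp add: inner_add_right)
    then have A: "\<xi> \<in> ?A" unfolding tilt_set_def using s by blast
    have "norm (g \<xi> - s) \<le> 4 * L * norm (\<xi> - \<xi>)" by (rule lip[OF A tl])
    then have "g \<xi> = s" by simp
    with A show "s \<in> g ` ?A" by blast
  qed
  ultimately have "negligible (ball (0::'a) r)" by (rule negligible_subset)
  moreover have "\<not> negligible (ball (0::'a) r)" using \<open>r > 0\<close> by (intro open_not_negligible) auto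
  ultimately show False by blast
qed

text \<open>For each \<open>n\<close> porosity with constant \<open>1 / (N n)\<^sup>2\<close> fails,
  so within some ball of radius \<open>\<rho> n\<close> about a point of \<open>A\<close> every
  point is closer than \<open>\<rho> n / (N n)\<^sup>2\<close> to \<open>A\<close>. The intermediate
  scale \<open>\<rho> n / N n\<close> expands this ball to radius \<open>N n\<close> and still
  shrinks the gaps to \<open>1 / N n\<close>; in the limit every point is a contact point.\<close>

lemma sub_pair_of_blowup:
  fixes u z :: "real^'n \<Rightarrow> real"
  assumes "0 \<le> \<kappa>" "0 \<le> \<delta>" "closed F" "closed G"
    and scu: "semiconvex \<kappa> u" and scz: "semiconvex \<kappa> z"
    and A: "compact A" "\<not> negligible A" "A \<subseteq> V" "open V"
    and c: "\<And>\<xi>. \<xi> \<in> A \<Longrightarrow> \<exists>p q. contact \<kappa> \<delta> u z \<xi> p q"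
    and ju: "\<And>x. x \<in> V \<Longrightarrow> sjet u x \<subseteq> F" and jz: "\<And>x. x \<in> V \<Longrightarrow> sjet z x \<subseteq> G"
  shows "\<exists>u z. sub_pair \<kappa> \<delta> F G u z"
proof -
  obtain d where "d > 0" and d: "(\<Union>x\<in>A. ball x d) \<subseteq> V"
    using compact_subset_open_imp_ball_epsilon_subset[OF A(1,4,3)] by blast
  define N where "N n = real n + 1" for n :: nat
  have N: "N n \<ge> 1" for n by (simp add: N_def)
  have "\<exists>x r. x \<in> A \<and> 0 < r \<and> r < d \<and> (\<forall>y. dist x y < r \<longrightarrow> ball y (r / (N n)\<^sup>2) \<inter> A \<noteq> {})" for n
  proof (rule ccontr)
    assume no: "\<not> ?thesis"
    have "negligible A"
    proof (rule porous_imp_negligible[OF A(1) _ _ \<open>d > 0\<close>])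
      show "0 < 1 / (N n)\<^sup>2" "1 / (N n)\<^sup>2 \<le> 1" using N[of n] by (auto simp: divide_simps)
      fix x r assume "x \<in> A" "0 < r" "r < d"
      then show "\<exists>y. dist x y < r \<and> ball y (1 / (N n)\<^sup>2 * r) \<inter> A = {}" using no by auto
    qed
    with A(2) show False by blast
  qed
  then obtain x \<rho> where x: "\<And>n. x n \<in> A" and \<rho>: "\<And>n. 0 < \<rho> n" "\<And>n. \<rho> n < d"
    and near: "\<And>n y. dist (x n) y < \<rho> n \<Longrightarrow> ball y (\<rho> n / (N n)\<^sup>2) \<inter> A \<noteq> {}" by metis
  define r where "r n = \<rho> n / N n" for n
  have r: "r n > 0" for n using \<rho>(1)[of n] N[of n] by (simp add: r_def)
  have "\<forall>n. \<exists>p q. contact \<kappa> \<delta> u z (x n) p q" using c x by blast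
  then obtain p q where pq: "\<And>n. contact \<kappa> \<delta> u z (x n) (p n) (q n)" by metis
  define U where "U n = rescale u (x n) (p n) (r n)" for n
  define W where "W n = rescale z (x n) (q n) (r n)" for n
  have bdu: "\<bar>U n y\<bar> \<le> \<kappa> * (norm y)\<^sup>2" and bdz: "\<bar>W n y\<bar> \<le> \<kappa> * (norm y)\<^sup>2" for n y
    unfolding U_def W_def by (intro abs_rescale_le[OF r] contact_bounds[OF pq \<open>0 \<le> \<delta>\<close>])+
  have scU: "semiconvex \<kappa> (U n)" and scW: "semiconvex \<kappa> (W n)" for n
    unfolding U_def W_def by (intro semiconvex_rescale r scu scz)+
  obtain H1 lu where H1: "H1 \<le> sequentially" "H1 \<noteq> bot" "\<And>y. ((\<lambda>n. U n y) \<longlongrightarrow> lu y) H1"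
    by (rule pointwise_bounded_cluster[where s = U and B = "\<lambda>y. \<kappa> * (norm y)\<^sup>2", OF sequentially_bot bdu], rule that)
  obtain H lz where H: "H \<le> H1" "H \<noteq> bot" "\<And>y. ((\<lambda>n. W n y) \<longlongrightarrow> lz y) H"
    by (rule pointwise_bounded_cluster[where s = W and B = "\<lambda>y. \<kappa> * (norm y)\<^sup>2", OF H1(2) bdz], rule that)
  have Hs: "H \<le> sequentially" using H(1) H1(1) by order
  have big: "\<forall>\<^sub>F n in H. R < N n" for R
  proof (rule filter_leD[OF Hs])
    obtain n0 where "R < real n0" using reals_Archimedean2 by blast
    then show "\<forall>\<^sub>F n in sequentially. R < N n"
      by (intro eventually_sequentiallyI[of n0]) (simp add: N_def)
  qed
  have inO: "\<forall>\<^sub>F n in H. \<forall>y. norm y < R \<longrightarrow> x n + r n *\<^sub>R y \<in> V" for R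
    using big[of R]
  proof eventually_elim
    case (elim n)
    have "x n + r n *\<^sub>R y \<in> ball (x n) d" if "norm y < R" for y
    proof -
      have "r n * norm y \<le> r n * N n" using that elim r[of n] by (intro mult_left_mono) auto
      also have "\<dots> < d" using \<rho>(2)[of n] N[of n] by (simp add: r_def)
      finally show ?thesis using r[of n] by (simp add: dist_norm)
    qed
    then show ?case using d x by blast
  qed
  have "sub_pair \<kappa> \<delta> F G lu lz"
  proof (rule sub_pair_limit[OF H(2) assms(1,3,4) scU scW bdu bdz tendsto_mono[OF H(1) H1(3)] H(3)])
    fix R
    show "\<forall>\<^sub>F n in H. \<forall>y. norm y < R \<longrightarrow> sjet (U n) y \<subseteq> F"
      using inO[of R] by eventually_elim (use ju sjet_rescale[OF r] in \<open>unfold U_def, blast\<close>)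
    show "\<forall>\<^sub>F n in H. \<forall>y. norm y < R \<longrightarrow> sjet (W n) y \<subseteq> G"
      using inO[of R] by eventually_elim (use jz sjet_rescale[OF r] in \<open>unfold W_def, blast\<close>)
  next
    fix \<xi>
    have "\<exists>y p' q'. norm \<xi> < N n \<longrightarrow> norm (y - \<xi>) \<le> inverse (real (Suc n)) \<and> contact \<kappa> \<delta> (U n) (W n) y p' q'" for n
    proof (cases "norm \<xi> < N n")
      case True
      have "dist (x n) (x n + r n *\<^sub>R \<xi>) = r n * norm \<xi>" using r[of n] by (simp add: dist_norm)
      also have "\<dots> < r n * N n" using True r[of n] by simp
      also have "\<dots> = \<rho> n" using N[of n] by (simp add: r_def)
      finally obtain x' where x': "x' \<in> A" "dist (x n + r n *\<^sub>R \<xi>) x' < \<rho> n / (N n)\<^sup>2" using near by fastforce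
      define y where "y = (x' - x n) /\<^sub>R r n"
      have xy: "x n + r n *\<^sub>R y = x'" using r[of n] by (simp add: y_def)
      have "r n * norm (y - \<xi>) = dist (x n + r n *\<^sub>R \<xi>) x'"
        using r[of n] by (simp add: xy[symmetric] dist_norm norm_minus_commute[of y] flip: scaleR_diff_right)
      also have "\<dots> < r n * inverse (N n)" using x'(2) N[of n] by (simp add: r_def power2_eq_square divide_inverse)
      finally have "norm (y - \<xi>) < inverse (N n)" using r[of n] by simp
      moreover obtain p' q' where "contact \<kappa> \<delta> u z (x n + r n *\<^sub>R y) p' q'" using c[OF x'(1)] unfolding xy by blast
      from contact_rescale[OF r this] have "\<exists>p' q'. contact \<kappa> \<delta> (U n) (W n) y p' q'"
        unfolding U_def W_def by blast
      ultimately show ?thesis by (auto simp: N_def add.commute intro: less_imp_le)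
    qed auto
    then obtain y p' q' where y: "\<And>n. norm \<xi> < N n \<Longrightarrow> norm (y n - \<xi>) \<le> inverse (real (Suc n))"
       and cy: "\<And>n. norm \<xi> < N n \<Longrightarrow> contact \<kappa> \<delta> (U n) (W n) (y n) (p' n) (q' n)" by metis
    have "((\<lambda>n. y n - \<xi>) \<longlongrightarrow> 0) H"
    proof (rule Lim_null_comparison)
      show "\<forall>\<^sub>F n in H. norm (y n - \<xi>) \<le> inverse (real (Suc n))"
        using big[of "norm \<xi>"] by eventually_elim (rule y)
      show "((\<lambda>n. inverse (real (Suc n))) \<longlongrightarrow> 0) H"
        by (rule tendsto_mono[OF Hs LIMSEQ_inverse_real_of_nat])
    qed
    then have "(y \<longlongrightarrow> \<xi>) H" by (simp add: Lim_null[symmetric])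
    moreover have "\<forall>\<^sub>F n in H. contact \<kappa> \<delta> (U n) (W n) (y n) (p' n) (q' n)"
      using big[of "norm \<xi>"] by eventually_elim (rule cy)
    ultimately show "\<exists>x p q. (x \<longlongrightarrow> \<xi>) H \<and> (\<forall>\<^sub>F n in H. contact \<kappa> \<delta> (U n) (W n) (x n) (p n) (q n))"
      by blast
  qed
  then show ?thesis by blast
qed

lemma semiconvex_comparison:
  fixes F :: "(real^'n^'n) set" and u z :: "real^'n \<Rightarrow> real" and a \<delta>
  defines "f \<equiv> \<lambda>\<xi>. u \<xi> + z \<xi> + \<delta> * (norm (\<xi> - a))\<^sup>2"
  assumes F: "cone_subequation F" and "0 \<le> \<kappa>" "0 < \<delta>"
    and scu: "semiconvex \<kappa> u" and scz: "semiconvex \<kappa> z"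
    and cu: "continuous_on UNIV u" and cz: "continuous_on UNIV z"
    and m: "m < f a" and far: "\<And>y. R < norm (y - a) \<Longrightarrow> f y + norm (y - a) < f a"
    and ju: "\<And>x. m < f x \<Longrightarrow> sjet u x \<subseteq> F" and jz: "\<And>x. m < f x \<Longrightarrow> sjet z x \<subseteq> dual_subeq F"
  shows False
proof -
  define R' where "R' = max R 1"
  \<comment> \<open>The bound 1 lets \<open>far\<close> absorb the tilt and confines contact points
    to distance \<open>R'\<close> from \<open>a\<close>. The other bound keeps the loss
    \<open>r * R'\<close> below \<open>f a - m\<close>, so contact occurs where \<open>m < f\<close>
    and superjets are controlled.\<close>
  define r where "r = min 1 ((f a - m) / (2 * R'))"
  have R': "R' \<ge> 1" "R \<le> R'" by (auto simp: R'_def)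
  have r: "0 < r" "r \<le> 1" "r * R' < f a - m"
  proof -
    show "0 < r" "r \<le> 1" using m R' by (auto simp: r_def)
    have "r * R' \<le> ((f a - m) / (2 * R')) * R'" using R' by (intro mult_right_mono) (auto simp: r_def)
    also have "\<dots> = (f a - m) / 2" using R' by simp
    finally show "r * R' < f a - m" using m by simp
  qed
  have cf: "continuous_on UNIV f" unfolding f_def by (intro continuous_intros cu cz)
  have far': "f y + r * norm (y - a) < f a" if "R' < norm (y - a)" for y
  proof -
    have "r * norm (y - a) \<le> 1 * norm (y - a)" using r by (intro mult_right_mono) auto
    with far[of y] that R' show ?thesis by simp
  qed
  have tilt_contact: "\<exists>p q. contact \<kappa> \<delta> u z \<xi> p q \<and> p + q = s - (2 * \<delta>) *\<^sub>R (\<xi> - a)"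
    if "\<And>h. f (\<xi> + h) \<le> f \<xi> + s \<bullet> h" for \<xi> s
    using contact_of_tilt[OF scu scz, of \<xi> \<delta> a s] that unfolding f_def by metis
  have lo: "f \<xi> + s \<bullet> h - (2 * \<kappa>) * (norm h)\<^sup>2 \<le> f (\<xi> + h)"
    if tl: "\<And>h. f (\<xi> + h) \<le> f \<xi> + s \<bullet> h" for \<xi> s h
  proof -
    obtain p q where c: "contact \<kappa> \<delta> u z \<xi> p q" and pq: "p + q = s - (2 * \<delta>) *\<^sub>R (\<xi> - a)" using tilt_contact[OF tl] by blast
    have "u \<xi> + p \<bullet> h - \<kappa> * (norm h)\<^sup>2 \<le> u (\<xi> + h)" "z \<xi> + q \<bullet> h - \<kappa> * (norm h)\<^sup>2 \<le> z (\<xi> + h)"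
      using c by (auto simp: contact_def)
    moreover have "p \<bullet> h + q \<bullet> h = s \<bullet> h - ((2 * \<delta>) *\<^sub>R (\<xi> - a)) \<bullet> h"
      by (simp only: inner_add_left[symmetric] pq inner_diff_left[symmetric])
    moreover have "\<delta> * (norm (\<xi> + h - a))\<^sup>2 = \<delta> * (norm (\<xi> - a))\<^sup>2 + ((2 * \<delta>) *\<^sub>R (\<xi> - a)) \<bullet> h + \<delta> * (norm h)\<^sup>2"
      by (simp add: power2_norm_eq_inner inner_add_left inner_add_right inner_diff_left inner_diff_right inner_commute algebra_simps)
    moreover have "0 \<le> \<delta> * (norm h)\<^sup>2" using \<open>0 < \<delta>\<close> by simp
    ultimately show ?thesis unfolding f_def by linarith
  qed
  let ?A = "tilt_set f r"
  have inA: "norm (\<xi> - a) \<le> R' \<and> m < f \<xi>" if \<xi>A: "\<xi> \<in> ?A" for \<xi>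
  proof -
    obtain s where s: "norm s \<le> r" "\<And>h. f (\<xi> + h) \<le> f \<xi> + s \<bullet> h" using \<xi>A unfolding tilt_set_def by blast
    have "f a \<le> f \<xi> + s \<bullet> (a - \<xi>)" using s(2)[of "a - \<xi>"] by simp
    moreover have "s \<bullet> (a - \<xi>) \<le> norm s * norm (a - \<xi>)" by (rule norm_cauchy_schwarz)
    moreover have "norm s * norm (a - \<xi>) \<le> r * norm (\<xi> - a)"
      using s(1) by (simp add: norm_minus_commute mult_right_mono)
    ultimately have fa: "f a \<le> f \<xi> + r * norm (\<xi> - a)" by linarith
    then have n: "norm (\<xi> - a) \<le> R'" using far'[of \<xi>] by linarith
    then have "r * norm (\<xi> - a) \<le> r * R'" using r by (intro mult_left_mono) auto
    with fa r(3) n show ?thesis by linarith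
  qed
  have "bounded ?A"
    by (rule bounded_subset[OF bounded_cball[of a R']]) (use inA in \<open>auto simp: dist_norm norm_minus_commute\<close>)
  then have "compact ?A" using closed_tilt_set[OF cf] by (simp add: compact_eq_bounded_closed)
  moreover have "\<not> negligible ?A"
    by (rule tilt_set_not_negligible[OF cf r(1) lo far']) (use R' in auto)
  moreover have "?A \<subseteq> {x. m < f x}" using inA by blast
  moreover have "open {x. m < f x}" by (intro open_Collect_less continuous_intros cf)
  moreover have "\<exists>p q. contact \<kappa> \<delta> u z \<xi> p q" if "\<xi> \<in> ?A" for \<xi>
    using that tilt_contact unfolding tilt_set_def by blast
  moreover have "closed F" using F by (simp add: cone_subequation_def)
  ultimately have "\<exists>u z. sub_pair \<kappa> \<delta> F (dual_subeq F) u z"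
    using \<open>0 < \<delta>\<close> \<open>0 \<le> \<kappa>\<close> scu scz ju jz
    by (intro sub_pair_of_blowup[of \<kappa> \<delta> F "dual_subeq F" u z ?A "{x. m < f x}"] closed_dual_subeq) auto
  with no_sub_pair[OF F \<open>0 \<le> \<kappa>\<close> \<open>0 < \<delta>\<close>] show False by blast
qed

subsection \<open>Sup-convolutions and the comparison principle\<close>

text \<open>The counterpart of \<open>sjet\<close> for extended values: finite at the point itself,
  possibly \<open>-\<infinity>\<close> nearby.\<close>

definition ejet :: "(real^'n \<Rightarrow> ereal) \<Rightarrow> real^'n \<Rightarrow> (real^'n^'n) set" where
  "ejet v x = {A. transpose A = A \<and> (\<exists>c p. \<exists>\<epsilon>>0. v x = ereal c \<and>
     (\<forall>h. norm h < \<epsilon> \<longrightarrow> v (x + h) \<le> ereal (c + p \<bullet> h + (h \<bullet> (A *v h)) / 2)))}"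

lemma subharmonic_on_ejet:
  assumes v: "subharmonic_on G X v" and "x \<in> X"
  shows "ejet v x \<subseteq> G"
proof
  fix A assume "A \<in> ejet v x"
  then obtain c p \<epsilon> where A: "transpose A = A" and "\<epsilon> > 0" and vx: "v x = ereal c"
    and le: "\<And>h. norm h < \<epsilon> \<Longrightarrow> v (x + h) \<le> ereal (c + p \<bullet> h + (h \<bullet> (A *v h)) / 2)"
    unfolding ejet_def by blast
  define \<phi> where "\<phi> y = c + p \<bullet> (y - x) + ((y - x) \<bullet> (A *v (y - x))) / 2" for y
  define g where "g y = p + A *v (y - x)" for y
  have lin: "bounded_linear ((*v) A)" by (rule matrix_vector_mul_bounded_linear)
  have dA: "((\<lambda>y. A *v (y - x)) has_derivative (\<lambda>h. A *v h)) (at y)" for y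
    by (auto intro!: bounded_linear.has_derivative[OF lin] derivative_eq_intros)
  have "(\<phi> has_derivative (\<lambda>h. g y \<bullet> h)) (at y)" for y
  proof -
    have "(\<phi> has_derivative (\<lambda>h. p \<bullet> h + ((y - x) \<bullet> (A *v h) + h \<bullet> (A *v (y - x))) / 2)) (at y)"
      unfolding \<phi>_def by (auto intro!: derivative_eq_intros dA)
    moreover have "p \<bullet> h + ((y - x) \<bullet> (A *v h) + h \<bullet> (A *v (y - x))) / 2 = g y \<bullet> h" for h
      using symmetric_inner_matrix[OF A, of "y - x" h]
      by (simp add: g_def inner_add_left inner_commute[of "A *v (y - x)"])
    ultimately show ?thesis by simp
  qed
  moreover have "(g has_derivative (\<lambda>h. A *v h)) (at y)" for y
    unfolding g_def by (auto intro!: derivative_eq_intros dA)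
  ultimately have "C2_on_with \<phi> (ball x \<epsilon>) g (\<lambda>_. A)"
    by (simp add: C2_on_with_def)
  moreover have "v y \<le> ereal (\<phi> y)" if "y \<in> ball x \<epsilon>" for y
    using le[of "y - x"] that by (simp add: \<phi>_def dist_norm norm_minus_commute)
  moreover have "v x = ereal (\<phi> x)" by (simp add: vx \<phi>_def)
  ultimately show "A \<in> G"
    using v \<open>x \<in> X\<close> \<open>\<epsilon> > 0\<close> unfolding subharmonic_on_def by (metis IntD1 centre_in_ball)
qed

lemma usc_on_add_continuous:
  assumes v: "usc_on K v" and g: "continuous_on K g"
  shows "usc_on K (\<lambda>x. v x + ereal (g x))"
  unfolding usc_on_def
proof (intro conjI ballI allI impI)
  fix x assume x: "x \<in> K"
  then show "v x + ereal (g x) \<noteq> \<infinity>" using v by (simp add: usc_on_def)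
  fix c assume c: "v x + ereal (g x) < c"
  show "\<forall>\<^sub>F y in at x within K. v y + ereal (g y) < c"
  proof (cases c)
    case (real C)
    then have "v x < ereal (C - g x)" using c by (cases "v x") auto
    then obtain s where s: "v x < ereal s" "ereal s < ereal (C - g x)" using ereal_dense2 by blast
    have "\<forall>\<^sub>F y in at x within K. v y < ereal s" using v x s(1) by (simp add: usc_on_def)
    moreover have "\<forall>\<^sub>F y in at x within K. g y < C - s"
      using g x s(2) by (intro order_tendstoD(2)[of g "g x"]) (auto simp: continuous_on_def)
    ultimately show ?thesis
    proof eventually_elim
      case (elim y)
      then show ?case using real by (cases "v y") auto
    qed
  next
    case PInf
    have "\<forall>\<^sub>F y in at x within K. y \<in> K" by (simp add: eventually_at_filter)
    then show ?thesis by eventually_elim (use v PInf in \<open>auto simp: usc_on_def\<close>)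
  qed (use c in auto)
qed

lemma usc_on_subset: "usc_on X v \<Longrightarrow> Y \<subseteq> X \<Longrightarrow> usc_on Y v"
  unfolding usc_on_def by (meson at_le filter_leD subsetD)

lemma usc_on_compact_bounded:
  assumes "compact K" "usc_on K v"
  obtains B where "\<And>x. x \<in> K \<Longrightarrow> v x \<le> ereal B"
proof (cases "K = {}")
  case False
  obtain x where x: "x \<in> K" "\<And>y. y \<in> K \<Longrightarrow> v y \<le> v x" 
    by (rule usc_on_attains_max[OF assms(1) False assms(2)], rule that)
  have "v x \<noteq> \<infinity>" using assms(2) x(1) by (simp add: usc_on_def)
  then have "v x \<le> ereal (real_of_ereal (v x))" by (cases "v x") auto
  then show ?thesis using that x(2) by (meson order_trans)
qed (use that in auto)

text \<open>Here \<open>u \<xi>\<close> is the sup-convolution, the maximum over \<open>x\<close> in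
  \<open>K\<close> of \<open>v x - \<kappa> * (norm (x - \<xi>))\<^sup>2\<close>, and
  \<open>X \<xi>\<close> a maximiser. The finite value at \<open>a\<close> keeps the maximum
  finite.\<close>

lemma sup_convolution_exists:
  fixes v :: "real^'n \<Rightarrow> ereal"
  assumes K: "compact K" and v: "usc_on K v" and a: "a \<in> K" "v a \<noteq> - \<infinity>"
  obtains u X where "\<And>\<xi>. X \<xi> \<in> K" "\<And>\<xi>. v (X \<xi>) = ereal (u \<xi> + \<kappa> * (norm (X \<xi> - \<xi>))\<^sup>2)"
    "\<And>\<xi> x. x \<in> K \<Longrightarrow> v x \<le> ereal (u \<xi> + \<kappa> * (norm (x - \<xi>))\<^sup>2)"
proof -
  have "\<exists>x\<in>K. \<forall>y\<in>K. v y + ereal (- \<kappa> * (norm (y - \<xi>))\<^sup>2) \<le> v x + ereal (- \<kappa> * (norm (x - \<xi>))\<^sup>2)" for \<xi>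
  proof -
    have us: "usc_on K (\<lambda>x. v x + ereal (- \<kappa> * (norm (x - \<xi>))\<^sup>2))"
      by (intro usc_on_add_continuous v continuous_intros)
    have "K \<noteq> {}" using a by blast
    obtain x where "x \<in> K"
      "\<And>y. y \<in> K \<Longrightarrow> v y + ereal (- \<kappa> * (norm (y - \<xi>))\<^sup>2) \<le> v x + ereal (- \<kappa> * (norm (x - \<xi>))\<^sup>2)"
      by (rule usc_on_attains_max[OF K \<open>K \<noteq> {}\<close> us], rule that)
    then show ?thesis by (intro bexI[of _ x] ballI)
  qed
  then obtain X where X: "\<And>\<xi>. X \<xi> \<in> K" 
    and max: "\<And>\<xi> y. y \<in> K \<Longrightarrow> v y + ereal (- \<kappa> * (norm (y - \<xi>))\<^sup>2) \<le> v (X \<xi>) + ereal (- \<kappa> * (norm (X \<xi> - \<xi>))\<^sup>2)"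
    by metis
  define u where "u \<xi> = real_of_ereal (v (X \<xi>)) - \<kappa> * (norm (X \<xi> - \<xi>))\<^sup>2" for \<xi>
  have vX: "v (X \<xi>) = ereal (u \<xi> + \<kappa> * (norm (X \<xi> - \<xi>))\<^sup>2)" for \<xi>
  proof -
    have "v (X \<xi>) \<noteq> \<infinity>" using v X by (simp add: usc_on_def)
    moreover have "v (X \<xi>) \<noteq> - \<infinity>" using max[OF a(1), of \<xi>] a(2) by (cases "v a") auto
    ultimately show ?thesis by (cases "v (X \<xi>)") (auto simp: u_def)
  qed
  have "v x \<le> ereal (u \<xi> + \<kappa> * (norm (x - \<xi>))\<^sup>2)" if "x \<in> K" for \<xi> x
    using max[OF that, of \<xi>] unfolding vX by (cases "v x") auto
  with X vX show ?thesis by (rule that)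
qed

section \<open>Semiconvexity, continuity and superjets of sup-convolutions\<close>

context
  fixes v :: "real^'n \<Rightarrow> ereal" and u :: "real^'n \<Rightarrow> real" and X :: "real^'n \<Rightarrow> real^'n" and K \<kappa>
  assumes X: "\<And>\<xi>. X \<xi> \<in> K" and vX: "\<And>\<xi>. v (X \<xi>) = ereal (u \<xi> + \<kappa> * (norm (X \<xi> - \<xi>))\<^sup>2)"
    and le_u: "\<And>\<xi> x. x \<in> K \<Longrightarrow> v x \<le> ereal (u \<xi> + \<kappa> * (norm (x - \<xi>))\<^sup>2)"
begin

text \<open>The maximiser for \<xi> competes at \<open>\<xi> + h\<close>; expanding the square
  produces the slope.\<close>

lemma sup_convolution_subgradient:
  "u \<xi> + ((2 * \<kappa>) *\<^sub>R (X \<xi> - \<xi>)) \<bullet> h - \<kappa> * (norm h)\<^sup>2 \<le> u (\<xi> + h)"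
proof -
  have "u \<xi> + \<kappa> * (norm (X \<xi> - \<xi>))\<^sup>2 \<le> u (\<xi> + h) + \<kappa> * (norm (X \<xi> - (\<xi> + h)))\<^sup>2"
    using le_u[OF X, of \<xi> "\<xi> + h"] vX[of \<xi>] by simp
  moreover have "\<kappa> * (norm (X \<xi> - (\<xi> + h)))\<^sup>2 = \<kappa> * (norm (X \<xi> - \<xi>))\<^sup>2 - ((2 * \<kappa>) *\<^sub>R (X \<xi> - \<xi>)) \<bullet> h + \<kappa> * (norm h)\<^sup>2"
    by (simp add: power2_norm_eq_inner inner_add_left inner_add_right inner_diff_left inner_diff_right inner_commute algebra_simps)
  ultimately show ?thesis by linarith
qed

lemma sup_convolution_semiconvex: "semiconvex \<kappa> u"
  unfolding semiconvex_def using sup_convolution_subgradient by blast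

lemma sup_convolution_continuous:
  assumes "bounded K" "0 \<le> \<kappa>"
  shows "continuous_on UNIV u"
proof -
  obtain B where B: "\<And>x. x \<in> K \<Longrightarrow> norm x \<le> B" using \<open>bounded K\<close> unfolding bounded_iff by blast
  have "isCont u \<xi>" for \<xi>
  proof -
    have low: "u \<eta> - u (\<eta> + k) \<le> 2 * \<kappa> * (B + norm \<eta>) * norm k + \<kappa> * (norm k)\<^sup>2" for \<eta> k
    proof -
      have "- (((2 * \<kappa>) *\<^sub>R (X \<eta> - \<eta>)) \<bullet> k) \<le> norm ((2 * \<kappa>) *\<^sub>R (X \<eta> - \<eta>)) * norm k"
        using Cauchy_Schwarz_ineq2[of "(2 * \<kappa>) *\<^sub>R (X \<eta> - \<eta>)" k] by linarith
      also have "\<dots> \<le> 2 * \<kappa> * (B + norm \<eta>) * norm k"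
      proof (rule mult_right_mono)
        have "norm (X \<eta> - \<eta>) \<le> B + norm \<eta>" using norm_triangle_ineq4[of "X \<eta>" \<eta>] B[OF X, of \<eta>] by linarith
        then show "norm ((2 * \<kappa>) *\<^sub>R (X \<eta> - \<eta>)) \<le> 2 * \<kappa> * (B + norm \<eta>)" using \<open>0 \<le> \<kappa>\<close> by (simp add: mult_left_mono)
      qed simp
      finally show ?thesis using sup_convolution_subgradient[of \<eta> k] by linarith
    qed
    have "norm (u (\<xi> + h) - u \<xi>) \<le> 2 * \<kappa> * (B + norm \<xi> + norm h) * norm h + \<kappa> * (norm h)\<^sup>2" for h
    proof -
      have 1: "2 * \<kappa> * (B + norm \<xi>) * norm h \<le> 2 * \<kappa> * (B + norm \<xi> + norm h) * norm h"
        "2 * \<kappa> * (B + norm (\<xi> + h)) * norm h \<le> 2 * \<kappa> * (B + norm \<xi> + norm h) * norm h"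
        using \<open>0 \<le> \<kappa>\<close> norm_triangle_ineq[of \<xi> h] by (auto intro!: mult_right_mono mult_left_mono)
      show ?thesis using low[of \<xi> h] low[of "\<xi> + h" "- h"] 1 by (simp add: abs_le_iff)
    qed
    then have ev: "\<forall>\<^sub>F h in at 0. norm (u (\<xi> + h) - u \<xi>) \<le> 2 * \<kappa> * (B + norm \<xi> + norm h) * norm h + \<kappa> * (norm h)\<^sup>2"
      by (rule always_eventually[OF allI])
    have "((\<lambda>h :: real^'n. 2 * \<kappa> * (B + norm \<xi> + norm h) * norm h + \<kappa> * (norm h)\<^sup>2) \<longlongrightarrow>
          2 * \<kappa> * (B + norm \<xi> + norm (0 :: real^'n)) * norm (0 :: real^'n) + \<kappa> * (norm (0 :: real^'n))\<^sup>2) (at 0)"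
      by (intro tendsto_intros tendsto_norm[OF tendsto_ident_at])
    then have "((\<lambda>h :: real^'n. 2 * \<kappa> * (B + norm \<xi> + norm h) * norm h + \<kappa> * (norm h)\<^sup>2) \<longlongrightarrow> 0) (at 0)" by simp
    with ev have "((\<lambda>h. u (\<xi> + h) - u \<xi>) \<longlongrightarrow> 0) (at 0)" by (rule Lim_null_comparison)
    then show ?thesis unfolding isCont_iff by (simp add: Lim_null[symmetric])
  qed
  then show ?thesis by (simp add: continuous_at_imp_continuous_on)
qed

text \<open>Moving the competitor together with the base point keeps the penalty fixed, so a
  quadratic majorant of \<open>u\<close> at \<xi> becomes one of \<open>v\<close> at
  \<open>X \<xi>\<close> with the same matrix.\<close>

lemma sup_convolution_sjet:
  assumes "open V" "V \<subseteq> K" "X \<xi> \<in> V"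
  shows "sjet u \<xi> \<subseteq> ejet v (X \<xi>)"
proof
  fix A assume "A \<in> sjet u \<xi>"
  then obtain p \<epsilon> where A: "transpose A = A" "\<epsilon> > 0"
    and le: "\<And>h. norm h < \<epsilon> \<Longrightarrow> u (\<xi> + h) \<le> u \<xi> + p \<bullet> h + (h \<bullet> (A *v h)) / 2"
    unfolding sjet_def by blast
  obtain d where d: "d > 0" "ball (X \<xi>) d \<subseteq> V" using assms(1,3) open_contains_ball by blast
  have "v (X \<xi> + h) \<le> ereal (u \<xi> + \<kappa> * (norm (X \<xi> - \<xi>))\<^sup>2 + p \<bullet> h + (h \<bullet> (A *v h)) / 2)"
    if h: "norm h < min \<epsilon> d" for h
  proof -
    have "X \<xi> + h \<in> ball (X \<xi>) d" using h by (simp add: dist_norm)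
    then have "X \<xi> + h \<in> K" using d(2) assms(2) by blast
    from le_u[OF this, of "\<xi> + h"] have "v (X \<xi> + h) \<le> ereal (u (\<xi> + h) + \<kappa> * (norm (X \<xi> - \<xi>))\<^sup>2)" by simp
    also have "\<dots> \<le> ereal (u \<xi> + \<kappa> * (norm (X \<xi> - \<xi>))\<^sup>2 + p \<bullet> h + (h \<bullet> (A *v h)) / 2)"
      using le[of h] h by simp
    finally show ?thesis .
  qed
  moreover have "min \<epsilon> d > 0" using A(2) d(1) by simp
  ultimately show "A \<in> ejet v (X \<xi>)" unfolding ejet_def using A(1) vX[of \<xi>] by blast
qed

end

lemma usc_on_eventually_less:
  assumes "usc_on K v" "x \<in> K" "v x < c" and lim: "(s \<longlongrightarrow> x) H" and K: "\<And>n. s n \<in> K"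
  shows "\<forall>\<^sub>F n in H. v (s n) < c"
proof -
  obtain T where T: "open T" "{x\<in>K. v x < c} = K \<inter> T"
    using usc_on_openin[OF assms(1), of c] by (auto simp: openin_open)
  have "x \<in> T" using T(2) assms(2,3) by blast
  then have "\<forall>\<^sub>F n in H. s n \<in> T" by (rule topological_tendstoD[OF lim T(1)])
  then show ?thesis by eventually_elim (use T(2) K in blast)
qed

text \<open>Semicontinuity of the two summands is used along different sequences of points, so the
  strict inequality has to be distributed between them, also when a summand is
  \<open>-\<infinity>\<close>.\<close>

lemma ereal_add_less_split:
  fixes v w :: ereal
  assumes "v \<noteq> \<infinity>" "w \<noteq> \<infinity>" "v + w < ereal M"
  obtains \<alpha> \<beta> where "v < ereal \<alpha>" "w < ereal \<beta>" "\<alpha> + \<beta> < M"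
proof (cases v)
  case (real r)
  show ?thesis
  proof (cases w)
    case (real s)
    have "r + s < M" using assms(3) \<open>v = ereal r\<close> real by simp
    then show ?thesis using that[of "r + (M - (r + s)) / 3" "s + (M - (r + s)) / 3"] real \<open>v = ereal r\<close> by (simp add: field_simps)
  next
    case MInf
    then show ?thesis using that[of "r + 1" "M - r - 2"] real by simp
  qed (use assms in auto)
next
  case MInf
  show ?thesis
  proof (cases w)
    case (real s)
    then show ?thesis using that[of "M - s - 2" "s + 1"] MInf by simp
  next
    case 2: MInf
    then show ?thesis using that[of "M - 1" 0] MInf by simp
  qed (use assms in auto)
qed (use assms in auto)

lemma comparison_principle:
  fixes F :: "(real^'n^'n) set" and v w :: "real^'n \<Rightarrow> ereal"
  assumes F: "cone_subequation F" and K: "compact K" and V: "open V" "V \<subseteq> K"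
    and v: "usc_on K v" and w: "usc_on K w"
    and jv: "\<And>x. x \<in> V \<Longrightarrow> ejet v x \<subseteq> F" and jw: "\<And>x. x \<in> V \<Longrightarrow> ejet w x \<subseteq> dual_subeq F"
    and bdry: "\<And>x. x \<in> K - V \<Longrightarrow> v x + w x \<le> ereal c" and a: "a \<in> K"
  shows "v a + w a \<le> ereal c"
proof (rule ccontr)
  assume "\<not> ?thesis"
  then have gt: "ereal c < v a + w a" by simp
  have fin: "v x \<noteq> \<infinity>" "w x \<noteq> \<infinity>" if "x \<in> K" for x using v w that by (auto simp: usc_on_def)
  obtain va wa where va: "v a = ereal va" and wa: "w a = ereal wa"
    using gt fin[OF a] by (cases "v a"; cases "w a") auto
  define M where "M = va + wa"
  have M: "c < M" using gt by (simp add: va wa M_def)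
  obtain D' where D': "\<And>x. x \<in> K \<Longrightarrow> dist a x \<le> D'" using compact_imp_bounded[OF K] bounded_any_center by metis
  define D where "D = max D' 1"
  have D: "D \<ge> 1" "\<And>x. x \<in> K \<Longrightarrow> norm (x - a) \<le> D"
    using D' by (fastforce simp: D_def dist_norm norm_minus_commute)+
  \<comment> \<open>On \<open>K\<close> the quadratic term amounts to at most a quarter of the gap
    \<open>M - c\<close>. The level \<open>m\<close> halfway between \<open>c\<close> and
    \<open>M\<close> therefore stays strictly above its contribution at the boundary.\<close>
  define \<delta> where "\<delta> = (M - c) / (4 * D\<^sup>2)"
  have \<delta>: "\<delta> > 0" using M D(1) by (simp add: \<delta>_def)
  have \<delta>D: "\<delta> * D\<^sup>2 = (M - c) / 4" using D(1) by (simp add: \<delta>_def)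
  define m where "m = (c + M) / 2"
  have m: "c + \<delta> * D\<^sup>2 < m" "m < M" using M by (simp_all add: \<delta>D m_def field_simps)
  obtain B1 where B1: "\<And>x. x \<in> K \<Longrightarrow> v x \<le> ereal B1" using usc_on_compact_bounded[OF K v] by blast
  obtain B2 where B2: "\<And>x. x \<in> K \<Longrightarrow> w x \<le> ereal B2" using usc_on_compact_bounded[OF K w] by blast
  \<comment> \<open>The summand \<open>2 * \<delta>\<close> absorbs the growth of
    \<open>\<delta> * (norm (\<xi> - a))\<^sup>2\<close> away from \<open>K\<close>, both in
    \<open>sq\<close> and in \<open>far\<close>; the summand 1 leaves \<open>t\<^sup>2 / 2\<close>
    to beat the linear term in \<open>far\<close>.\<close>
  define \<kappa> where "\<kappa> n = real n + 1 + 2 * \<delta>" for n :: nat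
  have \<kappa>: "\<kappa> n \<ge> 0" for n using \<delta> by (simp add: \<kappa>_def)
  have "\<exists>u X. (\<forall>\<xi>. X \<xi> \<in> K) \<and> (\<forall>\<xi>. v (X \<xi>) = ereal (u \<xi> + \<kappa> n * (norm (X \<xi> - \<xi>))\<^sup>2)) \<and>
      (\<forall>\<xi> x. x \<in> K \<longrightarrow> v x \<le> ereal (u \<xi> + \<kappa> n * (norm (x - \<xi>))\<^sup>2))" for n
    by (rule sup_convolution_exists[OF K v a, of "\<kappa> n"]) (use va in auto)
  then obtain u X where X: "\<And>n \<xi>. X n \<xi> \<in> K" and vX: "\<And>n \<xi>. v (X n \<xi>) = ereal (u n \<xi> + \<kappa> n * (norm (X n \<xi> - \<xi>))\<^sup>2)"
    and le_u: "\<And>n \<xi> x. x \<in> K \<Longrightarrow> v x \<le> ereal (u n \<xi> + \<kappa> n * (norm (x - \<xi>))\<^sup>2)" by metis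
  have "\<exists>u X. (\<forall>\<xi>. X \<xi> \<in> K) \<and> (\<forall>\<xi>. w (X \<xi>) = ereal (u \<xi> + \<kappa> n * (norm (X \<xi> - \<xi>))\<^sup>2)) \<and>
      (\<forall>\<xi> x. x \<in> K \<longrightarrow> w x \<le> ereal (u \<xi> + \<kappa> n * (norm (x - \<xi>))\<^sup>2))" for n
    by (rule sup_convolution_exists[OF K w a, of "\<kappa> n"]) (use wa in auto)
  then obtain z Y where Y: "\<And>n \<xi>. Y n \<xi> \<in> K" and wY: "\<And>n \<xi>. w (Y n \<xi>) = ereal (z n \<xi> + \<kappa> n * (norm (Y n \<xi> - \<xi>))\<^sup>2)"
    and le_z: "\<And>n \<xi> x. x \<in> K \<Longrightarrow> w x \<le> ereal (z n \<xi> + \<kappa> n * (norm (x - \<xi>))\<^sup>2)" by metis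
  define f where "f n \<xi> = u n \<xi> + z n \<xi> + \<delta> * (norm (\<xi> - a))\<^sup>2" for n \<xi>
  have uB: "u n \<xi> + \<kappa> n * (norm (X n \<xi> - \<xi>))\<^sup>2 \<le> B1" and zB: "z n \<xi> + \<kappa> n * (norm (Y n \<xi> - \<xi>))\<^sup>2 \<le> B2" for n \<xi>
    using B1[OF X[of n \<xi>]] B2[OF Y[of n \<xi>]] by (simp_all add: vX wY)
  have fa: "M \<le> f n a" for n
    using le_u[OF a, of n a] le_z[OF a, of n a] by (simp add: va wa f_def M_def)
  \<comment> \<open>Superjets can be transferred only from maximisers inside \<open>V\<close>.
    Otherwise, by \<open>sq\<close>, the points \<open>\<xi> n\<close> and both maximisers merge
    along a filter. Their limit cannot be in \<open>V\<close>, which is open, nor outside, where the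
    boundary bound lies below the level \<open>m\<close>.\<close>
  have "\<exists>n. \<forall>\<xi>. m < f n \<xi> \<longrightarrow> X n \<xi> \<in> V \<and> Y n \<xi> \<in> V"
  proof (rule ccontr)
    assume "\<not> ?thesis"
    then obtain \<xi> where \<xi>: "\<And>n. m < f n (\<xi> n)" "\<And>n. \<not> (X n (\<xi> n) \<in> V \<and> Y n (\<xi> n) \<in> V)" by metis
    define x where "x n = X n (\<xi> n)" for n
    define y where "y n = Y n (\<xi> n)" for n
    have xK: "x n \<in> K" and yK: "y n \<in> K" for n by (simp_all add: x_def y_def X Y)
    define E where "E = B1 + B2 - m + 2 * (\<delta> * D\<^sup>2)"
    have sq: "real (Suc n) * ((norm (x n - \<xi> n))\<^sup>2 + (norm (y n - \<xi> n))\<^sup>2) \<le> E" for n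
    proof -
      have "(norm (\<xi> n - a))\<^sup>2 \<le> (norm (x n - \<xi> n) + D)\<^sup>2"
      proof (rule power_mono)
        show "norm (\<xi> n - a) \<le> norm (x n - \<xi> n) + D"
          using norm_triangle_ineq[of "\<xi> n - x n" "x n - a"] D(2)[OF xK, of n] by (simp add: norm_minus_commute)
      qed simp
      also have "\<dots> \<le> 2 * (norm (x n - \<xi> n))\<^sup>2 + 2 * D\<^sup>2"
        using sum_squares_ge_zero[of 0 "norm (x n - \<xi> n) - D"] by (simp add: power2_eq_square algebra_simps)
      finally have "\<delta> * (norm (\<xi> n - a))\<^sup>2 \<le> \<delta> * (2 * (norm (x n - \<xi> n))\<^sup>2 + 2 * D\<^sup>2)" using \<delta> by (intro mult_left_mono) auto
      moreover have "0 \<le> 2 * \<delta> * (norm (y n - \<xi> n))\<^sup>2" using \<delta> by simp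
      ultimately show ?thesis
        using \<xi>(1)[of n] uB[of n "\<xi> n"] zB[of n "\<xi> n"]
        by (simp add: f_def E_def \<kappa>_def x_def y_def algebra_simps)
    qed
    have small: "((\<lambda>n. s n - \<xi> n) \<longlongrightarrow> 0) sequentially" 
      if s: "\<And>n. (norm (s n - \<xi> n))\<^sup>2 \<le> (norm (x n - \<xi> n))\<^sup>2 + (norm (y n - \<xi> n))\<^sup>2" for s
    proof -
      have "(norm (s n - \<xi> n))\<^sup>2 \<le> E * inverse (real (Suc n))" for n
      proof -
        have "real (Suc n) * (norm (s n - \<xi> n))\<^sup>2 \<le> E"
          using mult_left_mono[OF s[of n], of "real (Suc n)"] sq[of n] by linarith
        then show ?thesis by (simp add: field_simps)
      qed
      moreover have "((\<lambda>n. E * inverse (real (Suc n))) \<longlongrightarrow> 0) sequentially"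
        using tendsto_mult_right_zero[OF LIMSEQ_inverse_real_of_nat] by simp
      ultimately have "((\<lambda>n. (norm (s n - \<xi> n))\<^sup>2) \<longlongrightarrow> 0) sequentially"
        by (intro Lim_null_comparison[of "\<lambda>n. (norm (s n - \<xi> n))\<^sup>2"]) (auto intro!: always_eventually)
      then have "((\<lambda>n. sqrt ((norm (s n - \<xi> n))\<^sup>2)) \<longlongrightarrow> sqrt 0) sequentially" by (rule tendsto_real_sqrt)
      then show ?thesis by (simp add: tendsto_norm_zero_iff)
    qed
    have x0: "((\<lambda>n. x n - \<xi> n) \<longlongrightarrow> 0) sequentially" and y0: "((\<lambda>n. y n - \<xi> n) \<longlongrightarrow> 0) sequentially"
      by (intro small; simp)+
    obtain H l where H: "H \<le> sequentially" "H \<noteq> bot" "l \<in> K" and xl: "(x \<longlongrightarrow> l) H"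
      using compact_cluster_filter[OF K sequentially_bot, of x] xK by (metis always_eventually)
    have \<xi>l: "(\<xi> \<longlongrightarrow> l) H" using tendsto_diff[OF xl tendsto_mono[OF H(1) x0]] by simp
    have yl: "(y \<longlongrightarrow> l) H" using tendsto_add[OF tendsto_mono[OF H(1) y0] \<xi>l] by simp
    have "l \<in> V"
    proof (rule ccontr)
      assume "l \<notin> V"
      then have "v l + w l \<le> ereal c" using bdry H(3) by blast
      also have "ereal c < ereal (m - \<delta> * (norm (l - a))\<^sup>2)"
      proof -
        have "\<delta> * (norm (l - a))\<^sup>2 \<le> \<delta> * D\<^sup>2" using D(2)[OF H(3)] \<delta> by (intro mult_left_mono power_mono) auto
        then show ?thesis using m(1) by simp
      qed
      finally obtain \<alpha> \<beta> where ab: "v l < ereal \<alpha>" "w l < ereal \<beta>" "\<alpha> + \<beta> < m - \<delta> * (norm (l - a))\<^sup>2"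
        using ereal_add_less_split fin[OF H(3)] by metis
      have "\<forall>\<^sub>F n in H. v (x n) < ereal \<alpha>" "\<forall>\<^sub>F n in H. w (y n) < ereal \<beta>"
        using usc_on_eventually_less[OF v H(3) ab(1) xl xK] usc_on_eventually_less[OF w H(3) ab(2) yl yK] by auto
      then have ev: "\<forall>\<^sub>F n in H. m \<le> \<alpha> + \<beta> + \<delta> * (norm (\<xi> n - a))\<^sup>2"
      proof eventually_elim
        case (elim n)
        have "0 \<le> \<kappa> n * (norm (x n - \<xi> n))\<^sup>2" "0 \<le> \<kappa> n * (norm (y n - \<xi> n))\<^sup>2" using \<kappa> by simp_all
        with elim \<xi>(1)[of n] show ?case by (simp add: x_def y_def vX wY f_def)
      qed
      have "((\<lambda>n. \<alpha> + \<beta> + \<delta> * (norm (\<xi> n - a))\<^sup>2) \<longlongrightarrow> \<alpha> + \<beta> + \<delta> * (norm (l - a))\<^sup>2) H"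
        by (intro tendsto_intros \<xi>l)
      from tendsto_lowerbound[OF this ev H(2)] ab(3) show False by simp
    qed
    then have "\<forall>\<^sub>F n in H. x n \<in> V" "\<forall>\<^sub>F n in H. y n \<in> V"
      using topological_tendstoD[OF xl V(1)] topological_tendstoD[OF yl V(1)] by auto
    then have "\<forall>\<^sub>F n in H. False" by eventually_elim (use \<xi>(2) in \<open>auto simp: x_def y_def\<close>)
    with H(2) show False by (simp add: eventually_False)
  qed
  then obtain n where n: "\<And>\<xi>. m < f n \<xi> \<Longrightarrow> X n \<xi> \<in> V" "\<And>\<xi>. m < f n \<xi> \<Longrightarrow> Y n \<xi> \<in> V" by blast
  \<comment> \<open>Beyond \<open>2 * D\<close> each point of \<open>K\<close> has distance at least
    \<open>t / 2\<close> from \<open>y\<close>; beyond 4 the quantity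
    \<open>t\<^sup>2 / 2 - t\<close> is at least \<open>t\<close>, and \<open>t\<close> then
    outweighs \<open>\<bar>B1 + B2 - M\<bar>\<close>.\<close>
  define R where "R = max (2 * D) (4 + \<bar>B1 + B2 - M\<bar>)"
  have far: "f n y + norm (y - a) < f n a" if y: "R < norm (y - a)" for y
  proof -
    define t where "t = norm (y - a)"
    have t: "t > 2 * D" "t > 4" "t > \<bar>B1 + B2 - M\<bar>" using y by (auto simp: R_def t_def)
    have q: "\<kappa> n * (t\<^sup>2 / 4) \<le> \<kappa> n * (norm (x - y))\<^sup>2" if "x \<in> K" for x
    proof (rule mult_left_mono)
      have "t / 2 \<le> norm (x - y)"
        using norm_triangle_ineq[of "y - x" "x - a"] D(2)[OF that] t(1) by (simp add: t_def norm_minus_commute)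
      then have "(t / 2)\<^sup>2 \<le> (norm (x - y))\<^sup>2" using t by (intro power_mono) auto
      then show "t\<^sup>2 / 4 \<le> (norm (x - y))\<^sup>2" by (simp add: power_divide)
    qed (rule \<kappa>)
    have "f n y + norm (y - a) \<le> B1 + B2 - 2 * (\<kappa> n * (t\<^sup>2 / 4)) + \<delta> * t\<^sup>2 + t"
      using uB[of n y] zB[of n y] q[OF X, of n y] q[OF Y, of n y] by (simp add: f_def t_def)
    also have "\<dots> \<le> B1 + B2 - t\<^sup>2 / 2 + t"
    proof -
      have "2 * (\<kappa> n * (t\<^sup>2 / 4)) = real n * t\<^sup>2 / 2 + t\<^sup>2 / 2 + \<delta> * t\<^sup>2" by (simp add: \<kappa>_def field_simps)
      moreover have "0 \<le> real n * t\<^sup>2 / 2" by simp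
      ultimately show ?thesis by linarith
    qed
    also have "\<dots> < M"
    proof -
      have "4 * t \<le> t * t" using t by (intro mult_right_mono) auto
      then have "t \<le> t\<^sup>2 / 2 - t" by (simp add: power2_eq_square)
      then show ?thesis using t(3) by linarith
    qed
    finally show ?thesis using fa[of n] by linarith
  qed
  show False
  proof (rule semiconvex_comparison[OF F \<kappa>[of n] \<delta>])
    show "semiconvex (\<kappa> n) (u n)" by (rule sup_convolution_semiconvex[OF X vX le_u])
    show "semiconvex (\<kappa> n) (z n)" by (rule sup_convolution_semiconvex[OF Y wY le_z])
    show "continuous_on UNIV (u n)" by (rule sup_convolution_continuous[OF X vX le_u compact_imp_bounded[OF K] \<kappa>])
    show "continuous_on UNIV (z n)" by (rule sup_convolution_continuous[OF Y wY le_z compact_imp_bounded[OF K] \<kappa>])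
    show "m < u n a + z n a + \<delta> * (norm (a - a))\<^sup>2" using fa[of n] m(2) by (simp add: f_def)
    show "u n y + z n y + \<delta> * (norm (y - a))\<^sup>2 + norm (y - a) < u n a + z n a + \<delta> * (norm (a - a))\<^sup>2"
      if "R < norm (y - a)" for y using far[OF that] by (simp add: f_def)
    show "sjet (u n) x \<subseteq> F" if "m < u n x + z n x + \<delta> * (norm (x - a))\<^sup>2" for x
      using sup_convolution_sjet[OF X vX le_u V n(1)] jv[OF n(1)] that unfolding f_def by blast
    show "sjet (z n) x \<subseteq> dual_subeq F" if "m < u n x + z n x + \<delta> * (norm (x - a))\<^sup>2" for x
      using sup_convolution_sjet[OF Y wY le_z V n(2)] jw[OF n(2)] that unfolding f_def by blast
  qed
qed

subsection \<open>Isolated poles\<close>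

text \<open>The cone property enters here: the matrix divided by \<open>t\<close> is a superjet of
  \<open>v\<close>, and \<open>F\<close> is invariant under multiplication by
  \<open>t\<close>.\<close>

lemma ejet_scale:
  assumes F: "cone_subequation F" and "t > 0" and "ejet v x \<subseteq> F"
  shows "ejet (\<lambda>y. ereal t * v y) x \<subseteq> F"
proof
  fix A assume "A \<in> ejet (\<lambda>y. ereal t * v y) x"
  then obtain c p \<epsilon> where A: "transpose A = A" "\<epsilon> > 0" and c: "ereal t * v x = ereal c"
    and le: "\<And>h. norm h < \<epsilon> \<Longrightarrow> ereal t * v (x + h) \<le> ereal (c + p \<bullet> h + (h \<bullet> (A *v h)) / 2)"
    unfolding ejet_def by blast
  define B where "B = inverse t *\<^sub>R A"
  have "v x = ereal (c / t)" using c \<open>t > 0\<close> by (cases "v x") (auto simp: field_simps)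
  moreover have "v (x + h) \<le> ereal (c / t + (p /\<^sub>R t) \<bullet> h + (h \<bullet> (B *v h)) / 2)" if "norm h < \<epsilon>" for h
  proof -
    have "h \<bullet> (B *v h) = (h \<bullet> (A *v h)) / t"
      by (simp add: B_def scaleR_matrix_vector_assoc[symmetric] divide_inverse mult.commute)
    then have "t * (c / t + (p /\<^sub>R t) \<bullet> h + (h \<bullet> (B *v h)) / 2) = c + p \<bullet> h + (h \<bullet> (A *v h)) / 2"
      using \<open>t > 0\<close> by (simp add: field_simps)
    then have "ereal t * v (x + h) \<le> ereal (t * (c / t + (p /\<^sub>R t) \<bullet> h + (h \<bullet> (B *v h)) / 2))"
      using le[OF that] by simp
    then show ?thesis using \<open>t > 0\<close> by (cases "v (x + h)") auto
  qed
  moreover have "transpose B = B" using A(1) by (simp add: B_def transpose_def vec_eq_iff)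
  ultimately have "B \<in> ejet v x" unfolding ejet_def using A(2) by blast
  then have "B \<in> F" using assms(3) by blast
  then have "t *\<^sub>R B \<in> (\<lambda>A. t *\<^sub>R A) ` F" by blast
  also have "\<dots> = F" using F \<open>t > 0\<close> unfolding cone_subequation_def by blast
  finally show "A \<in> F" using \<open>t > 0\<close> by (simp add: B_def)
qed

lemma usc_on_scale:
  assumes v: "usc_on K v" and "t > 0"
  shows "usc_on K (\<lambda>x. ereal t * v x)"
  unfolding usc_on_def
proof (intro conjI ballI allI impI)
  fix x assume x: "x \<in> K"
  have fin: "ereal t * v y \<noteq> \<infinity>" if "y \<in> K" for y 
    using v that \<open>t > 0\<close> by (cases "v y") (auto simp: usc_on_def)
  show "ereal t * v x \<noteq> \<infinity>" by (rule fin[OF x])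
  fix c assume c: "ereal t * v x < c"
  show "\<forall>\<^sub>F y in at x within K. ereal t * v y < c"
  proof (cases c)
    case (real C)
    have iff: "ereal t * v y < c \<longleftrightarrow> v y < ereal (C / t)" for y
      using \<open>t > 0\<close> real by (cases "v y") (auto simp: field_simps)
    then show ?thesis using v x c by (simp add: usc_on_def)
  next
    case PInf
    have "\<forall>\<^sub>F y in at x within K. y \<in> K" by (simp add: eventually_at_filter)
    then show ?thesis by eventually_elim (use fin PInf in auto)
  qed (use c in auto)
qed

lemma polar_singular_harmonic_tendsto:
  assumes "polar_singular_harmonic F x0 h"
  shows "\<forall>\<^sub>F y in at x0. \<exists>r. h y = ereal r \<and> r < N"
proof -
  obtain U where U: "open U" "x0 \<in> U" "continuous_on U h" "subharmonic_on F U h" 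
    "h x0 = -\<infinity>" "\<And>x. x \<in> U - {x0} \<Longrightarrow> h x \<noteq> -\<infinity>"
    using assms unfolding polar_singular_harmonic_def by blast
  have "(h \<longlongrightarrow> h x0) (at x0 within U)" using U(2,3) unfolding continuous_on_def by blast
  then have "(h \<longlongrightarrow> -\<infinity>) (at x0)" using U(1,2,5) at_within_open by metis
  then have "\<forall>\<^sub>F y in at x0. h y < ereal N" by (rule order_tendstoD) simp
  moreover have "\<forall>\<^sub>F y in at x0. y \<in> U - {x0}"
    using eventually_at_in_open[OF U(1,2)] .
  ultimately show ?thesis
  proof eventually_elim
    case (elim y)
    then have "h y \<noteq> -\<infinity>" using U(6) by blast
    then show ?case using elim(1) by (cases "h y") auto
  qed
qed

text \<open>The singular functions are condensed into \<open>pole\<close>, the sign information that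
  remains of them for each \<epsilon>.\<close>

lemma punctured_comparison:
  fixes F :: "(real^'n^'n) set"
  assumes F: "cone_subequation F" and \<Omega>: "open \<Omega>" "bounded \<Omega>" and P: "finite P" "P \<subseteq> \<Omega>"
    and v: "usc_on (closure \<Omega> - P) v" and w: "usc_on (closure \<Omega> - P) w"
    and sv: "subharmonic_on F (\<Omega> - P) v" and sw: "subharmonic_on (dual_subeq F) (\<Omega> - P) w"
    and pole: "\<And>\<epsilon> p. \<lbrakk>\<epsilon> > 0; p \<in> P\<rbrakk> \<Longrightarrow> \<forall>\<^sub>F y in at p. v y \<le> 0 \<and> ereal (1 + \<epsilon>) * v y + w y \<le> 0"
    and bdry: "\<And>y. y \<in> frontier \<Omega> \<Longrightarrow> v y + w y \<le> 0"
    and y: "y \<in> \<Omega> - P"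
  shows "v y + w y \<le> 0"
proof -
  \<comment> \<open>Control up to twice the radius includes the spheres of radius
    \<open>\<rho> p\<close>, which become part of the boundary.\<close>
  have radii: "\<exists>\<rho>. \<forall>p\<in>P. \<rho> p > 0 \<and> (\<forall>y. y \<noteq> p \<and> dist y p < 2 * \<rho> p \<longrightarrow> v y \<le> 0 \<and> ereal (1 + \<epsilon>) * v y + w y \<le> 0)"
    if "\<epsilon> > 0" for \<epsilon>
  proof (intro bchoice ballI)
    fix p assume "p \<in> P"
    from pole[OF that this] obtain d where d: "d > 0" 
      "\<And>y. y \<noteq> p \<Longrightarrow> dist y p < d \<Longrightarrow> v y \<le> 0 \<and> ereal (1 + \<epsilon>) * v y + w y \<le> 0"
      unfolding eventually_at by auto
    then show "\<exists>\<rho>>0. \<forall>y. y \<noteq> p \<and> dist y p < 2 * \<rho> \<longrightarrow> v y \<le> 0 \<and> ereal (1 + \<epsilon>) * v y + w y \<le> 0"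
      by (intro exI[of _ "d / 2"]) auto
  qed
  define K where "K \<rho> = closure \<Omega> - (\<Union>p\<in>P. ball p (\<rho> p))" for \<rho> :: "real^'n \<Rightarrow> real"
  have cK: "compact (K \<rho>)" for \<rho>
    unfolding K_def using \<Omega>(2) by (intro compact_diff) (auto simp: compact_closure)
  have Ksub: "K \<rho> \<subseteq> closure \<Omega> - P" if "\<forall>p\<in>P. \<rho> p > 0" for \<rho>
    using that unfolding K_def by force
  \<comment> \<open>Near the poles \<open>v\<close> is nonpositive and the rest is compact. The
    bound \<open>C\<close> pays for the additional \<open>\<epsilon> * v\<close> on the frontier,
    and \<open>C \<ge> 0\<close> lets the bound 0 on the spheres be weakened to
    \<open>\<epsilon> * C\<close>.\<close>
  obtain C where C: "C \<ge> 0" "\<And>y. y \<in> closure \<Omega> - P \<Longrightarrow> v y \<le> ereal C"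
  proof -
    obtain \<rho> where \<rho>: "\<forall>p\<in>P. \<rho> p > 0 \<and> (\<forall>y. y \<noteq> p \<and> dist y p < 2 * \<rho> p \<longrightarrow> v y \<le> 0 \<and> ereal (1 + 1) * v y + w y \<le> 0)"
      using radii[of 1] by auto
    obtain B where B: "\<And>y. y \<in> K \<rho> \<Longrightarrow> v y \<le> ereal B"
      using usc_on_compact_bounded[OF cK usc_on_subset[OF v Ksub]] \<rho> by metis
    have "v y \<le> ereal (max B 0)" if yP: "y \<in> closure \<Omega> - P" for y
    proof (cases "y \<in> K \<rho>")
      case True
      then show ?thesis using B[of y] by (simp add: le_max_iff_disj)
    next
      case False
      then obtain p where "p \<in> P" "dist y p < \<rho> p" using yP by (auto simp: K_def dist_commute)
      moreover have "y \<noteq> p" using \<open>p \<in> P\<close> yP by blast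
      moreover have "dist y p < 2 * \<rho> p" using \<open>dist y p < \<rho> p\<close> zero_le_dist[of y p] by linarith
      ultimately have "v y \<le> 0" using \<rho> by blast
      then show ?thesis by (simp add: le_max_iff_disj zero_ereal_def)
    qed
    then show ?thesis using that[of "max B 0"] by simp
  qed
  have main: "ereal (1 + \<epsilon>) * v y + w y \<le> ereal (\<epsilon> * C)" if \<epsilon>: "\<epsilon> > 0" for \<epsilon>
  proof -
    obtain \<rho> where \<rho>: "\<And>p. p \<in> P \<Longrightarrow> \<rho> p > 0" 
      and near: "\<And>p y. \<lbrakk>p \<in> P; y \<noteq> p; dist y p < 2 * \<rho> p\<rbrakk> \<Longrightarrow> ereal (1 + \<epsilon>) * v y + w y \<le> 0"
      using radii[OF \<epsilon>] by blast
    have pos: "(0::ereal) \<le> ereal (\<epsilon> * C)" using \<epsilon> C(1) by (simp add: zero_ereal_def)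
    show ?thesis
    proof (cases "y \<in> K \<rho>")
      case False
      moreover have "y \<in> closure \<Omega>" using y closure_subset by blast
      ultimately obtain p where "p \<in> P" "dist y p < \<rho> p" by (auto simp: K_def dist_commute)
      moreover have "y \<noteq> p" using \<open>p \<in> P\<close> y by blast
      ultimately have "ereal (1 + \<epsilon>) * v y + w y \<le> 0" using near[of p y] \<rho>[of p] by simp
      then show ?thesis using pos by (rule order_trans)
    next
      case True
      \<comment> \<open>Closed balls are removed here and open ones in \<open>K \<rho>\<close>, so
        that one set is open and the other compact; the spheres lie in the difference.\<close>
      let ?V = "\<Omega> - (\<Union>p\<in>P. cball p (\<rho> p))"
      have VK: "?V \<subseteq> K \<rho>" unfolding K_def using closure_subset ball_subset_cball by fast
      have V\<Omega>: "?V \<subseteq> \<Omega> - P" using \<rho> by force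
      have K': "K \<rho> \<subseteq> closure \<Omega> - P" using Ksub \<rho> by blast
      show ?thesis
      proof (rule comparison_principle[OF F cK _ VK _ _ _ _ _ True])
        show "open ?V" using \<Omega>(1) P(1) by (intro open_Diff closed_UN) auto
        show "usc_on (K \<rho>) (\<lambda>y. ereal (1 + \<epsilon>) * v y)"
          using \<epsilon> by (intro usc_on_scale usc_on_subset[OF v K']) auto
        show "usc_on (K \<rho>) w" by (rule usc_on_subset[OF w K'])
      next
        fix x assume "x \<in> ?V"
        then have x: "x \<in> \<Omega> - P" using V\<Omega> by blast
        show "ejet (\<lambda>y. ereal (1 + \<epsilon>) * v y) x \<subseteq> F"
          using \<epsilon> by (intro ejet_scale[OF F] subharmonic_on_ejet[OF sv x]) auto
        show "ejet w x \<subseteq> dual_subeq F" by (rule subharmonic_on_ejet[OF sw x])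
      next
        fix x assume x: "x \<in> K \<rho> - ?V"
        show "ereal (1 + \<epsilon>) * v x + w x \<le> ereal (\<epsilon> * C)"
        proof (cases "x \<in> \<Omega>")
          case True
          then obtain p where p: "p \<in> P" "dist p x \<le> \<rho> p" using x by auto
          have "x \<noteq> p" using x K' p(1) by blast
          then have "ereal (1 + \<epsilon>) * v x + w x \<le> 0" using near[of p x] p \<rho>[of p] by (simp add: dist_commute)
          then show ?thesis using pos by (rule order_trans)
        next
          case False
          have xK: "x \<in> closure \<Omega> - P" using x K' by blast
          then have "v x + w x \<le> 0" using False \<Omega>(1) by (intro bdry) (simp add: frontier_def interior_open)
          moreover have "v x \<le> ereal C" by (rule C(2)[OF xK])
          moreover have "v x \<noteq> \<infinity>" "w x \<noteq> \<infinity>" using xK v w by (auto simp: usc_on_def)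
          ultimately show ?thesis
          proof (cases "v x"; cases "w x")
            fix r s assume rs: "v x = ereal r" "w x = ereal s"
            then have rsC: "r + s \<le> 0" "r \<le> C" using \<open>v x + w x \<le> 0\<close> \<open>v x \<le> ereal C\<close> by (simp_all add: zero_ereal_def)
            have "\<epsilon> * r \<le> \<epsilon> * C" using rsC \<epsilon> by (intro mult_left_mono) auto
            with rsC have "(1 + \<epsilon>) * r + s \<le> \<epsilon> * C" by (simp add: distrib_right)
            then show ?thesis by (simp add: rs)
          qed (use \<epsilon> in auto)
        qed
      qed
    qed
  qed
  have yc: "y \<in> closure \<Omega> - P" using y closure_subset by blast
  then have "v y \<noteq> \<infinity>" "w y \<noteq> \<infinity>" using v w by (auto simp: usc_on_def)
  then show ?thesis
  proof (cases "v y"; cases "w y")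
    fix r s assume rs: "v y = ereal r" "w y = ereal s"
    have "r \<le> C" using C(2)[OF yc] rs by simp
    have lim: "r + s \<le> \<epsilon> * (C - r)" if "\<epsilon> > 0" for \<epsilon> using main[OF that] by (simp add: rs algebra_simps)
    have "r + s \<le> 0"
    proof (rule ccontr)
      assume "\<not> r + s \<le> 0"
      \<comment> \<open>For this value of \<epsilon> the right-hand side of \<open>lim\<close> is
        smaller than \<open>r + s\<close>.\<close>
      then have "(r + s) / (C - r + 1) > 0" using \<open>r \<le> C\<close> by simp
      from lim[OF this] \<open>r \<le> C\<close> \<open>\<not> r + s \<le> 0\<close> show False by (simp add: field_simps)
    qed
    then show ?thesis by (simp add: rs zero_ereal_def)
  qed auto
qed

theorem theorem5p2:
  fixes F :: "(real^'n^'n) set" and \<Omega> :: "(real^'n) set"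
    and k :: nat and x :: "nat \<Rightarrow> real^'n" and h :: "nat \<Rightarrow> real^'n \<Rightarrow> ereal"
    and v w :: "real^'n \<Rightarrow> ereal"
  assumes "cone_subequation F"
    and "open \<Omega>" "connected \<Omega>" "bounded \<Omega>" "\<Omega> \<noteq> {}"
    and "\<forall>j<k. x j \<in> \<Omega>" "inj_on x {..<k}"
    and "\<forall>j<k. polar_singular_harmonic F (x j) (h j)"
    and "usc_on (closure \<Omega> - x ` {..<k}) v" "usc_on (closure \<Omega> - x ` {..<k}) w"
    and "subharmonic_on F (\<Omega> - x ` {..<k}) v"
    and "subharmonic_on (dual_subeq F) (\<Omega> - x ` {..<k}) w"
    and "\<forall>j<k. \<exists>c. \<forall>\<^sub>F y in at (x j). v y \<le> h j y + ereal c"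
    and "\<forall>j<k. \<exists>c. \<forall>\<^sub>F y in at (x j). w y \<le> - h j y + ereal c"
    and "\<forall>y\<in>frontier \<Omega>. v y + w y \<le> 0"
  shows "\<forall>y\<in>\<Omega> - x ` {..<k}. v y + w y \<le> 0"
proof
  fix y assume y: "y \<in> \<Omega> - x ` {..<k}"
  show "v y + w y \<le> 0"
  proof (rule punctured_comparison[OF assms(1,2,4) _ _ assms(9-12) _ _ y])
    show "x ` {..<k} \<subseteq> \<Omega>" using assms(6) by blast
    show "v y + w y \<le> 0" if "y \<in> frontier \<Omega>" for y using assms(15) that by blast
  next
    fix \<epsilon> :: real and p assume \<epsilon>: "\<epsilon> > 0" and "p \<in> x ` {..<k}"
    then obtain j where j: "j < k" "p = x j" by blast
    obtain c1 where c1: "\<forall>\<^sub>F y in at p. v y \<le> h j y + ereal c1" using assms(13) j by blast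
    obtain c2 where c2: "\<forall>\<^sub>F y in at p. w y \<le> - h j y + ereal c2" using assms(14) j by blast
    \<comment> \<open>When \<open>h j y\<close> is below \<open>- N\<close>, the first summand makes
      \<open>h j y + c1\<close> nonpositive. The second lets \<open>\<epsilon> * h j y\<close>
      outweigh the constant \<open>(1 + \<epsilon>) * c1 + c2\<close>, which is left once
      \<open>h j y\<close> and \<open>- h j y\<close> have cancelled; off the pole these values are
      finite.\<close>
    define N where "N = \<bar>c1\<bar> + ((1 + \<epsilon>) * \<bar>c1\<bar> + \<bar>c2\<bar>) / \<epsilon>"
    have "polar_singular_harmonic F p (h j)" using assms(8) j by blast
    from c1 c2 polar_singular_harmonic_tendsto[OF this, of "- N"]
    show "\<forall>\<^sub>F y in at p. v y \<le> 0 \<and> ereal (1 + \<epsilon>) * v y + w y \<le> 0"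
    proof eventually_elim
      case (elim y)
      then obtain r where r: "h j y = ereal r" "r < - N" by blast
      have q: "0 \<le> ((1 + \<epsilon>) * \<bar>c1\<bar> + \<bar>c2\<bar>) / \<epsilon>" using \<epsilon> by simp
      have vle: "v y \<le> ereal (r + c1)" and wle: "w y \<le> ereal (c2 - r)" using elim(1,2) by (simp_all add: r(1))
      have "r + c1 \<le> 0" using r(2) q by (simp add: N_def)
      then have "ereal (r + c1) \<le> 0" by (simp add: zero_ereal_def)
      with vle have "v y \<le> 0" by (rule order_trans)
      moreover have "ereal (1 + \<epsilon>) * v y + w y \<le> 0"
      proof -
        have "ereal (1 + \<epsilon>) * v y \<le> ereal (1 + \<epsilon>) * ereal (r + c1)"
          using vle \<epsilon> by (intro ereal_mult_left_mono) auto
        then have "ereal (1 + \<epsilon>) * v y + w y \<le> ereal (1 + \<epsilon>) * ereal (r + c1) + ereal (c2 - r)"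
          using wle by (rule add_mono)
        also have "\<dots> = ereal (\<epsilon> * r + (1 + \<epsilon>) * c1 + c2)" by (simp add: algebra_simps)
        also have "\<dots> \<le> 0"
        proof -
          have "\<epsilon> * r \<le> \<epsilon> * (- (((1 + \<epsilon>) * \<bar>c1\<bar> + \<bar>c2\<bar>) / \<epsilon>))"
            using r(2) \<epsilon> by (intro mult_left_mono) (auto simp: N_def)
          also have "\<dots> = - ((1 + \<epsilon>) * \<bar>c1\<bar> + \<bar>c2\<bar>)" using \<epsilon> by simp
          finally have "\<epsilon> * r \<le> - ((1 + \<epsilon>) * \<bar>c1\<bar> + \<bar>c2\<bar>)" .
          moreover have "(1 + \<epsilon>) * c1 \<le> (1 + \<epsilon>) * \<bar>c1\<bar>" using \<epsilon> by (intro mult_left_mono) auto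
          ultimately have "\<epsilon> * r + (1 + \<epsilon>) * c1 + c2 \<le> 0" by linarith
          then show ?thesis by (simp add: zero_ereal_def)
        qed
        finally show ?thesis .
      qed
      ultimately show ?case ..
    qed
  qed auto
qed

end
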